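(* Let $S=\begin{pmatrix}A&B\\C&D\end{pmatrix}\in\mathrm{Sp}(d,\mathbb{C})$ with $A,B,C,D\in\mathbb{C}^{d\times d}$, and let $T\in\mathcal{B}(L^2(\mathbb{R}^d))$ be a nonzero bounded intertwiner of $S$, i.e. for every $f\in L^2(\mathbb{R}^d)$, $z\in\mathbb{R}^{2d}$, $\tau\in\mathbb{R}$, $$T\rho(z;\tau)f=\rho(Sz;\tau)Tf\quad\text{in }S_{1/2}^{1/2}(\mathbb{R}^d)'.$$ Fix $Z\in\mathfrak{H}_d$ and define $L_Z:=A+BZ$, $N_Z:=C+DZ$. Then $L_Z$ is invertible, the matrix $$\mathcal{M}_S(Z):=N_ZL_Z^{-1}=(C+DZ)(A+BZ)^{-1}$$ belongs to $\mathfrak{H}_d$, and $$T\Phi_Z=c_Z\Phi_{\mathcal{M}_S(Z)}$$ for some $c_Z\in\mathbb{C}\setminus\{0\}$.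
   Context: $J=\begin{pmatrix} O& I\\ -I& O\end{pmatrix}$; $\mathrm{Sp}(d,\mathbb{C})$ is the group of $S\in\mathbb{C}^{2d\times2d}$ with $S^\top JS=J$. The Siegel upper half-space $\mathfrak{H}_d$ is the set of symmetric $Z\in\mathbb{C}^{d\times d}$ with $\mathrm{Im}(Z)>0$ (positive definite). For $Z\in\mathfrak{H}_d$, $\Phi_Z(t)=e^{i\pi Zt\cdot t}$, $t\in\mathbb{R}^d$. $\mathcal{B}(L^2(\mathbb{R}^d))$ is the space of bounded linear operators on $L^2(\mathbb{R}^d)$. Gelfand-Shilov space. For $h>0$, $S_{1/2,h}^{1/2}(\mathbb{R}^d)$ is the Banach space of $\varphi\in C^\infty(\mathbb{R}^d)$ with $\|\varphi\|_h=\sup_{t\in\mathbb{R}^d,\ \beta,\gamma\in\mathbb{N}^d}\frac{|t^\beta\partial^\gamma\varphi(t)|}{h^{|\beta+\gamma|}(\beta!\gamma!)^{1/2}}<\infty$. $S_{1/2}^{1/2}(\mathbb{R}^d)=\bigcup_{h>0}S_{1/2,h}^{1/2}(\mathbb{R}^d)$ with the inductive-limit topology, and $S_{1/2}^{1/2}(\mathbb{R}^d)'$ is its topological dual, with bilinear pairing $\langle u,\varphi\rangle$. Each $f\in L^2(\mathbb{R}^d)$ is identified with the element $\varphi\mapsto\int f\varphi\,dt$ of $S_{1/2}^{1/2}(\mathbb{R}^d)'$. Complex Schrödinger action. $x\cdot y=\sum_j x_jy_j$ is bilinear on $\mathbb{C}^d$. For $x,\xi\in\mathbb{C}^d$ and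 $\varphi\in S_{1/2}^{1/2}(\mathbb{R}^d)$ put $M_\xi\varphi(t)=e^{2\pi i\xi\cdot t}\varphi(t)$ and $T_x\varphi=\mathcal{F}^{-1}\big(e^{-2\pi i x\cdot\omega}\widehat\varphi(\omega)\big)$, with $\mathcal{F}$ the Fourier transform (kernel $e^{-2\pi i\omega\cdot t}$); these are continuous automorphisms of $S_{1/2}^{1/2}(\mathbb{R}^d)$. Extend to the dual by $\langle M_\xi u,\varphi\rangle=\langle u,M_\xi\varphi\rangle$, $\langle T_xu,\varphi\rangle=\langle u,T_{-x}\varphi\rangle$. For $x,\xi\in\mathbb{C}^d$, $\tau\in\mathbb{R}$ set $\rho(x,\xi;\tau)=e^{2\pi i\tau}e^{-i\pi x\cdot\xi}M_\xi T_x$ on $S_{1/2}^{1/2}(\mathbb{R}^d)'$. For real $x,\xi$ and $f\in L^2(\mathbb{R}^d)$ this is the unitary Schrödinger representation $\rho(x,\xi;\tau)f(t)=e^{2\pi i\tau}e^{-i\pi x\cdot\xi}e^{2\pi i\xi\cdot t}f(t-x)$. *)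

theory Defs
  imports "HOL-Analysis.Analysis" "HOL-Probability.Sinc_Integral"
begin

section \<open>Complex symplectic matrices and the Siegel upper half-space\<close>

text \<open>The index type \<^typ>\<open>'d\<close> plays the role of $\{1,\dots,d\}$, and \<^typ>\<open>'d + 'd\<close> that of
  $\{1,\dots,2d\}$.\<close>

definition block_matrix ::
    "'a^'d^'d \<Rightarrow> 'a^'d^'d \<Rightarrow> 'a^'d^'d \<Rightarrow> 'a^'d^'d \<Rightarrow> 'a^('d + 'd)^('d + 'd)" where
  "block_matrix A B C D = (\<chi> i j. case i of
      Inl k \<Rightarrow> (case j of Inl l \<Rightarrow> A $ k $ l | Inr l \<Rightarrow> B $ k $ l)
    | Inr k \<Rightarrow> (case j of Inl l \<Rightarrow> C $ k $ l | Inr l \<Rightarrow> D $ k $ l))"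

definition symplectic_J :: "complex^('d::finite + 'd)^('d + 'd)" where
  "symplectic_J = block_matrix 0 (mat 1) (- mat 1) 0"

definition Sp :: "(complex^('d::finite + 'd)^('d + 'd)) set" where
  "Sp = {S. transpose S ** symplectic_J ** S = symplectic_J}"

definition siegel_upper_half_space :: "(complex^'d::finite^'d) set" where
  "siegel_upper_half_space =
    {Z. transpose Z = Z \<and> (\<forall>x::real^'d. x \<noteq> 0 \<longrightarrow> x \<bullet> ((\<chi> i j. Im (Z $ i $ j)) *v x) > 0)}"

definition complex_vec :: "real^'n \<Rightarrow> complex^'n" where
  "complex_vec t = (\<chi> i. complex_of_real (t $ i))"

text \<open>The dot product is bilinear; the library's inner product on \<^typ>\<open>complex^'n\<close> is real-valued.\<close>

definition cdot :: "complex^'n::finite \<Rightarrow> complex^'n \<Rightarrow> complex" where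
  "cdot x y = (\<Sum>j\<in>UNIV. x $ j * y $ j)"

definition position :: "'a^('d + 'd) \<Rightarrow> 'a^'d" where
  "position z = (\<chi> i. z $ Inl i)"

definition momentum :: "'a^('d + 'd) \<Rightarrow> 'a^'d" where
  "momentum z = (\<chi> i. z $ Inr i)"

definition gaussian :: "complex^'d::finite^'d \<Rightarrow> real^'d \<Rightarrow> complex" where
  "gaussian Z t = exp (\<i> * of_real pi * cdot (Z *v complex_vec t) (complex_vec t))"


section \<open>Square-integrable functions and bounded operators\<close>

text \<open>Elements of $L^2(\mathbb{R}^d)$ are given by Borel measurable representatives, and equality in
  $L^2$ is equality almost everywhere. A bounded operator acts on representatives; its linearity
  is required almost everywhere. Linearity and boundedness together force it to respect equality
  almost everywhere, so it is the same thing as a bounded operator on the quotient.\<close>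

definition L2 :: "(real^'d::finite \<Rightarrow> complex) set" where
  "L2 = {f. f \<in> borel_measurable lborel \<and> integrable lborel (\<lambda>t. (cmod (f t))\<^sup>2)}"

definition L2_norm :: "(real^'d::finite \<Rightarrow> complex) \<Rightarrow> real" where
  "L2_norm f = sqrt (\<integral>t. (cmod (f t))\<^sup>2 \<partial>lborel)"

definition bounded_L2_operator ::
    "((real^'d::finite \<Rightarrow> complex) \<Rightarrow> (real^'d \<Rightarrow> complex)) \<Rightarrow> bool" where
  "bounded_L2_operator T \<longleftrightarrow>
    (\<forall>f\<in>L2. T f \<in> L2) \<and>
    (\<forall>f\<in>L2. \<forall>g\<in>L2. \<forall>a b. AE t in lborel. T (\<lambda>s. a * f s + b * g s) t = a * T f t + b * T g t) \<and>
    (\<exists>K. \<forall>f\<in>L2. L2_norm (T f) \<le> K * L2_norm f)"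

definition nonzero_L2_operator ::
    "((real^'d::finite \<Rightarrow> complex) \<Rightarrow> (real^'d \<Rightarrow> complex)) \<Rightarrow> bool" where
  "nonzero_L2_operator T \<longleftrightarrow> (\<exists>f\<in>L2. \<not> (AE t in lborel. T f t = 0))"


section \<open>The Gelfand--Shilov space and its dual\<close>

definition partial_deriv :: "'d::finite \<Rightarrow> (real^'d \<Rightarrow> complex) \<Rightarrow> real^'d \<Rightarrow> complex" where
  "partial_deriv i \<phi> t = vector_derivative (\<lambda>s. \<phi> (t + s *\<^sub>R axis i 1)) (at 0)"

primrec iter_partial :: "'d::finite list \<Rightarrow> (real^'d \<Rightarrow> complex) \<Rightarrow> real^'d \<Rightarrow> complex" where
  "iter_partial [] \<phi> = \<phi>"
| "iter_partial (i # is) \<phi> = partial_deriv i (iter_partial is \<phi>)"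

definition smooth :: "(real^'d::finite \<Rightarrow> complex) \<Rightarrow> bool" where
  "smooth \<phi> \<longleftrightarrow> (\<forall>is. continuous_on UNIV (iter_partial is \<phi>) \<and>
     (\<forall>i t. (\<lambda>s::real. iter_partial is \<phi> (t + s *\<^sub>R axis i 1)) differentiable at 0))"

text \<open>Multi-indices are functions \<^typ>\<open>'d \<Rightarrow> nat\<close>. By Schwarz's theorem the order of differentiation
  is irrelevant for smooth functions, so any list containing each \<open>i\<close> exactly \<open>\<gamma> i\<close> times will do.\<close>

definition multi_deriv :: "('d::finite \<Rightarrow> nat) \<Rightarrow> (real^'d \<Rightarrow> complex) \<Rightarrow> real^'d \<Rightarrow> complex" where
  "multi_deriv \<gamma> = iter_partial (SOME is. \<forall>i. count_list is i = \<gamma> i)"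

definition GS_quotient ::
    "real \<Rightarrow> (real^'d::finite \<Rightarrow> complex) \<Rightarrow> (real^'d) \<times> ('d \<Rightarrow> nat) \<times> ('d \<Rightarrow> nat) \<Rightarrow> real" where
  "GS_quotient h \<phi> = (\<lambda>(t, \<beta>, \<gamma>).
     cmod (of_real (\<Prod>i\<in>UNIV. (t $ i) ^ \<beta> i) * multi_deriv \<gamma> \<phi> t) /
     (h ^ (\<Sum>i\<in>UNIV. \<beta> i + \<gamma> i) * sqrt ((\<Prod>i\<in>UNIV. fact (\<beta> i)) * (\<Prod>i\<in>UNIV. fact (\<gamma> i)))))"

definition GS_norm :: "real \<Rightarrow> (real^'d::finite \<Rightarrow> complex) \<Rightarrow> real" where
  "GS_norm h \<phi> = (SUP p. GS_quotient h \<phi> p)"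

definition GS_step :: "real \<Rightarrow> (real^'d::finite \<Rightarrow> complex) set" where
  "GS_step h = {\<phi>. smooth \<phi> \<and> bdd_above (range (GS_quotient h \<phi>))}"

definition GS :: "(real^'d::finite \<Rightarrow> complex) set" where
  "GS = (\<Union>h\<in>{0<..}. GS_step h)"

definition absolutely_convex :: "('a \<Rightarrow> complex) set \<Rightarrow> bool" where
  "absolutely_convex V \<longleftrightarrow>
    (\<forall>\<phi>\<in>V. \<forall>\<psi>\<in>V. \<forall>a b. cmod a + cmod b \<le> 1 \<longrightarrow> (\<lambda>t. a * \<phi> t + b * \<psi> t) \<in> V)"

text \<open>The locally convex inductive limit topology: a base of neighbourhoods of zero consists of the
  absolutely convex sets whose trace on each step is a neighbourhood of zero in that Banach space.\<close>

definition GS_nhd0 :: "(real^'d::finite \<Rightarrow> complex) set \<Rightarrow> bool" where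
  "GS_nhd0 V \<longleftrightarrow> V \<subseteq> GS \<and> absolutely_convex V \<and>
    (\<forall>h>0. \<exists>e>0. \<forall>\<phi>\<in>GS_step h. GS_norm h \<phi> < e \<longrightarrow> \<phi> \<in> V)"

definition GS_open :: "(real^'d::finite \<Rightarrow> complex) set \<Rightarrow> bool" where
  "GS_open U \<longleftrightarrow> U \<subseteq> GS \<and> (\<forall>\<phi>\<in>U. \<exists>V. GS_nhd0 V \<and> (\<forall>\<psi>\<in>V. (\<lambda>t. \<phi> t + \<psi> t) \<in> U))"

definition GS_topology :: "(real^'d::finite \<Rightarrow> complex) topology" where
  "GS_topology = topology GS_open"

text \<open>Functionals are total functions in HOL, so only their values on \<^term>\<open>GS\<close> are meaningful, and
  equality in the dual is agreement on \<^term>\<open>GS\<close>.\<close>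

definition GS_dual :: "((real^'d::finite \<Rightarrow> complex) \<Rightarrow> complex) set" where
  "GS_dual = {u. (\<forall>\<phi>\<in>GS. \<forall>\<psi>\<in>GS. \<forall>a b. u (\<lambda>t. a * \<phi> t + b * \<psi> t) = a * u \<phi> + b * u \<psi>) \<and>
                 continuous_map GS_topology euclidean u}"

definition GS_dual_eq ::
    "((real^'d::finite \<Rightarrow> complex) \<Rightarrow> complex) \<Rightarrow> ((real^'d \<Rightarrow> complex) \<Rightarrow> complex) \<Rightarrow> bool" where
  "GS_dual_eq u v \<longleftrightarrow> u \<in> GS_dual \<and> v \<in> GS_dual \<and> (\<forall>\<phi>\<in>GS. u \<phi> = v \<phi>)"

definition L2_functional :: "(real^'d::finite \<Rightarrow> complex) \<Rightarrow> (real^'d \<Rightarrow> complex) \<Rightarrow> complex" where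
  "L2_functional f = (\<lambda>\<phi>. \<integral>t. f t * \<phi> t \<partial>lborel)"


section \<open>The Schroedinger representation and its complex extension\<close>

definition fourier :: "(real^'d::finite \<Rightarrow> complex) \<Rightarrow> real^'d \<Rightarrow> complex" where
  "fourier \<phi> \<omega> = (\<integral>t. exp (- 2 * of_real pi * \<i> * of_real (\<omega> \<bullet> t)) * \<phi> t \<partial>lborel)"

definition inverse_fourier :: "(real^'d::finite \<Rightarrow> complex) \<Rightarrow> real^'d \<Rightarrow> complex" where
  "inverse_fourier \<psi> t = (\<integral>\<omega>. exp (2 * of_real pi * \<i> * of_real (\<omega> \<bullet> t)) * \<psi> \<omega> \<partial>lborel)"

definition modulation :: "complex^'d::finite \<Rightarrow> (real^'d \<Rightarrow> complex) \<Rightarrow> real^'d \<Rightarrow> complex" where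
  "modulation \<xi> \<phi> t = exp (2 * of_real pi * \<i> * cdot \<xi> (complex_vec t)) * \<phi> t"

definition translation :: "complex^'d::finite \<Rightarrow> (real^'d \<Rightarrow> complex) \<Rightarrow> real^'d \<Rightarrow> complex" where
  "translation x \<phi> =
    inverse_fourier (\<lambda>\<omega>. exp (- 2 * of_real pi * \<i> * cdot x (complex_vec \<omega>)) * fourier \<phi> \<omega>)"

definition modulation_dual :: "complex^'d::finite \<Rightarrow>
    ((real^'d \<Rightarrow> complex) \<Rightarrow> complex) \<Rightarrow> (real^'d \<Rightarrow> complex) \<Rightarrow> complex" where
  "modulation_dual \<xi> u = (\<lambda>\<phi>. u (modulation \<xi> \<phi>))"

definition translation_dual :: "complex^'d::finite \<Rightarrow>
    ((real^'d \<Rightarrow> complex) \<Rightarrow> complex) \<Rightarrow> (real^'d \<Rightarrow> complex) \<Rightarrow> complex" where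
  "translation_dual x u = (\<lambda>\<phi>. u (translation (- x) \<phi>))"

definition rho_dual :: "complex^('d::finite + 'd) \<Rightarrow> real \<Rightarrow>
    ((real^'d \<Rightarrow> complex) \<Rightarrow> complex) \<Rightarrow> (real^'d \<Rightarrow> complex) \<Rightarrow> complex" where
  "rho_dual z \<tau> u = (\<lambda>\<phi>. exp (2 * of_real pi * \<i> * of_real \<tau>) *
     exp (- \<i> * of_real pi * cdot (position z) (momentum z)) *
     modulation_dual (momentum z) (translation_dual (position z) u) \<phi>)"

definition rho_L2 :: "real^('d::finite + 'd) \<Rightarrow> real \<Rightarrow> (real^'d \<Rightarrow> complex) \<Rightarrow> real^'d \<Rightarrow> complex" where
  "rho_L2 z \<tau> f t = exp (2 * of_real pi * \<i> * of_real \<tau>) *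
     exp (- \<i> * of_real pi * of_real (position z \<bullet> momentum z)) *
     exp (2 * of_real pi * \<i> * of_real (momentum z \<bullet> t)) * f (t - position z)"

definition intertwiner :: "complex^('d::finite + 'd)^('d + 'd) \<Rightarrow>
    ((real^'d \<Rightarrow> complex) \<Rightarrow> (real^'d \<Rightarrow> complex)) \<Rightarrow> bool" where
  "intertwiner S T \<longleftrightarrow> (\<forall>f\<in>L2. \<forall>z \<tau>.
     GS_dual_eq (L2_functional (T (rho_L2 z \<tau> f)))
                (rho_dual (S *v complex_vec z) \<tau> (L2_functional (T f))))"


section \<open>Consistency of the definitions\<close>

lemma iter_partial_lincomb:
  assumes "smooth \<phi>" "smooth \<psi>"
  shows "iter_partial is (\<lambda>t. a * \<phi> t + b * \<psi> t) =
           (\<lambda>t. a * iter_partial is \<phi> t + b * iter_partial is \<psi> t)"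
proof (induction "is")
  case (Cons i "is")
  have "partial_deriv i (\<lambda>t. a * iter_partial is \<phi> t + b * iter_partial is \<psi> t) t =
        a * partial_deriv i (iter_partial is \<phi>) t + b * partial_deriv i (iter_partial is \<psi>) t" for t
  proof -
    have "((\<lambda>s. iter_partial is \<eta> (t + s *\<^sub>R axis i 1)) has_vector_derivative
             partial_deriv i (iter_partial is \<eta>) t) (at 0)" if "smooth \<eta>" for \<eta>
      using that unfolding smooth_def partial_deriv_def vector_derivative_works by blast
    from this[OF assms(1)] this[OF assms(2)] show ?thesis
      unfolding partial_deriv_def[of i "\<lambda>t. a * _ t + b * _ t"]
      by (intro vector_derivative_at derivative_intros) auto
  qed
  then show ?case using Cons by auto
qed simp

lemma smooth_lincomb:
  fixes \<phi> \<psi> :: "real^'d::finite \<Rightarrow> complex"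
  assumes "smooth \<phi>" "smooth \<psi>"
  shows "smooth (\<lambda>t. a * \<phi> t + b * \<psi> t)"
  unfolding smooth_def iter_partial_lincomb[OF assms]
proof (intro allI conjI)
  fix "is" :: "'d list" and i t
  have "continuous_on UNIV (iter_partial is \<phi>)" "continuous_on UNIV (iter_partial is \<psi>)"
    and "(\<lambda>s::real. iter_partial is \<phi> (t + s *\<^sub>R axis i 1)) differentiable at 0"
      "(\<lambda>s::real. iter_partial is \<psi> (t + s *\<^sub>R axis i 1)) differentiable at 0"
    using assms unfolding smooth_def by blast+
  then show "continuous_on UNIV (\<lambda>t. a * iter_partial is \<phi> t + b * iter_partial is \<psi> t)"
    and "(\<lambda>s::real. a * iter_partial is \<phi> (t + s *\<^sub>R axis i 1) +
           b * iter_partial is \<psi> (t + s *\<^sub>R axis i 1)) differentiable at 0"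
    by (auto intro!: continuous_intros differentiable_add differentiable_mult)
qed

lemma multi_deriv_lincomb:
  assumes "smooth \<phi>" "smooth \<psi>"
  shows "multi_deriv \<gamma> (\<lambda>t. a * \<phi> t + b * \<psi> t) t = a * multi_deriv \<gamma> \<phi> t + b * multi_deriv \<gamma> \<psi> t"
  unfolding multi_deriv_def iter_partial_lincomb[OF assms] ..

lemma ex_count_list: "\<exists>is. \<forall>i. count_list is i = (\<gamma> :: 'd::finite \<Rightarrow> nat) i"
proof -
  obtain xs where "set xs = (UNIV::'d set)" "distinct xs"
    using finite_distinct_list[of "UNIV::'d set"] by auto
  moreover have "distinct ys \<Longrightarrow>
      count_list (concat (map (\<lambda>j. replicate (\<gamma> j) j) ys)) i = (if i \<in> set ys then \<gamma> i else 0)"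
    for ys :: "'d list" and i
  proof (induction ys)
    case (Cons j ys)
    have "count_list (replicate n j) i = (if i = j then n else 0)" for n by (induction n) auto
    then show ?case using Cons by (auto simp: count_list_append)
  qed simp
  ultimately show ?thesis by (intro exI[of _ "concat (map (\<lambda>j. replicate (\<gamma> j) j) xs)"]) auto
qed

lemma multi_deriv_0: "multi_deriv (\<lambda>_. 0) \<phi> = \<phi>"
proof -
  have "\<forall>i. count_list (SOME is. \<forall>i::'a. count_list is i = 0) i = 0"
    by (rule someI_ex) (rule ex_count_list[of "\<lambda>_. 0"])
  then have "(SOME is. \<forall>i::'a. count_list is i = 0) = []"
    by (metis count_list_0_iff list.set_intros(1) neq_Nil_conv)
  then show ?thesis unfolding multi_deriv_def by simp
qed

lemma GS_quotient_lincomb: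
  assumes "smooth \<phi>" "smooth \<psi>" "h > 0"
  shows "GS_quotient h (\<lambda>t. a * \<phi> t + b * \<psi> t) p \<le>
           cmod a * GS_quotient h \<phi> p + cmod b * GS_quotient h \<psi> p"
proof (cases p)
  case (fields t \<beta> \<gamma>)
  define P where "P = complex_of_real (\<Prod>i\<in>UNIV. (t $ i) ^ \<beta> i)"
  define Q where "Q = h ^ (\<Sum>i\<in>UNIV. \<beta> i + \<gamma> i) *
    sqrt ((\<Prod>i\<in>UNIV. fact (\<beta> i)) * (\<Prod>i\<in>UNIV. fact (\<gamma> i)))"
  have Q: "Q > 0" using assms(3) unfolding Q_def
    by (auto intro!: mult_pos_pos prod_pos)
  have "cmod (P * (a * multi_deriv \<gamma> \<phi> t + b * multi_deriv \<gamma> \<psi> t)) \<le>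
        cmod a * cmod (P * multi_deriv \<gamma> \<phi> t) + cmod b * cmod (P * multi_deriv \<gamma> \<psi> t)"
    by (metis (no_types, lifting) distrib_left mult.left_commute norm_mult norm_triangle_ineq)
  then have "cmod (P * (a * multi_deriv \<gamma> \<phi> t + b * multi_deriv \<gamma> \<psi> t)) / Q \<le>
        cmod a * (cmod (P * multi_deriv \<gamma> \<phi> t) / Q) + cmod b * (cmod (P * multi_deriv \<gamma> \<psi> t) / Q)"
    using Q by (simp add: divide_right_mono flip: add_divide_distrib)
  then show ?thesis
    unfolding GS_quotient_def fields prod.case multi_deriv_lincomb[OF assms(1,2)] P_def Q_def .
qed

lemma GS_step_lincomb:
  assumes "\<phi> \<in> GS_step h" "\<psi> \<in> GS_step h" "h > 0"
  shows "(\<lambda>t. a * \<phi> t + b * \<psi> t) \<in> GS_step h"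
proof -
  obtain K L where K: "\<And>p. GS_quotient h \<phi> p \<le> K" and L: "\<And>p. GS_quotient h \<psi> p \<le> L"
    using assms unfolding GS_step_def bdd_above_def by auto
  have s: "smooth \<phi>" "smooth \<psi>" using assms unfolding GS_step_def by auto
  have "GS_quotient h (\<lambda>t. a * \<phi> t + b * \<psi> t) p \<le> cmod a * K + cmod b * L" for p
    by (rule order_trans[OF GS_quotient_lincomb[OF s assms(3)]])
      (intro add_mono mult_left_mono K L norm_ge_zero)
  then show ?thesis unfolding GS_step_def bdd_above_def using smooth_lincomb[OF s] by blast
qed

lemma GS_step_mono:
  assumes "0 < h" "h \<le> k"
  shows "GS_step h \<subseteq> GS_step k"
proof
  fix \<phi> :: "real^'d \<Rightarrow> complex" assume \<phi>: "\<phi> \<in> GS_step h"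
  have "GS_quotient k \<phi> p \<le> GS_quotient h \<phi> p" for p
  proof (cases p)
    case (fields t \<beta> \<gamma>)
    have "(0::real) < (\<Prod>i\<in>UNIV. fact (\<beta> i)) * (\<Prod>i\<in>UNIV. fact (\<gamma> i))"
      by (intro mult_pos_pos prod_pos) auto
    then show ?thesis unfolding GS_quotient_def fields prod.case using assms
      by (intro divide_left_mono mult_right_mono power_mono mult_pos_pos) auto
  qed
  moreover obtain M where "\<And>p. GS_quotient h \<phi> p \<le> M"
    using \<phi> unfolding GS_step_def bdd_above_def by auto
  ultimately have "GS_quotient k \<phi> p \<le> M" for p using order_trans by blast
  then show "\<phi> \<in> GS_step k" using \<phi> unfolding GS_step_def bdd_above_def by blast
qed

lemma GS_lincomb:
  assumes "\<phi> \<in> GS" "\<psi> \<in> GS"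
  shows "(\<lambda>t. a * \<phi> t + b * \<psi> t) \<in> GS"
proof -
  obtain h k where hk: "h > 0" "k > 0" "\<phi> \<in> GS_step h" "\<psi> \<in> GS_step k"
    using assms unfolding GS_def by auto
  then have "\<phi> \<in> GS_step (max h k)" "\<psi> \<in> GS_step (max h k)"
    using GS_step_mono[of h "max h k"] GS_step_mono[of k "max h k"] by auto
  then have "(\<lambda>t. a * \<phi> t + b * \<psi> t) \<in> GS_step (max h k)" using hk by (intro GS_step_lincomb) auto
  then show ?thesis using hk unfolding GS_def by (auto intro!: bexI[of _ "max h k"])
qed

lemma GS_nhd0_Int:
  assumes "GS_nhd0 V" "GS_nhd0 W"
  shows "GS_nhd0 (V \<inter> W)"
proof -
  have "\<exists>e>0. \<forall>\<phi>\<in>GS_step h. GS_norm h \<phi> < e \<longrightarrow> \<phi> \<in> V \<inter> W" if "h > 0" for h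
  proof -
    obtain e1 e2 where "e1 > 0" "e2 > 0" "\<forall>\<phi>\<in>GS_step h. GS_norm h \<phi> < e1 \<longrightarrow> \<phi> \<in> V"
      "\<forall>\<phi>\<in>GS_step h. GS_norm h \<phi> < e2 \<longrightarrow> \<phi> \<in> W"
      using assms \<open>h > 0\<close> unfolding GS_nhd0_def by blast
    then show ?thesis by (intro exI[of _ "min e1 e2"]) auto
  qed
  then show ?thesis using assms unfolding GS_nhd0_def absolutely_convex_def by auto
qed

lemma GS_nhd0_GS: "GS_nhd0 (GS :: (real^'d::finite \<Rightarrow> complex) set)"
proof -
  have "\<exists>e>0. \<forall>\<phi>\<in>GS_step h. GS_norm h \<phi> < e \<longrightarrow> (\<phi> :: real^'d \<Rightarrow> complex) \<in> GS" if "h > 0" for h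
    using that by (intro exI[of _ 1]) (auto simp: GS_def)
  then show ?thesis unfolding GS_nhd0_def absolutely_convex_def by (simp add: GS_lincomb)
qed

lemma openin_GS_topology: "openin GS_topology = (GS_open :: (real^'d::finite \<Rightarrow> complex) set \<Rightarrow> bool)"
proof -
  have "GS_open (U \<inter> W)" if U: "GS_open U" and W: "GS_open W" for U W :: "(real^'d \<Rightarrow> complex) set"
    unfolding GS_open_def
  proof (intro conjI ballI)
    show "U \<inter> W \<subseteq> GS" using U unfolding GS_open_def by auto
    fix \<phi> assume "\<phi> \<in> U \<inter> W"
    then obtain V1 V2 where "GS_nhd0 V1" "\<forall>\<psi>\<in>V1. (\<lambda>t. \<phi> t + \<psi> t) \<in> U"
      "GS_nhd0 V2" "\<forall>\<psi>\<in>V2. (\<lambda>t. \<phi> t + \<psi> t) \<in> W"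
      using U W unfolding GS_open_def by blast
    then show "\<exists>V. GS_nhd0 V \<and> (\<forall>\<psi>\<in>V. (\<lambda>t. \<phi> t + \<psi> t) \<in> U \<inter> W)"
      by (intro exI[of _ "V1 \<inter> V2"]) (auto intro: GS_nhd0_Int)
  qed
  moreover have "GS_open (\<Union>K)" if "\<forall>U\<in>K. GS_open U" for K :: "(real^'d \<Rightarrow> complex) set set"
    unfolding GS_open_def
  proof (intro conjI ballI)
    show "\<Union>K \<subseteq> GS" using that unfolding GS_open_def by auto
    fix \<phi> assume "\<phi> \<in> \<Union>K"
    then obtain U where U: "U \<in> K" "\<phi> \<in> U" by auto
    then have "GS_open U" using that by blast
    then obtain V where "GS_nhd0 V" "\<forall>\<psi>\<in>V. (\<lambda>t. \<phi> t + \<psi> t) \<in> U"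
      using U(2) unfolding GS_open_def by blast
    then show "\<exists>V. GS_nhd0 V \<and> (\<forall>\<psi>\<in>V. (\<lambda>t. \<phi> t + \<psi> t) \<in> \<Union>K)"
      using U(1) by blast
  qed
  ultimately have "istopology (GS_open :: (real^'d \<Rightarrow> complex) set \<Rightarrow> bool)"
    unfolding istopology_def by blast
  then show ?thesis unfolding GS_topology_def by (rule topology_inverse')
qed

lemma topspace_GS_topology: "topspace GS_topology = (GS :: (real^'d::finite \<Rightarrow> complex) set)"
proof -
  have "GS_open (GS :: (real^'d \<Rightarrow> complex) set)" unfolding GS_open_def
    using GS_nhd0_GS GS_lincomb[of _ _ 1 1] by auto
  then have "openin GS_topology (GS :: (real^'d \<Rightarrow> complex) set)" by (simp add: openin_GS_topology)
  moreover have "U \<subseteq> GS" if "openin GS_topology U" for U :: "(real^'d \<Rightarrow> complex) set"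
    using that by (simp add: openin_GS_topology GS_open_def)
  ultimately show ?thesis by (intro subset_antisym) (simp_all add: openin_subset)
qed

lemma GS_quotient_le_norm:
  assumes "\<phi> \<in> GS_step h"
  shows "GS_quotient h \<phi> p \<le> GS_norm h \<phi>"
  using assms unfolding GS_norm_def GS_step_def by (auto intro: cSUP_upper)

definition decay :: "real^'d::finite \<Rightarrow> real" where
  "decay t = (\<Prod>i\<in>UNIV. inverse (1 + (t $ i)\<^sup>2))"

lemma decay_pos: "decay t > 0"
  unfolding decay_def by (intro prod_pos) (auto intro!: add_pos_nonneg)

lemma decay_le_1: "decay t \<le> 1"
  unfolding decay_def by (intro prod_le_1) (auto intro!: inverse_le_1_iff[THEN iffD2])

lemma integrable_decay: "integrable lborel (decay :: real^'d::finite \<Rightarrow> real)"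
proof (rule integrableI_bounded)
  show "decay \<in> borel_measurable lborel" unfolding decay_def by measurable
  have one: "integrable lborel (\<lambda>x::real. inverse (1 + x\<^sup>2))"
    using integrable_inverse_1_plus_square by (simp add: set_integrable_def)
  have fin: "(\<integral>\<^sup>+x. ennreal (inverse (1 + (x::real)\<^sup>2)) \<partial>lborel) < \<infinity>"
    using one unfolding integrable_iff_bounded by simp
  have eq: "(\<integral>\<^sup>+t. (\<Prod>b\<in>Basis. ennreal (inverse (1 + ((t::real^'d) \<bullet> b)\<^sup>2))) \<partial>lborel) =
     (\<Prod>b\<in>(Basis :: (real^'d) set). \<integral>\<^sup>+x. ennreal (inverse (1 + (x::real)\<^sup>2)) \<partial>lborel)"
    by (rule nn_integral_lborel_prod) auto
  have "ennreal (norm (decay t)) = (\<Prod>b\<in>Basis. ennreal (inverse (1 + (t \<bullet> b)\<^sup>2)))" for t :: "real^'d"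
  proof -
    have inj: "inj (\<lambda>i::'d. axis i (1::real))" by (auto simp: inj_def axis_eq_axis)
    have B: "(Basis :: (real^'d) set) = range (\<lambda>i. axis i 1)" by (auto simp: Basis_vec_def)
    have "(\<Prod>b\<in>Basis. inverse (1 + (t \<bullet> b)\<^sup>2)) = decay t"
      unfolding decay_def B by (subst prod.reindex[OF inj]) (simp add: inner_axis)
    then show ?thesis using decay_pos[of t]
      by (simp add: prod_ennreal)
  qed
  then show "(\<integral>\<^sup>+t. ennreal (norm (decay t :: real)) \<partial>(lborel :: (real^'d) measure)) < \<infinity>"
    using fin by (simp add: eq power_less_top_ennreal)
qed

lemma GS_step_decay:
  assumes h: "h > 0"
  shows "\<exists>K\<ge>0. \<forall>\<phi>\<in>GS_step h. \<forall>t::real^'d::finite. cmod (\<phi> t) \<le> K * GS_norm h \<phi> * decay t"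
proof -
  define \<beta> :: "'d set \<Rightarrow> 'd \<Rightarrow> nat" where "\<beta> = (\<lambda>J i. if i \<in> J then 2 else 0)"
  define w where "w = (\<lambda>J::'d set. h ^ (\<Sum>i\<in>UNIV. \<beta> J i + 0) *
     sqrt ((\<Prod>i\<in>UNIV. fact (\<beta> J i)) * (\<Prod>i\<in>(UNIV::'d set). fact (0::nat))))"
  have w: "w J > 0" for J unfolding w_def using h by (auto intro!: mult_pos_pos prod_pos)
  have "cmod (\<phi> t) \<le> (\<Sum>J\<in>UNIV. w J) * GS_norm h \<phi> * decay t"
    if \<phi>: "\<phi> \<in> GS_step h" for \<phi> and t :: "real^'d"
  proof -
    have trm: "(\<Prod>i\<in>J. (t $ i)\<^sup>2) * cmod (\<phi> t) \<le> w J * GS_norm h \<phi>" for J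
    proof -
      have P: "(\<Prod>i\<in>UNIV. (t $ i) ^ \<beta> J i) = (\<Prod>i\<in>J. (t $ i)\<^sup>2)"
        by (rule prod.mono_neutral_cong_right) (auto simp: \<beta>_def)
      have "GS_quotient h \<phi> (t, \<beta> J, \<lambda>_. 0) = cmod (of_real (\<Prod>i\<in>J. (t $ i)\<^sup>2) * \<phi> t) / w J"
        unfolding GS_quotient_def prod.case multi_deriv_0 w_def P ..
      also have "cmod (of_real (\<Prod>i\<in>J. (t $ i)\<^sup>2) * \<phi> t) = (\<Prod>i\<in>J. (t $ i)\<^sup>2) * cmod (\<phi> t)"
        unfolding norm_mult norm_of_real by (simp add: prod_nonneg)
      finally show ?thesis
        using GS_quotient_le_norm[OF \<phi>, of "(t, \<beta> J, \<lambda>_. 0)"] w[of J]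
        by (simp add: pos_divide_le_eq mult.commute)
    qed
    have "(\<Prod>i\<in>UNIV. 1 + (t $ i)\<^sup>2) = (\<Sum>J\<in>UNIV. \<Prod>i\<in>J. (t $ i)\<^sup>2)"
      using prod_add[of "UNIV::'d set" "\<lambda>i. (t $ i)\<^sup>2" "\<lambda>_. 1"] by (simp add: add.commute)
    then have "(\<Prod>i\<in>UNIV. 1 + (t $ i)\<^sup>2) * cmod (\<phi> t) \<le> (\<Sum>J\<in>UNIV. w J) * GS_norm h \<phi>"
      by (simp add: sum_distrib_right) (intro sum_mono trm)
    then have "decay t * ((\<Prod>i\<in>UNIV. 1 + (t $ i)\<^sup>2) * cmod (\<phi> t)) \<le>
        decay t * ((\<Sum>J\<in>UNIV. w J) * GS_norm h \<phi>)"
      using decay_pos[of t] by (intro mult_left_mono) auto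
    moreover have "decay t * (\<Prod>i\<in>UNIV. 1 + (t $ i)\<^sup>2) = 1"
    proof -
      have "1 + x\<^sup>2 \<noteq> 0" for x :: real by (metis add_pos_nonneg less_irrefl zero_le_power2 zero_less_one)
      then show ?thesis unfolding decay_def prod.distrib[symmetric] by simp
    qed
    ultimately show ?thesis by (simp add: mult.assoc[symmetric]) (simp add: ac_simps)
  qed
  moreover have "(\<Sum>J\<in>UNIV. w J) \<ge> 0" using w by (intro sum_nonneg) (auto simp: less_imp_le)
  ultimately show ?thesis by blast
qed

lemma L2_times_decay:
  assumes f: "f \<in> L2"
  shows "integrable lborel (\<lambda>t. cmod (f t) * decay t)"
proof (rule Bochner_Integration.integrable_bound)
  show "integrable lborel (\<lambda>t. (cmod (f t))\<^sup>2 + decay t)"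
    using f integrable_decay unfolding L2_def by auto
  show "(\<lambda>t. cmod (f t) * decay t) \<in> borel_measurable lborel"
    using f borel_measurable_integrable[OF integrable_decay] unfolding L2_def
    by (intro borel_measurable_times) auto
  have "cmod (f t) * decay t \<le> (cmod (f t))\<^sup>2 + decay t" for t
  proof (cases "cmod (f t) \<le> 1")
    case True
    then have "cmod (f t) * decay t \<le> decay t" using decay_pos[of t] by (simp add: mult_le_cancel_right1)
    then show ?thesis by (simp add: add_increasing)
  next
    case False
    then have "cmod (f t) * decay t \<le> cmod (f t) * cmod (f t)"
      using decay_le_1[of t] by (intro mult_left_mono) auto
    then have "cmod (f t) * decay t \<le> (cmod (f t))\<^sup>2" by (simp add: power2_eq_square)
    then show ?thesis using decay_pos[of t] by linarith
  qed
  then show "AE t in lborel. norm (cmod (f t) * decay t) \<le> norm ((cmod (f t))\<^sup>2 + decay t)"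
    by (intro AE_I2) (simp add: abs_mult abs_of_pos[OF decay_pos] abs_of_nonneg add_nonneg_nonneg less_imp_le[OF decay_pos])
qed

lemma L2_functional_bound:
  fixes f :: "real^'d::finite \<Rightarrow> complex"
  assumes f: "f \<in> L2" and h: "h > 0"
  shows "\<exists>K\<ge>0. \<forall>\<phi>\<in>GS_step h. integrable lborel (\<lambda>t. f t * \<phi> t) \<and>
           cmod (L2_functional f \<phi>) \<le> K * GS_norm h \<phi>"
proof -
  obtain K where K: "K \<ge> 0"
    and le: "\<forall>\<phi>\<in>GS_step h. \<forall>t::real^'d. cmod (\<phi> t) \<le> K * GS_norm h \<phi> * decay t"
    using GS_step_decay[OF h] by blast
  define I where "I = (\<integral>t. cmod (f t) * decay t \<partial>lborel)"
  have I: "I \<ge> 0" unfolding I_def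
    by (intro integral_nonneg_AE AE_I2 mult_nonneg_nonneg less_imp_le[OF decay_pos]) auto
  have "integrable lborel (\<lambda>t. f t * \<phi> t) \<and> cmod (L2_functional f \<phi>) \<le> (K * I) * GS_norm h \<phi>"
    if \<phi>: "\<phi> \<in> GS_step h" for \<phi>
  proof -
    define c where "c = K * GS_norm h \<phi>"
    have "continuous_on UNIV (iter_partial [] \<phi>)" using \<phi> unfolding GS_step_def smooth_def by blast
    then have m: "\<phi> \<in> borel_measurable borel" by (auto intro: borel_measurable_continuous_onI)
    have b: "norm (f t * \<phi> t) \<le> c * (cmod (f t) * decay t)" for t
      using mult_left_mono[OF bspec[OF le \<phi>, THEN spec, of t], of "cmod (f t)"]
      unfolding c_def norm_mult by (simp add: ac_simps)
    have gi: "integrable lborel (\<lambda>t. c * (cmod (f t) * decay t))"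
      using L2_times_decay[OF f] by simp
    have i: "integrable lborel (\<lambda>t. f t * \<phi> t)"
    proof (rule Bochner_Integration.integrable_bound[OF gi])
      show "(\<lambda>t. f t * \<phi> t) \<in> borel_measurable lborel" using f m unfolding L2_def by auto
      show "AE t in lborel. norm (f t * \<phi> t) \<le> norm (c * (cmod (f t) * decay t))"
        using b by (intro AE_I2) (metis abs_ge_self order_trans real_norm_def)
    qed
    have "cmod (L2_functional f \<phi>) \<le> (\<integral>t. c * (cmod (f t) * decay t) \<partial>lborel)"
      unfolding L2_functional_def by (rule Bochner_Integration.integral_norm_bound_integral[OF i gi b])
    also have "\<dots> = (K * I) * GS_norm h \<phi>" unfolding I_def c_def by (simp add: mult.commute)
    finally show ?thesis using i by blast
  qed
  then show ?thesis using K I by (intro exI[of _ "K * I"]) auto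
qed

lemma L2_functional_lincomb:
  assumes f: "f \<in> L2" and "\<phi> \<in> GS" "\<psi> \<in> GS"
  shows "L2_functional f (\<lambda>t. a * \<phi> t + b * \<psi> t) = a * L2_functional f \<phi> + b * L2_functional f \<psi>"
proof -
  have "integrable lborel (\<lambda>t. f t * \<eta> t)" if "\<eta> \<in> GS" for \<eta>
    using that L2_functional_bound[OF f] unfolding GS_def by blast
  then have i: "integrable lborel (\<lambda>t. f t * \<phi> t)" "integrable lborel (\<lambda>t. f t * \<psi> t)"
    using assms by auto
  have "(\<lambda>t. f t * (a * \<phi> t + b * \<psi> t)) = (\<lambda>t. a * (f t * \<phi> t) + b * (f t * \<psi> t))"
    by (simp add: algebra_simps)
  then show ?thesis using i unfolding L2_functional_def by simp
qed

lemma L2_functional_in_GS_dual: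
  assumes f: "f \<in> L2"
  shows "L2_functional f \<in> GS_dual"
proof -
  let ?u = "L2_functional f"
  have nhd: "GS_nhd0 {\<psi>\<in>GS. cmod (?u \<psi>) < e}" if e: "e > 0" for e
    unfolding GS_nhd0_def absolutely_convex_def
  proof (intro conjI ballI allI impI)
    fix \<phi> \<psi> and a b :: complex
    assume \<phi>: "\<phi> \<in> {\<psi>\<in>GS. cmod (?u \<psi>) < e}" and \<psi>: "\<psi> \<in> {\<psi>\<in>GS. cmod (?u \<psi>) < e}"
      and ab: "cmod a + cmod b \<le> 1"
    define m where "m = max (cmod (?u \<phi>)) (cmod (?u \<psi>))"
    have "cmod (?u (\<lambda>t. a * \<phi> t + b * \<psi> t)) \<le> cmod a * cmod (?u \<phi>) + cmod b * cmod (?u \<psi>)"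
      using \<phi> \<psi> L2_functional_lincomb[OF f] by (simp add: norm_triangle_le norm_mult)
    also have "\<dots> \<le> cmod a * m + cmod b * m"
      unfolding m_def by (intro add_mono mult_left_mono) auto
    also have "\<dots> \<le> 1 * m"
      unfolding distrib_right[symmetric] using ab by (intro mult_right_mono) (auto simp: m_def le_max_iff_disj)
    also have "\<dots> < e" using \<phi> \<psi> by (auto simp: m_def)
    finally show "(\<lambda>t. a * \<phi> t + b * \<psi> t) \<in> {\<psi>\<in>GS. cmod (?u \<psi>) < e}"
      using \<phi> \<psi> GS_lincomb by auto
  next
    fix h :: real assume h: "h > 0"
    obtain K where K: "K \<ge> 0" "\<forall>\<phi>\<in>GS_step h. cmod (?u \<phi>) \<le> K * GS_norm h \<phi>"
      using L2_functional_bound[OF f h] by blast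
    have "cmod (?u \<phi>) < e" if "\<phi> \<in> GS_step h" "GS_norm h \<phi> < e / (K + 1)" for \<phi>
    proof -
      have "0 \<le> GS_quotient h \<phi> (0, \<lambda>_. 0, \<lambda>_. 0)" using h
        by (auto simp: GS_quotient_def)
      then have n: "0 \<le> GS_norm h \<phi>" using GS_quotient_le_norm[OF that(1)] order_trans by blast
      have "cmod (?u \<phi>) \<le> K * GS_norm h \<phi>" using K that by auto
      also have "\<dots> \<le> (K + 1) * GS_norm h \<phi>" using n by (intro mult_right_mono) auto
      also have "\<dots> < e" using that(2) K(1) by (simp add: field_simps)
      finally show ?thesis .
    qed
    moreover have "e / (K + 1) > 0" using e K by simp
    ultimately show "\<exists>r>0. \<forall>\<phi>\<in>GS_step h. GS_norm h \<phi> < r \<longrightarrow> \<phi> \<in> {\<psi>\<in>GS. cmod (?u \<psi>) < e}"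
      using h by (intro exI[of _ "e / (K + 1)"]) (auto simp: GS_def)
  qed auto
  have "GS_open {\<phi>\<in>GS. ?u \<phi> \<in> W}" if W: "open W" for W
    unfolding GS_open_def
  proof (intro conjI ballI)
    fix \<phi> assume \<phi>: "\<phi> \<in> {\<phi>\<in>GS. ?u \<phi> \<in> W}"
    then obtain e where e: "e > 0" "ball (?u \<phi>) e \<subseteq> W" using W open_contains_ball by blast
    have "(\<lambda>t. \<phi> t + \<psi> t) \<in> {\<phi>\<in>GS. ?u \<phi> \<in> W}" if "\<psi> \<in> GS" "cmod (?u \<psi>) < e" for \<psi>
    proof -
      have "?u (\<lambda>t. \<phi> t + \<psi> t) = ?u \<phi> + ?u \<psi>" "(\<lambda>t. \<phi> t + \<psi> t) \<in> GS"
        using L2_functional_lincomb[OF f, of \<phi> \<psi> 1 1] GS_lincomb[of \<phi> \<psi> 1 1] \<phi> that by auto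
      moreover have "?u \<phi> + ?u \<psi> \<in> ball (?u \<phi>) e" using that by (simp add: dist_norm)
      ultimately show ?thesis using e by auto
    qed
    then show "\<exists>V. GS_nhd0 V \<and> (\<forall>\<psi>\<in>V. (\<lambda>t. \<phi> t + \<psi> t) \<in> {\<phi>\<in>GS. ?u \<phi> \<in> W})"
      using nhd[OF e(1)] by blast
  qed auto
  then have "continuous_map GS_topology euclidean ?u"
    unfolding continuous_map_def topspace_GS_topology openin_GS_topology by auto
  then show ?thesis using L2_functional_lincomb[OF f] unfolding GS_dual_def by auto
qed

lemma GS_dual_cong:
  assumes "u \<in> GS_dual" "\<And>\<phi>. \<phi> \<in> GS \<Longrightarrow> v \<phi> = u \<phi>"
  shows "v \<in> GS_dual"
proof -
  have "continuous_map GS_topology euclidean v"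
    using assms unfolding GS_dual_def
    by (auto intro: continuous_map_eq simp: topspace_GS_topology)
  then show ?thesis using assms unfolding GS_dual_def by (simp add: GS_lincomb)
qed

text \<open>For the functionals in \<^const>\<open>intertwiner\<close>, agreement on all test functions already implies
  that both sides belong to the dual, so the membership clauses of \<^const>\<open>GS_dual_eq\<close> are harmless.\<close>

lemma GS_dual_eq_L2_functional:
  assumes "f \<in> L2"
  shows "GS_dual_eq (L2_functional f) v \<longleftrightarrow> (\<forall>\<phi>\<in>GS. L2_functional f \<phi> = v \<phi>)"
  using L2_functional_in_GS_dual[OF assms] GS_dual_cong[of "L2_functional f" v]
  unfolding GS_dual_eq_def by auto

end

theory Submission
  imports Defs "HOL-Complex_Analysis.Cauchy_Integral_Formula" "HOL-Probability.Characteristic_Functions"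
    "HOL-Real_Asymp.Real_Asymp"
begin

text \<open>The Gaussian \<open>\<Phi>\<close> attached to \<open>Z\<close> is annihilated by the infinitesimal Schroedinger operators in the
  complex directions \<open>(w, Z w)\<close>. Differentiating the intertwining relation at \<open>z = 0\<close> in real directions and
  extending complex linearly, \<open>g = T \<Phi>\<close> is weakly annihilated in the directions \<open>(L w, N w)\<close>. It suffices to
  test this against the Gaussians \<open>exp (- \<pi> t \<cdot> t + 2 \<pi> b \<cdot> t)\<close>, on which complex translations are explicit.
  If \<open>L w = 0\<close> and \<open>w \<noteq> 0\<close>, then \<open>N w \<noteq> 0\<close> and \<open>(N w \<cdot> t) g(t) = 0\<close>, so \<open>g = 0\<close>; but then \<open>T\<close> kills all
  modulations of \<open>\<Phi>\<close>, which are total in \<open>L\<^sup>2\<close>, and \<open>T = 0\<close>. Hence \<open>L\<close> is invertible. Integrating the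
  annihilation equation along a line shows that the quotient of \<open>g\<close> by the Gaussian of \<open>M = N L\<^sup>-\<^sup>1\<close> is
  translation invariant, hence constant, and square integrability of \<open>g\<close> forces \<open>Im M\<close> to be positive.\<close>

text \<open>For complex \<open>S z\<close> the relation is only an identity of functionals, and
  \<open>g\<close> is merely square integrable, so \<open>g\<close> can be neither differentiated
  nor translated by a complex vector. Every operation is therefore moved to the test function. The
  Gaussians with parameter \<open>b\<close> are stable, up to constants, under complex translation
  and modulation, so each pairing stays an ordinary integral. Purely imaginary \<open>b\<close>
  already recover \<open>g\<close>, because they give the Fourier transform of \<open>g\<close>
  times a real Gaussian. The intertwining relation is available for real \<open>z\<close> only and
  is exponential in \<open>z\<close>; its derivative at 0 is linear in \<open>z\<close>, and only
  this can be combined with complex coefficients to reach \<open>(w, Z w)\<close>. Symplecticity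
  enters through two identities: \<open>L^T N = N^T L\<close> makes \<open>M\<close> symmetric, and
  \<open>D^T L = 1 + B^T N\<close> shows that \<open>L w\<close> and \<open>N w\<close> cannot both
  vanish unless \<open>w = 0\<close>. The equation is integrated with \<open>w\<close> chosen so
  that \<open>L w\<close> is real. Of the displacement \<open>i N w - L w\<close> of the parameter,
  the first term then becomes a multiplication and the second an honest translation of
  \<open>g\<close>.\<close>

section \<open>Bounded Borel functions as bounded limits of trigonometric polynomials\<close>

text \<open>A device for density arguments: a property that is linear, holds for characters and
  survives dominated convergence passes by rule induction to all bounded Borel functions. The
  uniform bound in the limit rule supplies the majorant, both for integrals against an integrable
  function and for norm limits in \<open>L2\<close>.\<close>

inductive_set trig_closure :: "('a::euclidean_space \<Rightarrow> complex) set" where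
  character: "(\<lambda>t. exp (2 * of_real pi * \<i> * of_real (\<xi> \<bullet> t))) \<in> trig_closure"
| lincomb: "f \<in> trig_closure \<Longrightarrow> g \<in> trig_closure \<Longrightarrow> (\<lambda>t. a * f t + b * g t) \<in> trig_closure"
| bounded_limit: "(\<And>n::nat. f n \<in> trig_closure) \<Longrightarrow> (\<And>n t. cmod (f n t) \<le> K) \<Longrightarrow>
    (\<And>t. (\<lambda>n. f n t) \<longlonglongrightarrow> g t) \<Longrightarrow> g \<in> trig_closure"

lemma trig_closure_bounded: "f \<in> trig_closure \<Longrightarrow> \<exists>K. \<forall>t. cmod (f t) \<le> K"
proof (induction rule: trig_closure.induct)
  case (character \<xi>)
  show ?case by (intro exI[of _ 1]) (simp add: norm_exp_eq_Re)
next
  case (lincomb f g a b)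
  then obtain K L where K: "\<And>t. cmod (f t) \<le> K" and L: "\<And>t. cmod (g t) \<le> L" by blast
  have "cmod (a * f t + b * g t) \<le> cmod a * K + cmod b * L" for t
    by (rule order_trans[OF norm_triangle_ineq], unfold norm_mult)
      (intro add_mono mult_left_mono K L norm_ge_zero)
  then show ?case by blast
next
  case (bounded_limit f K g)
  then have "cmod (g t) \<le> K" for t
    by (intro LIMSEQ_le_const2[OF tendsto_norm[OF bounded_limit.hyps(3)]]) auto
  then show ?case by blast
qed

lemma trig_closure_measurable: "f \<in> trig_closure \<Longrightarrow> f \<in> borel_measurable borel"
proof (induction rule: trig_closure.induct)
  case (character \<xi>)
  show ?case
    by (intro borel_measurable_continuous_onI continuous_on_exp continuous_on_mult continuous_on_const
        continuous_on_of_real continuous_on_inner continuous_on_id)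
next
  case (bounded_limit f K g)
  show ?case by (rule borel_measurable_LIMSEQ_metric[of f]) (use bounded_limit in auto)
qed auto

lemma trig_closure_const: "(\<lambda>_. c) \<in> trig_closure"
  using trig_closure.lincomb[OF trig_closure.character[of 0] trig_closure.character[of 0], of c 0] by simp

lemma trig_closure_scale: "f \<in> trig_closure \<Longrightarrow> (\<lambda>t. a * f t) \<in> trig_closure"
  using trig_closure.lincomb[of f f a 0] by simp

lemma trig_closure_add: "f \<in> trig_closure \<Longrightarrow> g \<in> trig_closure \<Longrightarrow> (\<lambda>t. f t + g t) \<in> trig_closure"
  using trig_closure.lincomb[of f g 1 1] by simp

lemma trig_closure_diff: "f \<in> trig_closure \<Longrightarrow> g \<in> trig_closure \<Longrightarrow> (\<lambda>t. f t - g t) \<in> trig_closure"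
  using trig_closure.lincomb[of f g 1 "-1"] by simp

lemma trig_closure_sum:
  "(\<And>i. i \<in> I \<Longrightarrow> f i \<in> trig_closure) \<Longrightarrow> (\<lambda>t. \<Sum>i\<in>I. f i t) \<in> trig_closure"
  by (induction I rule: infinite_finite_induct) (auto intro: trig_closure_const trig_closure_add)

text \<open>The limit case shared by the two inductions on products below; boundedness of the fixed
  factor \<open>k\<close> keeps the products uniformly bounded.\<close>

lemma trig_closure_mult_limit:
  assumes "\<And>n. (\<lambda>t. f n t * k t) \<in> trig_closure" "k \<in> trig_closure"
    and "\<And>n t. cmod (f n t) \<le> K" "\<And>t. (\<lambda>n. f n t) \<longlonglongrightarrow> g t"
  shows "(\<lambda>t. g t * k t) \<in> trig_closure"
proof -
  obtain L where L: "\<And>t. cmod (k t) \<le> L" using trig_closure_bounded assms(2) by blast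
  have "0 \<le> K" using assms(3) norm_ge_zero order_trans by blast
  then have "cmod (f n t * k t) \<le> K * L" for n t
    unfolding norm_mult by (intro mult_mono assms L) auto
  moreover have "(\<lambda>n. f n t * k t) \<longlonglongrightarrow> g t * k t" for t
    by (intro tendsto_intros assms)
  ultimately show ?thesis
    by (rule trig_closure.bounded_limit[where f="\<lambda>n t. f n t * k t", rotated]) (use assms(1) in auto)
qed

text \<open>Induction on one factor at a time: first the other factor is a character, where
  frequencies add, and then it is arbitrary, with the first result serving as the base case.\<close>

lemma trig_closure_mult:
  assumes f: "f \<in> trig_closure" and g: "g \<in> trig_closure"
  shows "(\<lambda>t. f t * g t) \<in> trig_closure"
proof -
  have char: "(\<lambda>t. f t * exp (2 * of_real pi * \<i> * of_real (\<eta> \<bullet> t))) \<in> trig_closure"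
    if "f \<in> trig_closure" for f and \<eta> :: 'a
    using that
  proof (induction rule: trig_closure.induct)
    case (character \<xi>)
    show ?case using trig_closure.character[of "\<xi> + \<eta>"]
      by (simp add: inner_add_left algebra_simps flip: exp_add)
  next
    case (lincomb f g a b)
    show ?case using trig_closure.lincomb[OF lincomb(3,4), of a b] by (simp add: algebra_simps)
  next
    case (bounded_limit f K g)
    show ?case
      by (rule trig_closure_mult_limit[where f=f and K=K])
        (use bounded_limit trig_closure.character in auto)
  qed
  show ?thesis using f
  proof (induction rule: trig_closure.induct)
    case (character \<xi>)
    show ?case using char[OF g] by (simp add: mult.commute)
  next
    case (lincomb f h a b)
    show ?case using trig_closure.lincomb[OF lincomb(3,4), of a b] by (simp add: algebra_simps)
  next
    case (bounded_limit f K h)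
    show ?case
      by (rule trig_closure_mult_limit[where f=f and K=K]) (use bounded_limit g in auto)
  qed
qed

lemma trig_closure_power: "f \<in> trig_closure \<Longrightarrow> (\<lambda>t. f t ^ n) \<in> trig_closure"
  by (induction n) (auto intro: trig_closure_const trig_closure_mult)

text \<open>The partial sums of the exponential series are uniformly bounded by
  \<open>exp K\<close>, so the bounded limit rule applies.\<close>

lemma trig_closure_exp:
  assumes f: "f \<in> trig_closure"
  shows "(\<lambda>t. exp (f t)) \<in> trig_closure"
proof -
  obtain K where K: "\<And>t. cmod (f t) \<le> K" using trig_closure_bounded f by blast
  show ?thesis
  proof (rule trig_closure.bounded_limit)
    show "(\<lambda>t. \<Sum>k<n. inverse (fact k) * f t ^ k) \<in> trig_closure" for n
      by (intro trig_closure_sum trig_closure_scale trig_closure_power f)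
    show "cmod (\<Sum>k<n. inverse (fact k) * f t ^ k) \<le> exp K" for n t
    proof -
      have s: "(\<lambda>k. inverse (fact k) * cmod (f t) ^ k) sums exp (cmod (f t))"
        using exp_converges[of "cmod (f t)"] by (simp add: divide_inverse_commute)
      have "cmod (\<Sum>k<n. inverse (fact k) * f t ^ k) \<le> (\<Sum>k<n. inverse (fact k) * cmod (f t) ^ k)"
        by (rule sum_norm_le) (simp add: norm_mult norm_power norm_inverse)
      also have "\<dots> \<le> exp (cmod (f t))"
        using sum_le_suminf[OF sums_summable[OF s], of "{..<n}"] sums_unique[OF s] by simp
      also have "\<dots> \<le> exp K" using K by simp
      finally show ?thesis .
    qed
    show "(\<lambda>n. \<Sum>k<n. inverse (fact k) * f t ^ k) \<longlonglongrightarrow> exp (f t)" for t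
      using exp_converges[of "f t"] unfolding sums_def by (simp add: scaleR_conv_of_real)
  qed
qed

text \<open>Two limits of exponentials: \<open>exp (- n r^2)\<close> tends to the indicator of
  \<open>r = 0\<close>, and \<open>exp (- exp (n r))\<close> tends to 1, \<open>exp (-1)\<close> or
  0 according to the sign of \<open>r\<close>. Both sequences are bounded by 1, and the first limit
  removes the spurious value \<open>exp (-1)\<close> on \<open>r = 0\<close> from the
  second.\<close>

lemma trig_closure_negative:
  assumes r: "(\<lambda>t. complex_of_real (r t)) \<in> trig_closure"
  shows "(\<lambda>t. of_bool (r t < 0)) \<in> trig_closure"
proof -
  have "(\<lambda>t. of_bool (r t = 0)) \<in> trig_closure"
  proof (rule trig_closure.bounded_limit)
    show "(\<lambda>t. exp (- of_nat n * of_real (r t) ^ 2)) \<in> trig_closure" for n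
      by (intro trig_closure_exp trig_closure_scale trig_closure_power r)
    show "cmod (exp (- of_nat n * of_real (r t) ^ 2)) \<le> 1" for n t
      by (simp add: norm_exp_eq_Re flip: of_real_power)
    show "(\<lambda>n. exp (- of_nat n * of_real (r t) ^ 2)) \<longlonglongrightarrow> (of_bool (r t = 0) :: complex)" for t
    proof -
      have "(\<lambda>n. exp (- real n * r t ^ 2)) \<longlonglongrightarrow> of_bool (r t = 0)"
      proof (cases "r t = 0")
        case False
        then have "r t ^ 2 > 0" by simp
        then have "(\<lambda>n. exp (- real n * r t ^ 2)) \<longlonglongrightarrow> 0" by real_asymp
        then show ?thesis using False by simp
      qed simp
      from tendsto_of_real[OF this, where 'a=complex]
      have "(\<lambda>n. complex_of_real (exp (- real n * r t ^ 2))) \<longlonglongrightarrow> of_bool (r t = 0)"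
        by (cases "r t = 0") auto
      moreover have E: "complex_of_real (exp (- real n * r t ^ 2)) = exp (- of_nat n * of_real (r t) ^ 2)" for n
        by (simp flip: exp_of_real)
      ultimately show ?thesis unfolding E by blast
    qed
  qed
  moreover have "(\<lambda>t. of_bool (r t < 0) + exp (-1) * of_bool (r t = 0)) \<in> trig_closure"
  proof (rule trig_closure.bounded_limit)
    show "(\<lambda>t. exp ((-1) * exp (of_nat n * of_real (r t)))) \<in> trig_closure" for n
      by (intro trig_closure_exp trig_closure_scale r)
    show "cmod (exp ((-1) * exp (of_nat n * of_real (r t)))) \<le> 1" for n t
    proof -
      have "exp (of_nat n * complex_of_real (r t)) = of_real (exp (real n * r t))"
        by (simp flip: exp_of_real)
      then show ?thesis by (simp add: norm_exp_eq_Re)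
    qed
    show "(\<lambda>n. exp ((-1) * exp (of_nat n * of_real (r t)))) \<longlonglongrightarrow>
        (of_bool (r t < 0) + exp (-1) * of_bool (r t = 0) :: complex)" for t
    proof -
      have "(\<lambda>n. exp (- exp (real n * r t))) \<longlonglongrightarrow> of_bool (r t < 0) + exp (-1) * of_bool (r t = 0)"
      proof (cases "r t" "0::real" rule: linorder_cases)
        case less
        then have "(\<lambda>n. exp (- exp (real n * r t))) \<longlonglongrightarrow> 1" by real_asymp
        then show ?thesis using less by simp
      next
        case greater
        then have "(\<lambda>n. exp (- exp (real n * r t))) \<longlonglongrightarrow> 0" by real_asymp
        then show ?thesis using greater by simp
      qed simp
      from tendsto_of_real[OF this, where 'a=complex]
      have "(\<lambda>n. complex_of_real (exp (- exp (real n * r t)))) \<longlonglongrightarrow>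
          of_bool (r t < 0) + exp (-1) * of_bool (r t = 0)"
        by (cases "r t" "0::real" rule: linorder_cases) (auto simp flip: exp_of_real)
      moreover have E: "complex_of_real (exp (- exp (real n * r t))) = exp ((-1) * exp (of_nat n * of_real (r t)))" for n
        by (simp flip: exp_of_real)
      ultimately show ?thesis unfolding E by blast
    qed
  qed
  ultimately show ?thesis
    using trig_closure.lincomb[of "\<lambda>t. of_bool (r t < 0) + exp (-1) * of_bool (r t = 0)"
        "\<lambda>t. of_bool (r t = 0)" 1 "- exp (-1)"] by simp
qed

text \<open>A linear form is unbounded and so lies outside the closure. It is replaced by
  \<open>sin ((t \<bullet> i - a) / Suc n)\<close>, a combination of two characters that has the
  sign of \<open>t \<bullet> i - a\<close> as soon as its argument is smaller than \<open>pi\<close>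
  in absolute value.\<close>

lemma trig_closure_halfspace: "(\<lambda>t. of_bool (t \<bullet> i < a)) \<in> trig_closure"
proof (rule trig_closure.bounded_limit)
  fix n :: nat
  let ?e = "\<lambda>c t. exp (2 * of_real pi * \<i> * of_real (((c / (2 * pi * Suc n)) *\<^sub>R i) \<bullet> t))"
  have "(\<lambda>t. (exp (- \<i> * of_real (a / Suc n)) / (2 * \<i>)) * ?e 1 t
          + (- exp (\<i> * of_real (a / Suc n)) / (2 * \<i>)) * ?e (-1) t) \<in> trig_closure"
    by (intro trig_closure.lincomb trig_closure.character)
  moreover have "(exp (- \<i> * of_real (a / Suc n)) / (2 * \<i>)) * ?e 1 t
          + (- exp (\<i> * of_real (a / Suc n)) / (2 * \<i>)) * ?e (-1) t =
        of_real (sin ((t \<bullet> i - a) / Suc n))" for t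
  proof -
    have e: "?e c t = exp (\<i> * of_real (c * (t \<bullet> i) / Suc n))" for c
    proof -
      have "2 * pi * (((c / (2 * pi * Suc n)) *\<^sub>R i) \<bullet> t) = c * (t \<bullet> i) / Suc n"
        by (simp add: inner_commute[of i t])
      then have "of_real (c * (t \<bullet> i) / Suc n) = (of_real (2 * pi * (((c / (2 * pi * Suc n)) *\<^sub>R i) \<bullet> t)) :: complex)"
        by (rule arg_cong[of _ _ complex_of_real, OF sym])
      then show ?thesis by (simp only: of_real_mult of_real_numeral mult_ac)
    qed
    have "(exp (- \<i> * of_real (a / Suc n)) / (2 * \<i>)) * ?e 1 t
          + (- exp (\<i> * of_real (a / Suc n)) / (2 * \<i>)) * ?e (-1) t =
      (exp (- \<i> * of_real (a / Suc n)) * ?e 1 t - exp (\<i> * of_real (a / Suc n)) * ?e (-1) t) / (2 * \<i>)"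
      by (simp add: field_simps)
    also have "\<dots> = (exp (\<i> * of_real ((t \<bullet> i - a) / Suc n)) - exp (- (\<i> * of_real ((t \<bullet> i - a) / Suc n)))) / (2 * \<i>)"
      unfolding e exp_add[symmetric] by (simp add: diff_divide_distrib algebra_simps)
    also have "\<dots> = sin (of_real ((t \<bullet> i - a) / Suc n))"
      unfolding sin_exp_eq by (simp add: mult.commute)
    finally show ?thesis by (simp only: sin_of_real)
  qed
  ultimately have "(\<lambda>t. complex_of_real (sin ((t \<bullet> i - a) / Suc n))) \<in> trig_closure"
    by (simp only:)
  then show "(\<lambda>t. of_bool (sin ((t \<bullet> i - a) / Suc n) < 0)) \<in> trig_closure"
    by (rule trig_closure_negative)
next
  show "cmod (of_bool (sin ((t \<bullet> i - a) / Suc n) < 0)) \<le> 1" for n t by simp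
  show "(\<lambda>n. of_bool (sin ((t \<bullet> i - a) / real (Suc n)) < 0)) \<longlonglongrightarrow> (of_bool (t \<bullet> i < a) :: complex)" for t
  proof -
    define x where "x = t \<bullet> i - a"
    have "eventually (\<lambda>n. of_bool (sin (x / real (Suc n)) < 0) = (of_bool (x < 0) :: complex)) sequentially"
    proof (rule eventually_sequentiallyI[of "nat \<lceil>\<bar>x\<bar>\<rceil>"])
      fix n assume "n \<ge> nat \<lceil>\<bar>x\<bar>\<rceil>"
      then have "\<bar>x\<bar> < real (Suc n)" by linarith
      then have "\<bar>x / Suc n\<bar> < 1" by (simp add: abs_divide)
      then have y: "\<bar>x / Suc n\<bar> < pi" using pi_gt3 by linarith
      have "sin (x / Suc n) < 0 \<longleftrightarrow> x / Suc n < 0"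
      proof (cases "x / Suc n" "0::real" rule: linorder_cases)
        case less
        then have "0 < sin (- (x / Suc n))" using y by (intro sin_gt_zero) linarith+
        then show ?thesis using less unfolding sin_minus by linarith
      next
        case greater
        then have "0 < sin (x / Suc n)" using y by (intro sin_gt_zero) linarith+
        then show ?thesis using greater by linarith
      next
        case equal
        then show ?thesis by (simp only: sin_zero)
      qed
      then show "of_bool (sin (x / Suc n) < 0) = (of_bool (x < 0) :: complex)"
        by (simp add: divide_less_0_iff)
    qed
    then show ?thesis unfolding x_def by (simp add: tendsto_eventually)
  qed
qed

text \<open>Half-spaces generate the Borel sets. As the closure is an algebra, finite unions are
  handled by \<open>1_A + 1_B - 1_A 1_B\<close>, and countable unions are bounded limits of
  these.\<close>

lemma trig_closure_indicator:
  fixes A :: "'a::euclidean_space set"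
  assumes "A \<in> sets borel"
  shows "(\<lambda>t. of_bool (t \<in> A)) \<in> trig_closure"
proof -
  have "A \<in> sigma_sets UNIV ((\<lambda>(a, i). {x::'a. x \<bullet> i < a}) ` (UNIV \<times> Basis))"
    using assms unfolding borel_eq_halfspace_less by simp
  then show ?thesis
  proof (induction rule: sigma_sets.induct)
    case (Basic A)
    then show ?case using trig_closure_halfspace by auto
  next
    case Empty
    show ?case using trig_closure_const[of 0] by simp
  next
    case (Compl A)
    have "(\<lambda>t. 1 - of_bool (t \<in> A)) \<in> trig_closure"
      by (intro trig_closure_diff trig_closure_const Compl)
    then show ?case by (simp add: of_bool_not_iff)
  next
    case (Union A)
    have "(\<lambda>t. of_bool (t \<in> \<Union>(A ` {..<n}))) \<in> trig_closure" for n
    proof (induction n)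
      case (Suc n)
      have "(\<lambda>t. (of_bool (t \<in> \<Union>(A ` {..<n})) + of_bool (t \<in> A n)) -
          of_bool (t \<in> \<Union>(A ` {..<n})) * of_bool (t \<in> A n)) \<in> trig_closure"
        by (intro trig_closure_diff trig_closure_add trig_closure_mult Suc Union)
      also have "(\<lambda>t. (of_bool (t \<in> \<Union>(A ` {..<n})) + of_bool (t \<in> A n)) -
          of_bool (t \<in> \<Union>(A ` {..<n})) * of_bool (t \<in> A n) :: complex) =
          (\<lambda>t. of_bool (t \<in> \<Union>(A ` {..<Suc n})))"
        by (rule ext) (auto simp: lessThan_Suc)
      finally show ?case .
    qed (use trig_closure_const[of 0] in simp)
    then show ?case
    proof (rule trig_closure.bounded_limit[where K=1])
      show "cmod (of_bool (t \<in> \<Union>(A ` {..<n}))) \<le> 1" for n t by simp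
      show "(\<lambda>n. of_bool (t \<in> \<Union>(A ` {..<n}))) \<longlonglongrightarrow> (of_bool (t \<in> (\<Union>i. A i)) :: complex)" for t
      proof (rule tendsto_eventually)
        show "eventually (\<lambda>n. of_bool (t \<in> \<Union>(A ` {..<n})) = (of_bool (t \<in> (\<Union>i. A i)) :: complex)) sequentially"
        proof (cases "\<exists>i. t \<in> A i")
          case True
          then obtain i where "t \<in> A i" ..
          then show ?thesis by (intro eventually_sequentiallyI[of "Suc i"]) auto
        qed auto
      qed
    qed
  qed
qed

lemma bounded_borel_in_trig_closure:
  assumes f: "f \<in> borel_measurable borel" and K: "\<And>t. cmod (f t) \<le> K"
  shows "f \<in> trig_closure"
proof -
  obtain F where F: "\<And>i. simple_function borel (F i)" "\<And>x. (\<lambda>i. F i x) \<longlonglongrightarrow> f x"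
    "\<And>i x. dist (F i x) 0 \<le> 2 * dist (f x) 0"
    using borel_measurable_implies_sequence_metric[OF f, of 0] by auto
  show ?thesis
  proof (rule trig_closure.bounded_limit[OF _ _ F(2)])
    show "cmod (F n t) \<le> 2 * K" for n t using F(3)[of n t] K[of t] by simp
    show "F n \<in> trig_closure" for n
    proof -
      have fin: "finite (range (F n))" using F(1)[of n] by (simp add: simple_function_def)
      have "(\<lambda>t. \<Sum>y\<in>range (F n). y * of_bool (t \<in> F n -` {y})) \<in> trig_closure"
      proof (intro trig_closure_sum trig_closure_scale trig_closure_indicator)
        fix y assume "y \<in> range (F n)"
        then show "F n -` {y} \<in> sets borel" using F(1)[of n] by (auto simp: simple_function_def)
      qed
      also have "(\<lambda>t. \<Sum>y\<in>range (F n). y * of_bool (t \<in> F n -` {y})) = F n"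
      proof
        fix t
        have "(\<Sum>y\<in>range (F n). y * of_bool (t \<in> F n -` {y})) = (\<Sum>y\<in>range (F n). if y = F n t then y else 0)"
          by (intro sum.cong) auto
        then show "(\<Sum>y\<in>range (F n). y * of_bool (t \<in> F n -` {y})) = F n t"
          using fin by simp
      qed
      finally show ?thesis .
    qed
  qed
qed

text \<open>The hypothesis says that \<open>w\<close> annihilates all characters, hence the whole
  closure. Testing against the bounded Borel function \<open>cnj (sgn w)\<close> turns the integral
  into that of \<open>cmod w\<close>.\<close>

lemma fourier_injective_L1:
  fixes w :: "'a::euclidean_space \<Rightarrow> complex"
  assumes w: "integrable lborel w"
    and zero: "\<And>\<xi>. (\<integral>t. exp (2 * of_real pi * \<i> * of_real (\<xi> \<bullet> t)) * w t \<partial>lborel) = 0"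
  shows "AE t in lborel. w t = 0"
proof -
  have int: "integrable lborel (\<lambda>t. h t * w t)" if h: "h \<in> trig_closure" for h
  proof -
    obtain K where K: "\<And>t. cmod (h t) \<le> K" using trig_closure_bounded[OF h] by blast
    show ?thesis
    proof (rule Bochner_Integration.integrable_bound[OF integrable_mult_right[OF integrable_norm[OF w], of K]])
      show "(\<lambda>t. h t * w t) \<in> borel_measurable lborel"
        using trig_closure_measurable[OF h] w by auto
      show "AE t in lborel. norm (h t * w t) \<le> norm (K * norm (w t))"
        using K by (intro AE_I2) (auto simp: norm_mult abs_mult intro!: mult_right_mono order_trans[OF K abs_ge_self])
    qed
  qed
  have "(\<integral>t. h t * w t \<partial>lborel) = 0" if "h \<in> trig_closure" for h
    using that
  proof (induction rule: trig_closure.induct)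
    case (character \<xi>)
    show ?case by (rule zero)
  next
    case (lincomb f g a b)
    have "(\<lambda>t. (a * f t + b * g t) * w t) = (\<lambda>t. a * (f t * w t) + b * (g t * w t))"
      by (simp add: algebra_simps)
    then show ?case using lincomb int by simp
  next
    case (bounded_limit f K g)
    have "(\<lambda>n. \<integral>t. f n t * w t \<partial>lborel) \<longlonglongrightarrow> (\<integral>t. g t * w t \<partial>lborel)"
    proof (rule integral_dominated_convergence[where w="\<lambda>t. K * cmod (w t)"])
      have "g \<in> borel_measurable borel"
        by (rule borel_measurable_LIMSEQ_metric[of f])
          (use bounded_limit trig_closure_measurable in force)+
      then show "(\<lambda>t. g t * w t) \<in> borel_measurable lborel" using w by auto
      show "(\<lambda>t. f n t * w t) \<in> borel_measurable lborel" for n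
        using trig_closure_measurable[of "f n"] bounded_limit w by auto
      show "integrable lborel (\<lambda>t. K * cmod (w t))" using w by auto
      show "AE t in lborel. (\<lambda>n. f n t * w t) \<longlonglongrightarrow> g t * w t"
        using bounded_limit by (intro AE_I2 tendsto_intros) auto
      show "AE t in lborel. norm (f n t * w t) \<le> K * cmod (w t)" for n
        using bounded_limit by (intro AE_I2) (auto simp: norm_mult intro!: mult_right_mono)
    qed
    then show ?case using bounded_limit by (simp add: LIMSEQ_const_iff)
  qed
  moreover have "(\<lambda>t. cnj (sgn (w t))) \<in> trig_closure"
  proof (rule bounded_borel_in_trig_closure)
    have "(\<lambda>t. cnj (w t) / of_real (cmod (w t))) \<in> borel_measurable lborel"
    proof -
      have "w \<in> borel_measurable lborel" using w by auto
      then show ?thesis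
        using measurable_compose[OF _ borel_measurable_continuous_onI[OF continuous_on_cnj[OF continuous_on_id]]]
        by measurable
    qed
    then show "(\<lambda>t. cnj (sgn (w t))) \<in> borel_measurable borel"
      by (simp add: sgn_eq)
    show "cmod (cnj (sgn (w t))) \<le> 1" for t by (simp add: norm_sgn)
  qed
  ultimately have "(\<integral>t. cnj (sgn (w t)) * w t \<partial>lborel) = 0" by blast
  moreover have "cnj (sgn z) * z = of_real (cmod z)" for z
  proof (cases "z = 0")
    case False
    have "cnj (sgn z) * z = (z * cnj z) / of_real (cmod z)" by (simp add: sgn_eq)
    also have "\<dots> = of_real (cmod z)"
      using False unfolding complex_norm_square[symmetric] by (simp add: power2_eq_square)
    finally show ?thesis .
  qed simp
  ultimately have "(\<integral>t. complex_of_real (cmod (w t)) \<partial>lborel) = 0" by simp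
  then have "(\<integral>t. cmod (w t) \<partial>lborel) = 0" by simp
  then have "AE t in lborel. cmod (w t) = 0"
    using w by (subst integral_nonneg_eq_0_iff_AE[symmetric]) auto
  then show ?thesis by simp
qed

section \<open>The bilinear dot product\<close>

lemma cdot_add_left: "cdot (x + y) z = cdot x z + cdot y z"
  and cdot_add_right: "cdot z (x + y) = cdot z x + cdot z y"
  and cdot_diff_left: "cdot (x - y) z = cdot x z - cdot y z"
  and cdot_diff_right: "cdot z (x - y) = cdot z x - cdot z y"
  and cdot_minus_left: "cdot (- x) z = - cdot x z"
  and cdot_minus_right: "cdot z (- x) = - cdot z x"
  and cdot_scale_left: "cdot (c *s x) z = c * cdot x z"
  and cdot_scale_right: "cdot z (c *s x) = c * cdot z x"
  and cdot_zero_left: "cdot 0 z = 0"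
  and cdot_zero_right: "cdot z 0 = 0"
  unfolding cdot_def
  by (simp_all add: sum.distrib sum_subtractf sum_negf sum_distrib_left algebra_simps)

lemmas cdot_linear = cdot_add_left cdot_add_right cdot_diff_left cdot_diff_right
  cdot_minus_left cdot_minus_right cdot_scale_left cdot_scale_right cdot_zero_left cdot_zero_right

lemma cdot_commute: "cdot x y = cdot y x"
  unfolding cdot_def by (simp add: mult.commute)

lemma complex_vec_add: "complex_vec (x + y) = complex_vec x + complex_vec y"
  and complex_vec_diff: "complex_vec (x - y) = complex_vec x - complex_vec y"
  and complex_vec_scaleR: "complex_vec (s *\<^sub>R x) = of_real s *s complex_vec x"
  unfolding complex_vec_def by (simp_all add: vec_eq_iff)

lemma cdot_complex_vec: "cdot (complex_vec x) (complex_vec y) = of_real (x \<bullet> y)"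
  unfolding cdot_def complex_vec_def inner_vec_def by simp

lemma cdot_matrix_vector: "cdot (M *v x) y = cdot x (transpose M *v y)"
proof -
  have "cdot (M *v x) y = (\<Sum>i\<in>UNIV. \<Sum>j\<in>UNIV. M $ i $ j * x $ j * y $ i)"
    unfolding cdot_def matrix_vector_mult_def by (simp add: sum_distrib_right)
  also have "\<dots> = (\<Sum>j\<in>UNIV. \<Sum>i\<in>UNIV. M $ i $ j * x $ j * y $ i)"
    by (rule sum.swap)
  also have "\<dots> = cdot x (transpose M *v y)"
    unfolding cdot_def matrix_vector_mult_def transpose_def
    by (simp add: sum_distrib_left algebra_simps)
  finally show ?thesis .
qed

lemma cdot_symmetric_matrix: "transpose M = M \<Longrightarrow> cdot (M *v x) y = cdot (M *v y) x"
  by (metis cdot_commute cdot_matrix_vector)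

lemma norm_cdot_complex_vec_le: "cmod (cdot a (complex_vec t)) \<le> norm a * norm t"
proof -
  have "cmod (cdot a (complex_vec t)) \<le> (\<Sum>j\<in>UNIV. \<bar>cmod (a $ j)\<bar> * \<bar>norm (t $ j)\<bar>)"
    unfolding cdot_def complex_vec_def by (rule sum_norm_le) (simp add: norm_mult)
  also have "\<dots> \<le> norm a * norm t"
    unfolding norm_vec_def by (rule L2_set_mult_ineq)
  finally show ?thesis .
qed

lemma continuous_on_cdot_complex_vec: "continuous_on UNIV (\<lambda>t. cdot a (complex_vec t))"
  unfolding cdot_def complex_vec_def by (simp add: continuous_intros)

lemma continuous_on_cdot_quadratic:
  "continuous_on UNIV (\<lambda>t. cdot (M *v complex_vec t) (complex_vec t))"
  unfolding cdot_def complex_vec_def matrix_vector_mult_def by (simp add: continuous_intros)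

text \<open>The zero set lies in the real hyperplane orthogonal to the real or to the imaginary part
  of \<open>a\<close>, whichever is nonzero.\<close>

lemma AE_cdot_complex_vec_nonzero:
  assumes "a \<noteq> 0"
  shows "AE t::real^'d::finite in lborel. cdot a (complex_vec t) \<noteq> 0"
proof -
  define r i where "r = (\<chi> j. Re (a $ j))" and "i = (\<chi> j. Im (a $ j))"
  have re: "Re (cdot a (complex_vec t)) = r \<bullet> t" and im: "Im (cdot a (complex_vec t)) = i \<bullet> t" for t
    unfolding cdot_def complex_vec_def r_def i_def inner_vec_def by (simp_all add: Re_sum Im_sum)
  have "r \<noteq> 0 \<or> i \<noteq> 0"
    using assms unfolding r_def i_def by (auto simp: vec_eq_iff complex_eq_iff)
  then obtain v where v: "v \<noteq> 0" "\<And>t. cdot a (complex_vec t) = 0 \<Longrightarrow> v \<bullet> t = 0"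
    using re im by (metis zero_complex.sel)
  have "{t. v \<bullet> t = 0} \<in> null_sets lborel"
  proof -
    have "closed {t. v \<bullet> t = 0}" by (rule closed_hyperplane)
    then have "{t. v \<bullet> t = 0} \<in> sets lborel" by simp
    moreover have "{t. v \<bullet> t = 0} \<in> null_sets lebesgue"
      using negligible_hyperplane[of v 0] v(1) negligible_iff_null_sets by blast
    ultimately show ?thesis using null_sets_completion_iff by blast
  qed
  then have "AE t in lborel. t \<notin> {t. v \<bullet> t = 0}" by (rule AE_not_in)
  then show ?thesis by eventually_elim (use v in auto)
qed

section \<open>Functions of exponential growth and of Gaussian decay\<close>

text \<open>The class is closed under sums and products and contains both affine functions and
  exponentials of linear forms. Functions with \<open>gaussian_decay\<close> form a module over it
  inside \<open>L2\<close>, so integrability reduces to structural rules.\<close>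

definition exp_growth :: "(real^'d::finite \<Rightarrow> complex) \<Rightarrow> bool" where
  "exp_growth m \<longleftrightarrow> m \<in> borel_measurable borel \<and>
    (\<exists>K\<ge>0. \<exists>C\<ge>0. \<forall>t. cmod (m t) \<le> K * exp (C * norm t))"

definition gaussian_decay :: "(real^'d::finite \<Rightarrow> complex) \<Rightarrow> bool" where
  "gaussian_decay f \<longleftrightarrow> f \<in> borel_measurable borel \<and>
    (\<exists>K\<ge>0. \<exists>C\<ge>0. \<exists>c>0. \<forall>t. cmod (f t) \<le> K * exp (C * norm t - c * (norm t)\<^sup>2))"

lemma exp_growthI:
  assumes "m \<in> borel_measurable borel" "K \<ge> 0" "C \<ge> 0" "\<And>t. cmod (m t) \<le> K * exp (C * norm t)"
  shows "exp_growth m"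
  using assms unfolding exp_growth_def by blast

lemma gaussian_decayI:
  assumes "f \<in> borel_measurable borel" "K \<ge> 0" "C \<ge> 0" "c > 0"
    and "\<And>t. cmod (f t) \<le> K * exp (C * norm t - c * (norm t)\<^sup>2)"
  shows "gaussian_decay f"
  using assms unfolding gaussian_decay_def by blast

lemma exp_growth_const: "exp_growth (\<lambda>_. a)"
  by (rule exp_growthI[of _ "cmod a" 0]) auto

lemma exp_growth_add:
  assumes "exp_growth f" "exp_growth g"
  shows "exp_growth (\<lambda>t. f t + g t)"
proof -
  obtain K C L D where f: "K \<ge> 0" "C \<ge> 0" "\<And>t. cmod (f t) \<le> K * exp (C * norm t)"
    and g: "L \<ge> 0" "D \<ge> 0" "\<And>t. cmod (g t) \<le> L * exp (D * norm t)"
    using assms unfolding exp_growth_def by auto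
  have "cmod (f t + g t) \<le> (K + L) * exp ((C + D) * norm t)" for t
  proof -
    have "cmod (f t + g t) \<le> K * exp (C * norm t) + L * exp (D * norm t)"
      using f(3)[of t] g(3)[of t] norm_triangle_ineq[of "f t" "g t"] by linarith
    also have "\<dots> \<le> K * exp ((C + D) * norm t) + L * exp ((C + D) * norm t)"
      using f g by (intro add_mono mult_left_mono) (auto intro: mult_right_mono)
    finally show ?thesis by (simp add: algebra_simps)
  qed
  moreover have "(\<lambda>t. f t + g t) \<in> borel_measurable borel"
    using assms unfolding exp_growth_def by auto
  ultimately show ?thesis using f g by (intro exp_growthI[of _ "K + L" "C + D"]) auto
qed

lemma exp_growth_mult:
  assumes "exp_growth f" "exp_growth g"
  shows "exp_growth (\<lambda>t. f t * g t)"
proof -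
  obtain K C L D where f: "K \<ge> 0" "C \<ge> 0" "\<And>t. cmod (f t) \<le> K * exp (C * norm t)"
    and g: "L \<ge> 0" "D \<ge> 0" "\<And>t. cmod (g t) \<le> L * exp (D * norm t)"
    using assms unfolding exp_growth_def by auto
  have "cmod (f t * g t) \<le> (K * L) * exp ((C + D) * norm t)" for t
  proof -
    have "cmod (f t * g t) \<le> (K * exp (C * norm t)) * (L * exp (D * norm t))"
      unfolding norm_mult using f g by (intro mult_mono) auto
    then show ?thesis by (simp add: algebra_simps exp_add)
  qed
  moreover have "(\<lambda>t. f t * g t) \<in> borel_measurable borel"
    using assms unfolding exp_growth_def by auto
  ultimately show ?thesis using f g by (intro exp_growthI[of _ "K * L" "C + D"]) auto
qed

lemma exp_growth_cmult: "exp_growth f \<Longrightarrow> exp_growth (\<lambda>t. a * f t)"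
  by (rule exp_growth_mult[OF exp_growth_const])

lemma exp_growth_diff: "exp_growth f \<Longrightarrow> exp_growth g \<Longrightarrow> exp_growth (\<lambda>t. f t - g t)"
  using exp_growth_add[of f "\<lambda>t. (-1) * g t"] exp_growth_cmult[of g "-1"] by simp

lemma exp_growth_cdot: "exp_growth (\<lambda>t::real^'d::finite. cdot a (complex_vec t))"
proof (rule exp_growthI[of _ "norm a" 1])
  show "(\<lambda>t. cdot a (complex_vec t)) \<in> borel_measurable borel"
    by (rule borel_measurable_continuous_onI[OF continuous_on_cdot_complex_vec])
  fix t :: "real^'d"
  have "norm t \<le> exp (1 * norm t)" using exp_ge_add_one_self[of "norm t"] unfolding mult_1 by linarith
  then show "cmod (cdot a (complex_vec t)) \<le> norm a * exp (1 * norm t)"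
    using norm_cdot_complex_vec_le[of a t] mult_left_mono[of "norm t" _ "norm a"] by fastforce
qed auto

lemma exp_growth_exp_cdot: "exp_growth (\<lambda>t::real^'d::finite. exp (c + k * cdot a (complex_vec t)))"
proof (rule exp_growthI[of _ "exp (cmod c)" "cmod k * norm a"])
  show "(\<lambda>t. exp (c + k * cdot a (complex_vec t))) \<in> borel_measurable borel"
    by (intro borel_measurable_continuous_onI continuous_on_exp continuous_on_add continuous_on_mult
        continuous_on_const continuous_on_cdot_complex_vec)
  fix t :: "real^'d"
  have "cmod (exp (c + k * cdot a (complex_vec t))) = exp (Re (c + k * cdot a (complex_vec t)))"
    by (rule norm_exp_eq_Re)
  also have "\<dots> \<le> exp (cmod c + cmod k * norm a * norm t)"
  proof -
    have "Re (c + k * cdot a (complex_vec t)) \<le> cmod (c + k * cdot a (complex_vec t))"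
      by (rule complex_Re_le_cmod)
    also have "\<dots> \<le> cmod c + cmod k * cmod (cdot a (complex_vec t))"
      using norm_triangle_ineq[of c "k * cdot a (complex_vec t)"] by (simp add: norm_mult)
    also have "\<dots> \<le> cmod c + cmod k * (norm a * norm t)"
      by (intro add_left_mono mult_left_mono norm_cdot_complex_vec_le) auto
    finally show ?thesis by (simp add: mult.assoc)
  qed
  finally show "cmod (exp (c + k * cdot a (complex_vec t))) \<le> exp (cmod c) * exp (cmod k * norm a * norm t)"
    by (simp add: exp_add)
qed auto

lemmas exp_growth_intros = exp_growth_const exp_growth_add exp_growth_diff exp_growth_mult
  exp_growth_cdot exp_growth_exp_cdot

lemma gaussian_decay_mult:
  assumes "exp_growth m" "gaussian_decay f"
  shows "gaussian_decay (\<lambda>t. m t * f t)"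
proof -
  obtain K C where m: "K \<ge> 0" "C \<ge> 0" "\<And>t. cmod (m t) \<le> K * exp (C * norm t)"
    using assms unfolding exp_growth_def by auto
  obtain L D d where f: "L \<ge> 0" "D \<ge> 0" "d > 0" "\<And>t. cmod (f t) \<le> L * exp (D * norm t - d * (norm t)\<^sup>2)"
    using assms unfolding gaussian_decay_def by auto
  have "cmod (m t * f t) \<le> (K * L) * exp ((C + D) * norm t - d * (norm t)\<^sup>2)" for t
  proof -
    have "cmod (m t * f t) \<le> (K * exp (C * norm t)) * (L * exp (D * norm t - d * (norm t)\<^sup>2))"
      unfolding norm_mult using m f by (intro mult_mono) auto
    also have "\<dots> = (K * L) * (exp (C * norm t) * exp (D * norm t - d * (norm t)\<^sup>2))" by simp
    finally show ?thesis unfolding exp_add[symmetric] by (simp add: algebra_simps)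
  qed
  moreover have "(\<lambda>t. m t * f t) \<in> borel_measurable borel"
    using assms unfolding exp_growth_def gaussian_decay_def by auto
  ultimately show ?thesis using m f
    by (intro gaussian_decayI[of _ "K * L" "C + D" d]) auto
qed

text \<open>Completing the square absorbs the linear term at the cost of half of the quadratic one.
  The rest factors over the coordinates, as \<open>decay\<close> does, and each factor is compared
  through \<open>1 + y \<le> exp y\<close>.\<close>

lemma exp_quadratic_le_decay:
  assumes c: "c > 0"
  shows "\<exists>K\<ge>0. \<forall>t::real^'d::finite. exp (C * norm t - c * (norm t)\<^sup>2) \<le> K * decay t"
proof (intro exI conjI allI)
  \<comment> \<open>Chosen so that \<open>1 + x^2 \<le> M * (1 + (c / 2) * x^2)\<close>: both
    coefficients on the right must be at least 1.\<close>
  define M where "M = max 1 (2 / c)"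
  have M: "M \<ge> 1" "M * (c / 2) \<ge> 1"
    using mult_right_mono[of "2 / c" M "c / 2"] c unfolding M_def by auto
  fix t :: "real^'d"
  have "C * norm t - c * (norm t)\<^sup>2 \<le> C\<^sup>2 / (2 * c) + - (c / 2) * (norm t)\<^sup>2"
  proof -
    have "0 \<le> (C - c * norm t)\<^sup>2 / (2 * c)" using c by simp
    also have "\<dots> = C\<^sup>2 / (2 * c) - C * norm t + (c / 2) * (norm t)\<^sup>2"
      using c by (simp add: power2_diff power_mult_distrib field_simps power2_eq_square)
    finally show ?thesis by (simp add: algebra_simps)
  qed
  then have "exp (C * norm t - c * (norm t)\<^sup>2) \<le> exp (C\<^sup>2 / (2 * c)) * exp (- (c / 2) * (norm t)\<^sup>2)"
    unfolding exp_add[symmetric] by simp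
  also have "exp (- (c / 2) * (norm t)\<^sup>2) \<le> M ^ CARD('d) * decay t"
  proof -
    have "(norm t)\<^sup>2 = (\<Sum>i\<in>UNIV. (t $ i)\<^sup>2)"
      unfolding power2_norm_eq_inner inner_vec_def by (simp add: power2_eq_square)
    then have "exp (- (c / 2) * (norm t)\<^sup>2) = (\<Prod>i\<in>UNIV. exp (- (c / 2) * (t $ i)\<^sup>2))"
      by (simp add: sum_distrib_left exp_sum)
    also have "\<dots> \<le> (\<Prod>i\<in>UNIV. M * inverse (1 + (t $ i)\<^sup>2))"
    proof (rule prod_mono, intro conjI)
      fix i
      have "1 + (t $ i)\<^sup>2 \<le> M * (1 + (c / 2) * (t $ i)\<^sup>2)"
        using M mult_right_mono[OF M(2), of "(t $ i)\<^sup>2"] by (simp add: algebra_simps)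
      also have "\<dots> \<le> M * exp ((c / 2) * (t $ i)\<^sup>2)"
        using M by (intro mult_left_mono exp_ge_add_one_self) auto
      finally have "1 + (t $ i)\<^sup>2 \<le> M * exp ((c / 2) * (t $ i)\<^sup>2)" .
      moreover have "1 + (t $ i)\<^sup>2 > 0" by (simp add: add_pos_nonneg)
      ultimately show "exp (- (c / 2) * (t $ i)\<^sup>2) \<le> M * inverse (1 + (t $ i)\<^sup>2)"
        by (simp add: exp_minus field_simps)
    qed auto
    also have "\<dots> = M ^ CARD('d) * decay t"
      unfolding decay_def prod.distrib by simp
    finally show ?thesis .
  qed
  finally show "exp (C * norm t - c * (norm t)\<^sup>2) \<le> (exp (C\<^sup>2 / (2 * c)) * M ^ CARD('d)) * decay t"
    by (simp add: mult_left_mono mult.assoc)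
qed (use c in \<open>auto intro!: mult_nonneg_nonneg zero_le_power simp: le_max_iff_disj\<close>)

lemma gaussian_decay_le_decay:
  assumes "gaussian_decay f"
  shows "\<exists>K\<ge>0. \<forall>t. cmod (f t) \<le> K * decay t"
proof -
  obtain L D d where f: "L \<ge> 0" "D \<ge> 0" "d > 0" "\<And>t. cmod (f t) \<le> L * exp (D * norm t - d * (norm t)\<^sup>2)"
    using assms unfolding gaussian_decay_def by auto
  obtain K where K: "K \<ge> 0" "\<And>t::real^'a. exp (D * norm t - d * (norm t)\<^sup>2) \<le> K * decay t"
    using exp_quadratic_le_decay[OF f(3)] by metis
  have "cmod (f t) \<le> (L * K) * decay t" for t
    using order_trans[OF f(4) mult_left_mono[OF K(2) f(1)]] by (simp add: mult.assoc)
  then show ?thesis using f K by (intro exI[of _ "L * K"]) auto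
qed

lemma gaussian_decay_L2:
  assumes "gaussian_decay f"
  shows "f \<in> L2"
proof -
  obtain K where K: "K \<ge> 0" "\<And>t. cmod (f t) \<le> K * decay t"
    using gaussian_decay_le_decay[OF assms] by auto
  have "integrable lborel (\<lambda>t. (cmod (f t))\<^sup>2)"
  proof (rule Bochner_Integration.integrable_bound[OF integrable_mult_right[OF integrable_decay, of "K\<^sup>2"]])
    show "(\<lambda>t. (cmod (f t))\<^sup>2) \<in> borel_measurable lborel"
      using assms unfolding gaussian_decay_def by auto
    have "(cmod (f t))\<^sup>2 \<le> K\<^sup>2 * decay t" for t
    proof -
      have "(cmod (f t))\<^sup>2 \<le> (K * decay t)\<^sup>2" by (intro power_mono K) auto
      also have "\<dots> \<le> K\<^sup>2 * decay t"
        using decay_pos[of t] decay_le_1[of t] unfolding power_mult_distrib power2_eq_square[of "decay t"]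
        by (intro mult_left_mono) (auto simp: mult_le_cancel_right1)
      finally show ?thesis .
    qed
    then show "AE t in lborel. norm ((cmod (f t))\<^sup>2) \<le> norm (K\<^sup>2 * decay t)"
      by (intro AE_I2) (simp add: abs_mult abs_of_pos[OF decay_pos])
  qed
  then show ?thesis using assms unfolding L2_def gaussian_decay_def by auto
qed

lemma L2_times_gaussian_decay_integrable:
  assumes g: "g \<in> L2" and f: "gaussian_decay f"
  shows "integrable lborel (\<lambda>t. g t * f t)"
proof -
  obtain K where K: "K \<ge> 0" "\<And>t. cmod (f t) \<le> K * decay t"
    using gaussian_decay_le_decay[OF f] by auto
  show ?thesis
  proof (rule Bochner_Integration.integrable_bound[OF integrable_mult_right[OF L2_times_decay[OF g], of K]])
    show "(\<lambda>t. g t * f t) \<in> borel_measurable lborel"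
      using f g unfolding gaussian_decay_def L2_def by auto
    have "cmod (g t * f t) \<le> K * (cmod (g t) * decay t)" for t
      unfolding norm_mult using mult_left_mono[OF K(2)[of t], of "cmod (g t)"] by (simp add: mult_ac)
    then show "AE t in lborel. norm (g t * f t) \<le> norm (K * (cmod (g t) * decay t))"
      by (intro AE_I2) (metis abs_ge_self order_trans real_norm_def)
  qed
qed

lemma norm_gaussian:
  "cmod (gaussian Z t) = exp (- pi * (t \<bullet> ((\<chi> i j. Im (Z $ i $ j)) *v t)))"
proof -
  have "Im (cdot (Z *v complex_vec t) (complex_vec t)) = t \<bullet> ((\<chi> i j. Im (Z $ i $ j)) *v t)"
    unfolding cdot_def matrix_vector_mult_def complex_vec_def inner_vec_def
    by (simp add: Im_sum sum_distrib_right mult.commute)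
  then show ?thesis unfolding gaussian_def norm_exp_eq_Re by simp
qed

lemma gaussian_measurable: "gaussian Z \<in> borel_measurable borel"
  unfolding gaussian_def
  by (intro borel_measurable_continuous_onI continuous_on_exp continuous_on_mult
        continuous_on_const continuous_on_cdot_quadratic)

text \<open>The positive quadratic form attains a positive minimum \<open>c\<close> on the compact
  unit sphere, and homogeneity turns this into the lower bound
  \<open>c * (norm t)^2\<close>.\<close>

lemma gaussian_decay_gaussian:
  assumes "Z \<in> siegel_upper_half_space"
  shows "gaussian_decay (gaussian Z)"
proof -
  define Y :: "real^'a^'a" where "Y = (\<chi> i j. Im (Z $ i $ j))"
  have pos: "x \<bullet> (Y *v x) > 0" if "x \<noteq> 0" for x
    using assms that unfolding siegel_upper_half_space_def Y_def by auto
  have "sphere (0 :: real^'a) 1 \<noteq> {}" by simp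
  moreover have "continuous_on (sphere 0 1) (\<lambda>x. x \<bullet> (Y *v x))"
    by (intro continuous_intros matrix_vector_mult_linear_continuous_on)
  ultimately obtain u where u: "u \<in> sphere 0 1" "\<And>x. x \<in> sphere 0 1 \<Longrightarrow> u \<bullet> (Y *v u) \<le> x \<bullet> (Y *v x)"
    using continuous_attains_inf[OF compact_sphere[of "0 :: real^'a" 1], of "\<lambda>x. x \<bullet> (Y *v x)"]
    by blast
  define c where "c = u \<bullet> (Y *v u)"
  have c: "c > 0" unfolding c_def using u(1) by (intro pos) auto
  have "c * (norm t)\<^sup>2 \<le> t \<bullet> (Y *v t)" for t
  proof (cases "t = 0")
    case False
    define v where "v = t /\<^sub>R norm t"
    have t: "t = norm t *\<^sub>R v" using False unfolding v_def by simp
    have "c \<le> v \<bullet> (Y *v v)" unfolding c_def using False by (intro u) (simp add: v_def)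
    then have "c * (norm t)\<^sup>2 \<le> (v \<bullet> (Y *v v)) * (norm t)\<^sup>2" by (intro mult_right_mono) auto
    also have "\<dots> = t \<bullet> (Y *v t)"
    proof -
      have "t \<bullet> (Y *v t) = (norm t *\<^sub>R v) \<bullet> (Y *v (norm t *\<^sub>R v))" using t by presburger
      then show ?thesis by (simp add: matrix_vector_mult_scaleR power2_eq_square)
    qed
    finally show ?thesis .
  qed simp
  then have "cmod (gaussian Z t) \<le> 1 * exp (0 * norm t - (pi * c) * (norm t)\<^sup>2)" for t
    unfolding norm_gaussian Y_def[symmetric] by simp
  then show ?thesis using c gaussian_measurable
    by (intro gaussian_decayI[of _ 1 0 "pi * c"]) auto
qed

section \<open>Square-integrable functions and bounded operators\<close>

lemma L2_measurable: "f \<in> L2 \<Longrightarrow> f \<in> borel_measurable borel"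
  unfolding L2_def by auto

lemma L2_norm_nonneg: "0 \<le> L2_norm f"
  unfolding L2_norm_def by simp

lemma L2_norm_squared: "(L2_norm f)\<^sup>2 = (\<integral>t. (cmod (f t))\<^sup>2 \<partial>lborel)"
  unfolding L2_norm_def by simp

lemma L2_lincomb:
  assumes "f \<in> L2" "g \<in> L2"
  shows "(\<lambda>t. a * f t + b * g t) \<in> L2"
proof -
  have "integrable lborel (\<lambda>t. (cmod (a * f t + b * g t))\<^sup>2)"
  proof (rule Bochner_Integration.integrable_bound)
    show "integrable lborel (\<lambda>t. 2 * (cmod a)\<^sup>2 * (cmod (f t))\<^sup>2 + 2 * (cmod b)\<^sup>2 * (cmod (g t))\<^sup>2)"
      using assms unfolding L2_def by auto
    show "(\<lambda>t. (cmod (a * f t + b * g t))\<^sup>2) \<in> borel_measurable lborel"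
      using assms unfolding L2_def by auto
    have "(cmod (x + y))\<^sup>2 \<le> 2 * (cmod x)\<^sup>2 + 2 * (cmod y)\<^sup>2" for x y
    proof -
      have "(cmod (x + y))\<^sup>2 \<le> (cmod x + cmod y)\<^sup>2" by (intro power_mono norm_triangle_ineq) auto
      also have "\<dots> \<le> 2 * (cmod x)\<^sup>2 + 2 * (cmod y)\<^sup>2"
        using sum_squares_bound[of "cmod x" "cmod y"] by (simp add: power2_sum)
      finally show ?thesis .
    qed
    from this[of "a * f t" "b * g t" for t]
    show "AE t in lborel. norm ((cmod (a * f t + b * g t))\<^sup>2) \<le>
        norm (2 * (cmod a)\<^sup>2 * (cmod (f t))\<^sup>2 + 2 * (cmod b)\<^sup>2 * (cmod (g t))\<^sup>2)"
      by (intro AE_I2) (simp add: norm_mult power_mult_distrib mult.assoc)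
  qed
  then show ?thesis using assms unfolding L2_def by auto
qed

lemma L2_diff: "f \<in> L2 \<Longrightarrow> g \<in> L2 \<Longrightarrow> (\<lambda>t. f t - g t) \<in> L2"
  using L2_lincomb[of f g 1 "-1"] by simp

lemma L2_cong_AE_norm: "AE t in lborel. f t = g t \<Longrightarrow> f \<in> borel_measurable borel \<Longrightarrow>
    g \<in> borel_measurable borel \<Longrightarrow> L2_norm f = L2_norm g"
  unfolding L2_norm_def by (intro arg_cong[of _ _ sqrt] integral_cong_AE) auto

lemma L2_norm_zero_iff:
  assumes "f \<in> L2"
  shows "L2_norm f = 0 \<longleftrightarrow> (AE t in lborel. f t = 0)"
proof -
  have "(\<integral>t. (cmod (f t))\<^sup>2 \<partial>lborel) = 0 \<longleftrightarrow> (AE t in lborel. (cmod (f t))\<^sup>2 = 0)"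
    using assms unfolding L2_def by (intro integral_nonneg_eq_0_iff_AE) auto
  then show ?thesis unfolding L2_norm_def by simp
qed

lemma L2_Cauchy_Schwarz:
  assumes f: "f \<in> L2" and g: "g \<in> L2"
  shows "integrable lborel (\<lambda>t. f t * g t)"
    and "cmod (\<integral>t. f t * g t \<partial>lborel) \<le> L2_norm f * L2_norm g"
proof -
  have m: "f \<in> borel_measurable borel" "g \<in> borel_measurable borel" using f g L2_measurable by auto
  have i: "integrable lborel (\<lambda>t. (cmod (f t))\<^sup>2)" "integrable lborel (\<lambda>t. (cmod (g t))\<^sup>2)"
    using f g unfolding L2_def by auto
  show int: "integrable lborel (\<lambda>t. f t * g t)"
  proof (rule Bochner_Integration.integrable_bound[OF Bochner_Integration.integrable_add[OF i]])
    show "(\<lambda>t. f t * g t) \<in> borel_measurable lborel" using m by auto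
    have "cmod x * cmod y \<le> (cmod x)\<^sup>2 + (cmod y)\<^sup>2" for x y
    proof -
      have "2 * (cmod x * cmod y) \<le> (cmod x)\<^sup>2 + (cmod y)\<^sup>2"
        using sum_squares_bound[of "cmod x" "cmod y"] by simp
      moreover have "0 \<le> cmod x * cmod y" by simp
      ultimately show ?thesis by linarith
    qed
    then show "AE t in lborel. norm (f t * g t) \<le> norm ((cmod (f t))\<^sup>2 + (cmod (g t))\<^sup>2)"
      by (intro AE_I2) (simp add: norm_mult)
  qed
  have i': "integrable lborel (\<lambda>t. cmod (f t) * cmod (g t))"
    using integrable_norm[OF int] by (simp add: norm_mult)
  have "ennreal ((\<integral>t. cmod (f t) * cmod (g t) \<partial>lborel)\<^sup>2) =
      (\<integral>\<^sup>+t. ennreal (cmod (f t)) * ennreal (cmod (g t)) \<partial>lborel)\<^sup>2"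
    using nn_integral_eq_integral[OF i'] by (simp add: ennreal_power ennreal_mult)
  also have "\<dots> \<le> (\<integral>\<^sup>+t. (ennreal (cmod (f t)))\<^sup>2 \<partial>lborel) * (\<integral>\<^sup>+t. (ennreal (cmod (g t)))\<^sup>2 \<partial>lborel)"
    using m by (intro Cauchy_Schwarz_nn_integral) auto
  also have "\<dots> = ennreal ((L2_norm f)\<^sup>2) * ennreal ((L2_norm g)\<^sup>2)"
    unfolding L2_norm_squared
    using nn_integral_eq_integral[OF i(1)] nn_integral_eq_integral[OF i(2)] by (simp add: ennreal_power)
  finally have "(\<integral>t. cmod (f t) * cmod (g t) \<partial>lborel)\<^sup>2 \<le> (L2_norm f * L2_norm g)\<^sup>2"
    by (simp add: ennreal_mult[symmetric] power_mult_distrib)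
  then have "(\<integral>t. cmod (f t) * cmod (g t) \<partial>lborel) \<le> L2_norm f * L2_norm g"
    by (rule power2_le_imp_le) (simp add: L2_norm_nonneg)
  moreover have "cmod (\<integral>t. f t * g t \<partial>lborel) \<le> (\<integral>t. cmod (f t) * cmod (g t) \<partial>lborel)"
    using integral_norm_bound[of lborel "\<lambda>t. f t * g t"] by (simp add: norm_mult)
  ultimately show "cmod (\<integral>t. f t * g t \<partial>lborel) \<le> L2_norm f * L2_norm g" by linarith
qed

lemma L2_tendsto_integral:
  assumes "\<And>n. f n \<in> L2" "f0 \<in> L2" "\<phi> \<in> L2" "(\<lambda>n. L2_norm (\<lambda>t. f n t - f0 t)) \<longlonglongrightarrow> 0"
  shows "(\<lambda>n. \<integral>t. f n t * \<phi> t \<partial>lborel) \<longlonglongrightarrow> (\<integral>t. f0 t * \<phi> t \<partial>lborel)"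
proof (rule Lim_null_comparison[THEN LIM_zero_cancel])
  show "(\<lambda>n. L2_norm (\<lambda>t. f n t - f0 t) * L2_norm \<phi>) \<longlonglongrightarrow> 0"
    using tendsto_mult_left_zero[OF assms(4)] .
  have "(\<integral>t. f n t * \<phi> t \<partial>lborel) - (\<integral>t. f0 t * \<phi> t \<partial>lborel) = (\<integral>t. (f n t - f0 t) * \<phi> t \<partial>lborel)" for n
    using L2_Cauchy_Schwarz(1)[OF assms(1)[of n] assms(3)] L2_Cauchy_Schwarz(1)[OF assms(2,3)]
    by (simp add: left_diff_distrib)
  then show "eventually (\<lambda>n. norm ((\<integral>t. f n t * \<phi> t \<partial>lborel) - (\<integral>t. f0 t * \<phi> t \<partial>lborel)) \<le>
      L2_norm (\<lambda>t. f n t - f0 t) * L2_norm \<phi>) sequentially"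
    using L2_Cauchy_Schwarz(2)[OF L2_diff[OF assms(1,2)] assms(3)] by simp
qed

lemma L2_dominated_convergence:
  fixes f :: "nat \<Rightarrow> real^'d::finite \<Rightarrow> complex"
  assumes f: "\<And>n. f n \<in> borel_measurable borel" and f0: "f0 \<in> borel_measurable borel"
    and h: "integrable lborel (\<lambda>t. (h t :: real)\<^sup>2)"
    and lim: "\<And>t. (\<lambda>n. f n t) \<longlonglongrightarrow> f0 t"
    and le: "\<And>n t. cmod (f n t) \<le> h t"
  shows "(\<lambda>n. L2_norm (\<lambda>t. f n t - f0 t)) \<longlonglongrightarrow> 0"
proof -
  have le0: "cmod (f0 t) \<le> h t" for t
    by (rule LIMSEQ_le_const2[OF tendsto_norm[OF lim]]) (use le in auto)
  have "(\<lambda>n. \<integral>t. (cmod (f n t - f0 t))\<^sup>2 \<partial>lborel) \<longlonglongrightarrow> integral\<^sup>L lborel (\<lambda>t::real^'d. 0)"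
  proof (rule integral_dominated_convergence[where w="\<lambda>t. 4 * (h t)\<^sup>2"])
    show "AE t in lborel. (\<lambda>n. (cmod (f n t - f0 t))\<^sup>2) \<longlonglongrightarrow> 0"
    proof (rule AE_I2)
      fix t
      have "(\<lambda>n. (cmod (f n t - f0 t))\<^sup>2) \<longlonglongrightarrow> (cmod (f0 t - f0 t))\<^sup>2"
        by (intro tendsto_intros lim)
      then show "(\<lambda>n. (cmod (f n t - f0 t))\<^sup>2) \<longlonglongrightarrow> 0" by simp
    qed
    show "AE t in lborel. norm ((cmod (f n t - f0 t))\<^sup>2) \<le> 4 * (h t)\<^sup>2" for n
    proof (rule AE_I2)
      fix t
      have "cmod (f n t - f0 t) \<le> 2 * h t"
        using le[of n t] le0[of t] norm_triangle_ineq4[of "f n t" "f0 t"] by linarith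
      then have "(cmod (f n t - f0 t))\<^sup>2 \<le> (2 * h t)\<^sup>2" by (intro power_mono) auto
      then show "norm ((cmod (f n t - f0 t))\<^sup>2) \<le> 4 * (h t)\<^sup>2" by (simp add: power_mult_distrib)
    qed
  qed (use f f0 h in auto)
  then have "(\<lambda>n. sqrt (\<integral>t. (cmod (f n t - f0 t))\<^sup>2 \<partial>lborel)) \<longlonglongrightarrow> sqrt 0"
    by (intro tendsto_real_sqrt) simp
  then show ?thesis unfolding L2_norm_def by simp
qed

lemma bounded_L2_operatorD:
  assumes "bounded_L2_operator T"
  shows "f \<in> L2 \<Longrightarrow> T f \<in> L2"
    and "f \<in> L2 \<Longrightarrow> g \<in> L2 \<Longrightarrow> AE t in lborel. T (\<lambda>s. a * f s + b * g s) t = a * T f t + b * T g t"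
    and "\<exists>K\<ge>0. \<forall>f\<in>L2. L2_norm (T f) \<le> K * L2_norm f"
proof -
  obtain K where K: "\<forall>f\<in>L2. L2_norm (T f) \<le> K * L2_norm f"
    using assms unfolding bounded_L2_operator_def by blast
  \<comment> \<open>The definition of boundedness leaves the sign of \<open>K\<close> open; passing
    to \<open>max 0 K\<close> makes the constant nonnegative.\<close>
  have "L2_norm (T f) \<le> max 0 K * L2_norm f" if "f \<in> L2" for f
  proof -
    have "K * L2_norm f \<le> max 0 K * L2_norm f" by (intro mult_right_mono L2_norm_nonneg) auto
    then show ?thesis using K that by fastforce
  qed
  then show "\<exists>K\<ge>0. \<forall>f\<in>L2. L2_norm (T f) \<le> K * L2_norm f"
    by (intro exI[of _ "max 0 K"]) auto
qed (use assms in \<open>unfold bounded_L2_operator_def, blast+\<close>)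

lemma bounded_L2_operator_tendsto:
  assumes T: "bounded_L2_operator T"
    and f: "\<And>n. f n \<in> L2" "f0 \<in> L2" "(\<lambda>n. L2_norm (\<lambda>t. f n t - f0 t)) \<longlonglongrightarrow> 0"
  shows "(\<lambda>n. L2_norm (\<lambda>t. T (f n) t - T f0 t)) \<longlonglongrightarrow> 0"
proof -
  obtain K where K: "K \<ge> 0" "\<And>f. f \<in> L2 \<Longrightarrow> L2_norm (T f) \<le> K * L2_norm f"
    using bounded_L2_operatorD(3)[OF T] by blast
  have m: "T g \<in> borel_measurable borel" if "g \<in> L2" for g
    using that L2_measurable bounded_L2_operatorD(1)[OF T] by blast
  have "L2_norm (\<lambda>t. T (f n) t - T f0 t) \<le> K * L2_norm (\<lambda>t. f n t - f0 t)" for n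
  proof -
    have "AE t in lborel. T (\<lambda>s. f n s - f0 s) t = T (f n) t - T f0 t"
      using bounded_L2_operatorD(2)[OF T f(1)[of n] f(2), of 1 "-1"] by simp
    then have "L2_norm (\<lambda>t. T (f n) t - T f0 t) = L2_norm (T (\<lambda>s. f n s - f0 s))"
      using m[OF f(1)[of n]] m[OF f(2)] m[OF L2_diff[OF f(1)[of n] f(2)]]
      by (intro L2_cong_AE_norm) auto
    then show ?thesis using K(2)[OF L2_diff[OF f(1)[of n] f(2)]] by simp
  qed
  then show ?thesis
    by (intro Lim_null_comparison[OF _ tendsto_mult_right_zero[OF f(3), of K]])
      (auto simp: L2_norm_nonneg)
qed

lemma bounded_L2_operator_kernel_closed:
  assumes T: "bounded_L2_operator T"
    and f: "\<And>n. f n \<in> L2" "f0 \<in> L2" "(\<lambda>n. L2_norm (\<lambda>t. f n t - f0 t)) \<longlonglongrightarrow> 0"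
    and zero: "\<And>n. AE t in lborel. T (f n) t = 0"
  shows "AE t in lborel. T f0 t = 0"
proof -
  have m: "T g \<in> borel_measurable borel" if "g \<in> L2" for g
    using that L2_measurable bounded_L2_operatorD(1)[OF T] by blast
  have "L2_norm (\<lambda>t. T (f n) t - T f0 t) = L2_norm (T f0)" for n
  proof -
    have "L2_norm (\<lambda>t. T (f n) t - T f0 t) = L2_norm (\<lambda>t. - T f0 t)"
      using zero[of n] m[OF f(1)[of n]] m[OF f(2)] by (intro L2_cong_AE_norm) auto
    then show ?thesis by (simp add: L2_norm_def)
  qed
  then have "L2_norm (T f0) = 0"
    using bounded_L2_operator_tendsto[OF T f] by (simp add: LIMSEQ_const_iff)
  then show ?thesis using L2_norm_zero_iff bounded_L2_operatorD(1)[OF T f(2)] by blast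
qed

text \<open>The totality of the modulations of \<open>\<Phi>\<close> in \<open>L\<^sup>2\<close>, phrased through kernels of bounded operators
  so that no orthogonal complement is needed.\<close>

lemma bounded_L2_operator_zero:
  assumes T: "bounded_L2_operator T"
    and \<Phi>: "gaussian_decay \<Phi>" "\<And>t. \<Phi> t \<noteq> 0"
    and zero: "\<And>\<xi>. AE t in lborel. T (\<lambda>s. exp (2 * of_real pi * \<i> * of_real (\<xi> \<bullet> s)) * \<Phi> s) t = 0"
    and f: "f \<in> L2"
  shows "AE t in lborel. T f t = 0"
proof -
  have \<Phi>L2: "\<Phi> \<in> L2" and \<Phi>m: "\<Phi> \<in> borel_measurable borel"
    using gaussian_decay_L2[OF \<Phi>(1)] L2_measurable by auto
  have dom: "(\<lambda>t. h t * \<Phi> t) \<in> L2" if h: "h \<in> borel_measurable borel" "\<And>t. cmod (h t) \<le> K" for h K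
  proof -
    have "integrable lborel (\<lambda>t. (cmod (h t * \<Phi> t))\<^sup>2)"
    proof (rule Bochner_Integration.integrable_bound)
      show "integrable lborel (\<lambda>t. K\<^sup>2 * (cmod (\<Phi> t))\<^sup>2)" using \<Phi>L2 unfolding L2_def by auto
      show "(\<lambda>t. (cmod (h t * \<Phi> t))\<^sup>2) \<in> borel_measurable lborel" using h \<Phi>m by auto
      show "AE t in lborel. norm ((cmod (h t * \<Phi> t))\<^sup>2) \<le> norm (K\<^sup>2 * (cmod (\<Phi> t))\<^sup>2)"
        using h(2) by (intro AE_I2) (auto simp: norm_mult power_mult_distrib intro!: mult_right_mono power_mono)
    qed
    then show ?thesis using h \<Phi>m unfolding L2_def by auto
  qed
  have L2h: "(\<lambda>t. h t * \<Phi> t) \<in> L2" if "h \<in> trig_closure" for h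
    using dom trig_closure_measurable[OF that] trig_closure_bounded[OF that] by metis
  have trig: "AE t in lborel. T (\<lambda>s. h s * \<Phi> s) t = 0" if "h \<in> trig_closure" for h
    using that
  proof (induction rule: trig_closure.induct)
    case (character \<xi>)
    show ?case by (rule zero)
  next
    case (lincomb h k a b)
    have "(\<lambda>s. (a * h s + b * k s) * \<Phi> s) = (\<lambda>s. a * (h s * \<Phi> s) + b * (k s * \<Phi> s))"
      by (simp add: algebra_simps)
    then show ?case
      using bounded_L2_operatorD(2)[OF T L2h[OF lincomb(1)] L2h[OF lincomb(2)], of a b] lincomb(3,4)
      by auto
  next
    case (bounded_limit h K k)
    have k: "k \<in> trig_closure" using trig_closure.bounded_limit[OF bounded_limit.hyps] .
    show ?case
    proof (rule bounded_L2_operator_kernel_closed[OF T, where f="\<lambda>n s. h n s * \<Phi> s"])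
      show "(\<lambda>n. L2_norm (\<lambda>t. h n t * \<Phi> t - k t * \<Phi> t)) \<longlonglongrightarrow> 0"
      proof (rule L2_dominated_convergence[where h="\<lambda>t. K * cmod (\<Phi> t)"])
        show "integrable lborel (\<lambda>t. (K * cmod (\<Phi> t))\<^sup>2)"
          using \<Phi>L2 unfolding L2_def by (simp add: power_mult_distrib)
        show "(\<lambda>n. h n t * \<Phi> t) \<longlonglongrightarrow> k t * \<Phi> t" for t
          by (intro tendsto_intros bounded_limit.hyps)
        show "cmod (h n t * \<Phi> t) \<le> K * cmod (\<Phi> t)" for n t
          unfolding norm_mult by (intro mult_right_mono bounded_limit.hyps) auto
        show "(\<lambda>t. h n t * \<Phi> t) \<in> borel_measurable borel" for n
          by (rule L2_measurable[OF L2h[OF bounded_limit.hyps(1)]])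
        show "(\<lambda>t. k t * \<Phi> t) \<in> borel_measurable borel"
          by (rule L2_measurable[OF L2h[OF k]])
      qed
    qed (use bounded_limit L2h k in auto)
  qed
  have fm: "f \<in> borel_measurable borel" using f by (rule L2_measurable)
  \<comment> \<open>\<open>F n * \<Phi>\<close> is \<open>f\<close> cut off to the set where
    \<open>cmod f \<le> n * cmod \<Phi>\<close>. There \<open>f / \<Phi>\<close> is bounded, so
    \<open>F n\<close> lies in the closure; since \<Phi> has no zeros these sets exhaust the space,
    with \<open>cmod f\<close> as majorant.\<close>
  define F where "F n t = (if cmod (f t) \<le> real n * cmod (\<Phi> t) then f t / \<Phi> t else 0)" for n :: nat and t
  have Fle: "cmod (F n t) \<le> real n" for n t
    unfolding F_def using \<Phi>(2)[of t] by (auto simp: norm_divide divide_le_eq)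
  have Fm: "F n \<in> borel_measurable borel" for n
    unfolding F_def using fm \<Phi>m by measurable
  have Fc: "F n \<in> trig_closure" for n
    by (rule bounded_borel_in_trig_closure[OF Fm Fle])
  show ?thesis
  proof (rule bounded_L2_operator_kernel_closed[OF T _ f, where f="\<lambda>n s. F n s * \<Phi> s"])
    show "(\<lambda>t. F n t * \<Phi> t) \<in> L2" for n by (rule L2h[OF Fc])
    show "AE t in lborel. T (\<lambda>s. F n s * \<Phi> s) t = 0" for n by (rule trig[OF Fc])
    show "(\<lambda>n. L2_norm (\<lambda>t. F n t * \<Phi> t - f t)) \<longlonglongrightarrow> 0"
    proof (rule L2_dominated_convergence[where h="\<lambda>t. cmod (f t)"])
      show "cmod (F n t * \<Phi> t) \<le> cmod (f t)" for n t unfolding F_def using \<Phi>(2)[of t] by auto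
      show "(\<lambda>n. F n t * \<Phi> t) \<longlonglongrightarrow> f t" for t
      proof (rule tendsto_eventually, rule eventually_sequentiallyI)
        fix n assume "nat \<lceil>cmod (f t) / cmod (\<Phi> t)\<rceil> \<le> n"
        then have "cmod (f t) / cmod (\<Phi> t) \<le> real n" by linarith
        then have "cmod (f t) \<le> real n * cmod (\<Phi> t)" using \<Phi>(2)[of t] by (simp add: divide_le_eq)
        then show "F n t * \<Phi> t = f t" unfolding F_def using \<Phi>(2)[of t] by simp
      qed
      show "integrable lborel (\<lambda>t. (cmod (f t))\<^sup>2)" using f unfolding L2_def by auto
      show "(\<lambda>t. F n t * \<Phi> t) \<in> borel_measurable borel" for n
        by (rule L2_measurable[OF L2h[OF Fc]])
    qed (rule fm)
  qed
qed

section \<open>Difference quotients\<close>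

lemma norm_exp_minus_one_le: "cmod (exp u - 1) \<le> cmod u * exp (cmod u)"
proof -
  have "cmod (exp u - exp 0) \<le> exp (cmod u) * cmod (u - 0)"
  proof (rule field_differentiable_bound[where S="cball 0 (cmod u)"])
    show "(exp has_field_derivative exp z) (at z within cball 0 (cmod u))" for z :: complex
      by (auto intro!: derivative_eq_intros)
    show "cmod (exp z) \<le> exp (cmod u)" if "z \<in> cball 0 (cmod u)" for z
      using that complex_Re_le_cmod[of z] by (auto simp: norm_exp_eq_Re)
  qed auto
  then show ?thesis by (simp add: mult.commute)
qed

text \<open>The exponent has this form because along the ray \<open>s z\<close> the linear part of
  the Schroedinger action scales with \<open>s\<close> and its phase with \<open>s^2\<close>. The
  exponent is of size \<open>s\<close> times a constant, so dividing by \<open>s\<close> leaves a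
  bound uniform in \<open>s\<close>.\<close>

lemma difference_quotient_le:
  fixes s :: real
  assumes "s \<noteq> 0" "\<bar>s\<bar> \<le> R"
  shows "cmod ((exp (of_real s * \<alpha> + (of_real s)\<^sup>2 * \<beta>) - 1) / of_real s) \<le>
    (cmod \<alpha> + R * cmod \<beta>) * exp (R * (cmod \<alpha> + R * cmod \<beta>))"
proof -
  define u where "u = of_real s * \<alpha> + (of_real s)\<^sup>2 * \<beta>"
  define b where "b = cmod \<alpha> + R * cmod \<beta>"
  have b: "b \<ge> 0" unfolding b_def using assms by simp
  have u: "cmod u \<le> \<bar>s\<bar> * b"
  proof -
    have "cmod u \<le> \<bar>s\<bar> * cmod \<alpha> + \<bar>s\<bar> * (\<bar>s\<bar> * cmod \<beta>)"
      unfolding u_def by (rule order_trans[OF norm_triangle_ineq]) (simp add: norm_mult norm_power power2_eq_square)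
    also have "\<dots> \<le> \<bar>s\<bar> * cmod \<alpha> + \<bar>s\<bar> * (R * cmod \<beta>)"
      using assms by (intro add_left_mono mult_left_mono mult_right_mono) auto
    finally show ?thesis unfolding b_def by (simp add: algebra_simps)
  qed
  also have "\<dots> \<le> R * b" using assms b by (intro mult_right_mono)
  finally have u': "cmod u \<le> R * b" .
  have "cmod (exp u - 1) \<le> (\<bar>s\<bar> * b) * exp (R * b)"
    using u u' by (intro order_trans[OF norm_exp_minus_one_le] mult_mono) (auto simp: b)
  then show ?thesis using assms(1) unfolding u_def[symmetric] b_def[symmetric]
    by (simp add: norm_divide divide_le_eq mult_ac)
qed

lemma difference_quotient_tendsto:
  fixes s :: "nat \<Rightarrow> real"
  assumes "\<And>n. s n \<noteq> 0" "s \<longlonglongrightarrow> 0"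
  shows "(\<lambda>n. (exp (of_real (s n) * \<alpha> + (of_real (s n))\<^sup>2 * \<beta>) - 1) / of_real (s n)) \<longlonglongrightarrow> (\<alpha> :: complex)"
proof -
  have "((\<lambda>z. exp (z * \<alpha> + z\<^sup>2 * \<beta>)) has_field_derivative \<alpha>) (at 0)"
    by (auto intro!: derivative_eq_intros)
  then have "((\<lambda>h. (exp (h * \<alpha> + h\<^sup>2 * \<beta>) - 1) / h) \<longlongrightarrow> \<alpha>) (at 0)"
    by (simp add: DERIV_def)
  moreover have "filterlim (\<lambda>n. complex_of_real (s n)) (at 0) sequentially"
    using assms tendsto_of_real[OF assms(2), where 'a=complex] by (auto simp: filterlim_at)
  ultimately show ?thesis by (rule filterlim_compose)
qed

text \<open>Convergence is needed in the \<open>L2\<close> norm, the only mode in which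
  \<open>T\<close> is known to be continuous. Although \<alpha> is unbounded in \<open>t\<close>,
  the bound \<open>y * exp (R * y) \<le> exp ((1 + R) * y)\<close> makes the majorant exponential in
  \<open>norm t\<close>, and the decay of \<Psi> absorbs it. The parameters \<open>c\<close>,
  \<open>k\<close>, \<open>a\<close> cover the Gaussian inside \<open>T\<close> as well as the test
  functions.\<close>

lemma L2_difference_quotient:
  fixes s :: "nat \<Rightarrow> real" and \<Psi> :: "real^'d::finite \<Rightarrow> complex" and c k :: complex and a :: "complex^'d"
  assumes s: "\<And>n. s n \<noteq> 0" "s \<longlonglongrightarrow> 0" and \<Psi>: "gaussian_decay \<Psi>"
  defines "\<alpha> \<equiv> \<lambda>t. c + k * cdot a (complex_vec t)"
  shows "gaussian_decay (\<lambda>t. (exp (of_real (s n) * \<alpha> t + (of_real (s n))\<^sup>2 * \<beta>) - 1) / of_real (s n) * \<Psi> t)"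
    and "gaussian_decay (\<lambda>t. \<alpha> t * \<Psi> t)"
    and "(\<lambda>n. L2_norm (\<lambda>t. (exp (of_real (s n) * \<alpha> t + (of_real (s n))\<^sup>2 * \<beta>) - 1) / of_real (s n) * \<Psi> t
             - \<alpha> t * \<Psi> t)) \<longlonglongrightarrow> 0"
proof -
  have e: "exp (of_real (s n) * \<alpha> t + (of_real (s n))\<^sup>2 * \<beta>) =
      exp ((of_real (s n) * c + (of_real (s n))\<^sup>2 * \<beta>) + (of_real (s n) * k) * cdot a (complex_vec t))" for n t
    unfolding \<alpha>_def by (simp add: algebra_simps)
  have "exp_growth (\<lambda>t. (1 / of_real (s n)) * (exp (of_real (s n) * \<alpha> t + (of_real (s n))\<^sup>2 * \<beta>) - 1))" for n
    unfolding e by (intro exp_growth_intros)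
  from gaussian_decay_mult[OF this \<Psi>]
  show g1: "gaussian_decay (\<lambda>t. (exp (of_real (s n) * \<alpha> t + (of_real (s n))\<^sup>2 * \<beta>) - 1) / of_real (s n) * \<Psi> t)" for n
    by simp
  show g2: "gaussian_decay (\<lambda>t. \<alpha> t * \<Psi> t)"
    unfolding \<alpha>_def by (intro gaussian_decay_mult[OF _ \<Psi>] exp_growth_intros)
  have "Bseq s" using s(2) convergent_imp_Bseq convergentI by blast
  then obtain R where R: "R > 0" "\<And>n. \<bar>s n\<bar> \<le> R" by (auto elim: BseqE)
  define h where "h t = (cmod (\<alpha> t) + R * cmod \<beta>) * exp (R * (cmod (\<alpha> t) + R * cmod \<beta>)) * cmod (\<Psi> t)" for t
  obtain K C d where \<Psi>b: "K \<ge> 0" "C \<ge> 0" "d > 0" "\<And>t. cmod (\<Psi> t) \<le> K * exp (C * norm t - d * (norm t)\<^sup>2)"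
    using \<Psi> unfolding gaussian_decay_def by auto
  have \<alpha>m: "\<alpha> \<in> borel_measurable borel"
    unfolding \<alpha>_def by (intro borel_measurable_continuous_onI continuous_on_add continuous_on_mult
        continuous_on_const continuous_on_cdot_complex_vec)
  have \<Psi>m: "\<Psi> \<in> borel_measurable borel" using \<Psi> unfolding gaussian_decay_def by auto
  have hb: "cmod (complex_of_real (h t)) \<le> (exp ((1 + R) * (cmod c + R * cmod \<beta>)) * K) *
      exp (((1 + R) * (cmod k * norm a) + C) * norm t - d * (norm t)\<^sup>2)" for t
  proof -
    define y where "y = cmod (\<alpha> t) + R * cmod \<beta>"
    have y: "0 \<le> y" unfolding y_def using R by simp
    have y': "y \<le> (cmod c + R * cmod \<beta>) + (cmod k * norm a) * norm t"
    proof -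
      have "cmod (\<alpha> t) \<le> cmod c + cmod k * cmod (cdot a (complex_vec t))"
        unfolding \<alpha>_def by (rule order_trans[OF norm_triangle_ineq]) (simp add: norm_mult)
      also have "\<dots> \<le> cmod c + cmod k * (norm a * norm t)"
        by (intro add_left_mono mult_left_mono norm_cdot_complex_vec_le) auto
      finally show ?thesis unfolding y_def by (simp add: mult.assoc)
    qed
    have "y \<le> exp y" using exp_ge_add_one_self[of y] by linarith
    then have "y * exp (R * y) \<le> exp y * exp (R * y)" by (intro mult_right_mono) auto
    also have "\<dots> = exp ((1 + R) * y)" by (simp add: exp_add[symmetric] algebra_simps)
    also have "\<dots> \<le> exp ((1 + R) * ((cmod c + R * cmod \<beta>) + (cmod k * norm a) * norm t))"
      using y' R by (simp add: mult_left_mono)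
    finally have "y * exp (R * y) * cmod (\<Psi> t) \<le>
        exp ((1 + R) * ((cmod c + R * cmod \<beta>) + (cmod k * norm a) * norm t)) *
        (K * exp (C * norm t - d * (norm t)\<^sup>2))"
      by (intro mult_mono \<Psi>b) auto
    also have "\<dots> = (exp ((1 + R) * (cmod c + R * cmod \<beta>)) * K) *
      exp (((1 + R) * (cmod k * norm a) + C) * norm t - d * (norm t)\<^sup>2)"
      by (simp add: exp_add[symmetric] algebra_simps)
    finally show ?thesis unfolding h_def y_def[symmetric] norm_of_real using y by simp
  qed
  have "(\<lambda>t. complex_of_real (h t)) \<in> borel_measurable borel"
    unfolding h_def using \<alpha>m \<Psi>m by measurable
  then have "gaussian_decay (\<lambda>t. complex_of_real (h t))"
    using hb R \<Psi>b
    by (intro gaussian_decayI[of _ "exp ((1 + R) * (cmod c + R * cmod \<beta>)) * K"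
          "(1 + R) * (cmod k * norm a) + C" d]) auto
  from gaussian_decay_L2[OF this] have h: "integrable lborel (\<lambda>t. (h t)\<^sup>2)" unfolding L2_def by simp
  show "(\<lambda>n. L2_norm (\<lambda>t. (exp (of_real (s n) * \<alpha> t + (of_real (s n))\<^sup>2 * \<beta>) - 1) / of_real (s n) * \<Psi> t
             - \<alpha> t * \<Psi> t)) \<longlonglongrightarrow> 0"
  proof (rule L2_dominated_convergence[OF _ _ h])
    show "(\<lambda>t. (exp (of_real (s n) * \<alpha> t + (of_real (s n))\<^sup>2 * \<beta>) - 1) / of_real (s n) * \<Psi> t) \<in> borel_measurable borel" for n
      using g1[of n] unfolding gaussian_decay_def by auto
    show "(\<lambda>t. \<alpha> t * \<Psi> t) \<in> borel_measurable borel"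
      using g2 unfolding gaussian_decay_def by auto
    show "(\<lambda>n. (exp (of_real (s n) * \<alpha> t + (of_real (s n))\<^sup>2 * \<beta>) - 1) / of_real (s n) * \<Psi> t) \<longlonglongrightarrow> \<alpha> t * \<Psi> t" for t
      by (intro tendsto_mult difference_quotient_tendsto s tendsto_const)
    show "cmod ((exp (of_real (s n) * \<alpha> t + (of_real (s n))\<^sup>2 * \<beta>) - 1) / of_real (s n) * \<Psi> t) \<le> h t" for n t
      unfolding h_def norm_mult[of _ "\<Psi> t"]
      by (intro mult_right_mono difference_quotient_le s R) auto
  qed
qed

section \<open>Gaussian integrals\<close>

lemma lborel_distr_uminus_euclidean: "distr lborel borel uminus = (lborel :: 'a::euclidean_space measure)"
  using lborel_affine[of "-1" "0 :: 'a"] by (simp add: density_1)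

lemma lborel_integral_affine:
  fixes f :: "'a::euclidean_space \<Rightarrow> 'b::{banach, second_countable_topology}"
  assumes f: "f \<in> borel_measurable borel"
  shows "(\<integral>t. f (t + c) \<partial>lborel) = (\<integral>t. f t \<partial>lborel)"
    and "(\<integral>t. f (c - t) \<partial>lborel) = (\<integral>t. f t \<partial>lborel)"
    and "integrable lborel f \<Longrightarrow> integrable lborel (\<lambda>t. f (t + c))"
proof -
  have plus: "(\<integral>t. f (c + t) \<partial>lborel) = (\<integral>t. f t \<partial>lborel)" if "f \<in> borel_measurable borel"
    for f :: "'a \<Rightarrow> 'b" and c
  proof -
    have "(\<integral>t. f t \<partial>lborel) = (\<integral>t. f t \<partial>distr lborel borel ((+) c))"
      by (simp only: lborel_distr_plus)
    also have "\<dots> = (\<integral>t. f (c + t) \<partial>lborel)" using that by (intro integral_distr) auto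
    finally show ?thesis ..
  qed
  from plus[OF f, of c] show "(\<integral>t. f (t + c) \<partial>lborel) = (\<integral>t. f t \<partial>lborel)" by (simp add: add.commute)
  have "(\<integral>t. f (c + t) \<partial>lborel) = (\<integral>t. f (c + t) \<partial>distr lborel borel uminus)"
    by (simp only: lborel_distr_uminus_euclidean)
  also have "\<dots> = (\<integral>t. f (c - t) \<partial>lborel)"
    using f by (subst integral_distr) auto
  finally show "(\<integral>t. f (c - t) \<partial>lborel) = (\<integral>t. f t \<partial>lborel)" using plus[OF f, of c] by simp
  show "integrable lborel (\<lambda>t. f (t + c))" if "integrable lborel f"
  proof -
    have "integrable (distr lborel borel ((+) c)) f" using that by (simp only: lborel_distr_plus)
    then have "integrable lborel (\<lambda>t. f (c + t))" using f by (subst (asm) integrable_distr_eq) auto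
    then show ?thesis by (simp add: add.commute)
  qed
qed

text \<open>Lebesgue measure is the image of the product of the coordinate measures, where the
  integral of a product of one-variable functions splits.\<close>

lemma integral_lborel_prod:
  fixes F :: "'a::euclidean_space \<Rightarrow> real \<Rightarrow> complex"
  assumes F: "\<And>b. b \<in> Basis \<Longrightarrow> integrable lborel (F b)"
  shows "(\<integral>t. (\<Prod>b\<in>Basis. F b (t \<bullet> b)) \<partial>lborel) = (\<Prod>b\<in>Basis. \<integral>x. F b x \<partial>lborel)"
proof -
  interpret product_sigma_finite "\<lambda>b::'a. lborel :: real measure" ..
  have m: "(\<lambda>f. \<Sum>b\<in>Basis. f b *\<^sub>R b) \<in> measurable (Pi\<^sub>M Basis (\<lambda>b::'a. lborel)) borel"
    by measurable
  have Fm: "(\<lambda>t. \<Prod>b\<in>Basis. F b (t \<bullet> b)) \<in> borel_measurable borel"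
  proof (rule borel_measurable_prod)
    fix b :: 'a assume "b \<in> Basis"
    then have "F b \<in> borel_measurable borel" using F[of b] by auto
    then show "(\<lambda>t. F b (t \<bullet> b)) \<in> borel_measurable borel"
      by (rule measurable_compose[rotated]) measurable
  qed
  have "(\<integral>t. (\<Prod>b\<in>Basis. F b (t \<bullet> b)) \<partial>lborel) =
      (\<integral>f. (\<Prod>b\<in>Basis. F b ((\<Sum>c\<in>Basis. f c *\<^sub>R c) \<bullet> b)) \<partial>Pi\<^sub>M Basis (\<lambda>b::'a. lborel))"
    unfolding lborel_eq[where 'a='a] by (rule integral_distr[OF m Fm])
  also have "\<dots> = (\<integral>f. (\<Prod>b\<in>Basis. F b (f b)) \<partial>Pi\<^sub>M Basis (\<lambda>b::'a. lborel))"
    by (intro Bochner_Integration.integral_cong prod.cong refl)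
      (simp add: inner_sum_left inner_Basis if_distrib sum.If_cases cong: if_cong)
  also have "\<dots> = (\<Prod>b\<in>Basis. \<integral>x. F b x \<partial>lborel)"
    by (rule product_integral_prod) (use F in auto)
  finally show ?thesis .
qed

lemma integrable_exp_quadratic_real:
  "integrable lborel (\<lambda>x::real. exp (- of_real pi * (of_real x)\<^sup>2 + 2 * of_real pi * \<i> * of_real (\<eta> * x)) :: complex)"
proof -
  have "integrable lborel (\<lambda>x::real. normal_density 0 (1 / sqrt (2 * pi)) x)"
    by (rule integrable_normal_density) simp
  then have r: "integrable lborel (\<lambda>x::real. exp (- pi * x\<^sup>2))"
    unfolding normal_density_def by (simp add: power_divide real_sqrt_divide field_simps)
  show ?thesis
  proof (rule Bochner_Integration.integrable_bound[OF r])
    show "(\<lambda>x::real. exp (- of_real pi * (of_real x)\<^sup>2 + 2 * of_real pi * \<i> * of_real (\<eta> * x)) :: complex)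
        \<in> borel_measurable lborel"
    proof -
      have "continuous_on UNIV (\<lambda>x::real. exp (- of_real pi * (of_real x)\<^sup>2 + 2 * of_real pi * \<i> * of_real (\<eta> * x)) :: complex)"
        by (intro continuous_intros)
      from borel_measurable_continuous_onI[OF this] show ?thesis by simp
    qed
    show "AE x in lborel. norm (exp (- of_real pi * (of_real x)\<^sup>2 + 2 * of_real pi * \<i> * of_real (\<eta> * x)) :: complex)
        \<le> norm (exp (- pi * x\<^sup>2))"
      by (intro AE_I2) (simp add: norm_exp_eq_Re flip: of_real_power)
  qed
qed

text \<open>The characteristic function of the standard normal distribution, in the normalisation in
  which \<open>exp (- pi x^2)\<close> is its own Fourier transform.\<close>

lemma integral_exp_quadratic_real:
  "(\<integral>x. exp (- of_real pi * (of_real x)\<^sup>2 + 2 * of_real pi * \<i> * of_real (\<eta> * x)) \<partial>lborel) =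
    exp (- of_real pi * (of_real \<eta>)\<^sup>2)"
proof -
  \<comment> \<open>Rescaling by \<open>sqrt (2 * pi)\<close> turns \<open>exp (- x^2 / 2)\<close>
    into \<open>exp (- pi x^2)\<close>, and the Jacobian cancels the normalising factor of the
    density.\<close>
  define r where "r = sqrt (2 * pi)"
  have r: "r > 0" "r * r = 2 * pi" unfolding r_def by simp_all
  have "exp (- of_real pi * (of_real \<eta>)\<^sup>2) = char std_normal_distribution (r * \<eta>)"
  proof -
    have "(r * \<eta>)\<^sup>2 = 2 * pi * \<eta>\<^sup>2" using r by (simp add: power2_eq_square algebra_simps)
    then show ?thesis unfolding char_std_normal_distribution
      by (simp flip: exp_of_real)
  qed
  also have "\<dots> = (\<integral>x. std_normal_density x *\<^sub>R iexp (r * \<eta> * x) \<partial>lborel)"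
    unfolding char_def
    by (rule integral_density) (auto intro!: borel_measurable_continuous_onI continuous_intros)
  also have "\<dots> = r *\<^sub>R (\<integral>x. std_normal_density (r * x) *\<^sub>R iexp (r * \<eta> * (r * x)) \<partial>lborel)"
    using lborel_integral_real_affine[of r "\<lambda>x. std_normal_density x *\<^sub>R iexp (r * \<eta> * x)" 0] r by simp
  also have "\<dots> = (\<integral>x. r *\<^sub>R (std_normal_density (r * x) *\<^sub>R iexp (r * \<eta> * (r * x))) \<partial>lborel)"
    by (rule integral_scaleR_right[symmetric])
  also have "\<dots> = (\<integral>x. exp (- of_real pi * (of_real x)\<^sup>2 + 2 * of_real pi * \<i> * of_real (\<eta> * x)) \<partial>lborel)"
  proof (rule Bochner_Integration.integral_cong[OF refl])
    fix x :: real
    have "(r * x)\<^sup>2 = 2 * pi * x\<^sup>2" using r by (simp add: power2_eq_square algebra_simps)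
    then have d: "std_normal_density (r * x) = exp (- pi * x\<^sup>2) / r"
      unfolding std_normal_density_def r_def[symmetric] by simp
    have e: "r * \<eta> * (r * x) = 2 * pi * (\<eta> * x)"
      using r by (simp add: algebra_simps)
    have "r *\<^sub>R (std_normal_density (r * x) *\<^sub>R iexp (r * \<eta> * (r * x))) =
        complex_of_real (exp (- pi * x\<^sup>2)) * exp (\<i> * of_real (2 * pi * (\<eta> * x)))"
      unfolding d e using r by (simp add: scaleR_conv_of_real)
    also have "\<dots> = exp (- of_real pi * (of_real x)\<^sup>2 + 2 * of_real pi * \<i> * of_real (\<eta> * x))"
      unfolding exp_of_real[symmetric] exp_add[symmetric] by (simp add: mult_ac)
    finally show "r *\<^sub>R (std_normal_density (r * x) *\<^sub>R iexp (r * \<eta> * (r * x))) =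
      exp (- of_real pi * (of_real x)\<^sup>2 + 2 * of_real pi * \<i> * of_real (\<eta> * x))" .
  qed
  finally show ?thesis ..
qed

text \<open>Up to the factor \<open>exp (pi * cdot b b)\<close> this is the standard Gaussian
  centred at the complex point \<open>b\<close>, a coherent state. Modulation and complex
  translation therefore only move \<open>b\<close> and produce scalar factors.\<close>

definition gauss_test :: "complex^'d::finite \<Rightarrow> real^'d \<Rightarrow> complex" where
  "gauss_test b t = exp (- of_real pi * of_real (t \<bullet> t) + 2 * of_real pi * cdot b (complex_vec t))"

lemma gaussian_decay_gauss_test: "gaussian_decay (gauss_test b)"
proof -
  have "gaussian_decay (\<lambda>t::real^'a. exp (- of_real pi * of_real (t \<bullet> t)))"
  proof (rule gaussian_decayI[of _ 1 0 pi])
    show "(\<lambda>t::real^'a. exp (- complex_of_real pi * of_real (t \<bullet> t))) \<in> borel_measurable borel"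
      by (intro borel_measurable_continuous_onI continuous_intros)
    show "cmod (exp (- complex_of_real pi * of_real (t \<bullet> t))) \<le> 1 * exp (0 * norm t - pi * (norm t)\<^sup>2)"
      for t :: "real^'a"
      by (simp add: norm_exp_eq_Re power2_norm_eq_inner)
  qed auto
  from gaussian_decay_mult[OF exp_growth_exp_cdot[of 0 "2 * of_real pi" b] this]
  show ?thesis unfolding gauss_test_def[abs_def] by (simp add: mult.commute flip: exp_add)
qed

lemma gauss_test_measurable: "gauss_test b \<in> borel_measurable borel"
  using gaussian_decay_gauss_test unfolding gaussian_decay_def by blast

lemma gauss_test_mult_exp:
  "exp (2 * of_real pi * cdot a (complex_vec t)) * gauss_test b t = gauss_test (b + a) t"
  unfolding gauss_test_def by (simp add: cdot_linear algebra_simps flip: exp_add)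

lemma integral_gauss_test_imaginary:
  fixes \<eta> :: "real^'d::finite"
  shows "(\<integral>t. gauss_test (\<i> *s complex_vec \<eta>) t \<partial>lborel) = exp (- of_real pi * of_real (\<eta> \<bullet> \<eta>))"
proof -
  have "gauss_test (\<i> *s complex_vec \<eta>) t =
      (\<Prod>b\<in>Basis. exp (- of_real pi * (of_real (t \<bullet> b))\<^sup>2 + 2 * of_real pi * \<i> * of_real ((\<eta> \<bullet> b) * (t \<bullet> b))))" for t
    unfolding gauss_test_def cdot_linear cdot_complex_vec
    by (simp add: euclidean_inner[of t t] euclidean_inner[of \<eta> t] exp_sum[symmetric] sum.distrib sum_subtractf
        sum_distrib_left sum_negf power2_eq_square mult_ac)
  then have "(\<integral>t. gauss_test (\<i> *s complex_vec \<eta>) t \<partial>lborel) =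
      (\<Prod>b\<in>Basis. exp (- of_real pi * (of_real (\<eta> \<bullet> b))\<^sup>2))"
    using integral_lborel_prod[OF integrable_exp_quadratic_real, of "\<lambda>b. \<eta> \<bullet> b"]
    by (simp only: integral_exp_quadratic_real)
  also have "\<dots> = exp (- of_real pi * of_real (\<eta> \<bullet> \<eta>))"
    by (simp add: euclidean_inner[of \<eta> \<eta>] exp_sum[symmetric] sum_distrib_left sum_negf power2_eq_square)
  finally show ?thesis .
qed

text \<open>A real shift of the variable removes the real part of \<open>b\<close>, and the
  remaining imaginary parameter gives the Fourier transform of a Gaussian. No contour shift is
  involved.\<close>

lemma integral_gauss_test:
  fixes b :: "complex^'d::finite"
  shows "(\<integral>t. gauss_test b t \<partial>lborel) = exp (of_real pi * cdot b b)"
proof -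
  define r i where "r = (\<chi> j. Re (b $ j))" and "i = (\<chi> j. Im (b $ j))"
  have b: "b = complex_vec r + \<i> *s complex_vec i"
    unfolding r_def i_def complex_vec_def by (simp add: vec_eq_iff complex_eq_iff)
  have bb: "cdot b b = of_real (r \<bullet> r) + 2 * \<i> * of_real (i \<bullet> r) - of_real (i \<bullet> i)"
    unfolding b cdot_linear cdot_complex_vec by (simp add: algebra_simps inner_commute)
  have "gauss_test b (t + r) = exp (of_real pi * (of_real (r \<bullet> r) + 2 * \<i> * of_real (i \<bullet> r))) *
      gauss_test (\<i> *s complex_vec i) t" for t
    unfolding gauss_test_def b cdot_linear complex_vec_add cdot_complex_vec exp_add[symmetric]
    by (rule arg_cong[of _ _ exp]) (simp add: inner_add_left inner_add_right inner_commute algebra_simps)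
  then have "(\<integral>t. gauss_test b t \<partial>lborel) = exp (of_real pi * (of_real (r \<bullet> r) + 2 * \<i> * of_real (i \<bullet> r))) *
      exp (- of_real pi * of_real (i \<bullet> i))"
    using lborel_integral_affine(1)[OF gauss_test_measurable[of b], of r] integral_gauss_test_imaginary[of i] by simp
  also have "\<dots> = exp (of_real pi * cdot b b)"
    unfolding bb exp_add[symmetric] by (simp add: algebra_simps)
  finally show ?thesis .
qed

section \<open>Gaussian test functions under modulation and complex translation\<close>

lemma modulation_gauss_test: "modulation \<xi> (gauss_test b) = gauss_test (b + \<i> *s \<xi>)"
proof
  fix t
  show "modulation \<xi> (gauss_test b) t = gauss_test (b + \<i> *s \<xi>) t"
    using gauss_test_mult_exp[of "\<i> *s \<xi>" t b] unfolding modulation_def cdot_scale_left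
    by (simp only: mult.assoc)
qed

lemma fourier_gauss_test:
  "fourier (gauss_test b) \<omega> = exp (of_real pi * cdot (b - \<i> *s complex_vec \<omega>) (b - \<i> *s complex_vec \<omega>))"
proof -
  have "exp (- 2 * of_real pi * \<i> * of_real (\<omega> \<bullet> t)) * gauss_test b t = gauss_test (b - \<i> *s complex_vec \<omega>) t" for t
  proof -
    have "b - \<i> *s complex_vec \<omega> = b + (- \<i>) *s complex_vec \<omega>" by (simp add: vec_eq_iff)
    then show ?thesis using gauss_test_mult_exp[of "(- \<i>) *s complex_vec \<omega>" t b]
      by (simp add: cdot_scale_left cdot_minus_left cdot_complex_vec mult.assoc)
  qed
  then show ?thesis unfolding fourier_def integral_gauss_test[symmetric] by simp
qed

text \<open>The Fourier definition agrees with substituting \<open>t - x\<close> into the entire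
  extension of the Gaussian, because the inverse transform is again a Gaussian integral.\<close>

lemma translation_gauss_test:
  "translation x (gauss_test b) =
    (\<lambda>t. exp (- of_real pi * cdot x x - 2 * of_real pi * cdot b x) * gauss_test (b + x) t)"
proof
  fix t
  \<comment> \<open>Collects the terms linear in the frequency: \<open>t\<close> from the inverse
    transform, \<open>- x\<close> from the multiplier and \<open>- b\<close> from the transform of
    the test function.\<close>
  define a where "a = \<i> *s (complex_vec t - x - b)"
  have "exp (2 * of_real pi * \<i> * of_real (\<omega> \<bullet> t)) *
      (exp (- 2 * of_real pi * \<i> * cdot x (complex_vec \<omega>)) * fourier (gauss_test b) \<omega>) =
      exp (of_real pi * cdot b b) * gauss_test a \<omega>" for \<omega>
    unfolding fourier_gauss_test gauss_test_def a_def exp_add[symmetric]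
    by (rule arg_cong[of _ _ exp])
      (simp add: cdot_linear cdot_complex_vec cdot_commute[of "complex_vec \<omega>"] inner_commute algebra_simps)
  then have "translation x (gauss_test b) t = exp (of_real pi * cdot b b) * exp (of_real pi * cdot a a)"
    unfolding translation_def inverse_fourier_def integral_gauss_test[symmetric] by simp
  also have "\<dots> = exp (- of_real pi * cdot x x - 2 * of_real pi * cdot b x) * gauss_test (b + x) t"
    unfolding gauss_test_def a_def exp_add[symmetric]
    by (rule arg_cong[of _ _ exp])
      (simp add: cdot_linear cdot_complex_vec cdot_commute[of "complex_vec t"] cdot_commute[of x b] algebra_simps)
  finally show "translation x (gauss_test b) t =
    exp (- of_real pi * cdot x x - 2 * of_real pi * cdot b x) * gauss_test (b + x) t" .
qed

section \<open>Gaussian test functions belong to the Gelfand--Shilov space\<close>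

lemma holomorphic_higher_deriv_UNIV:
  assumes "F holomorphic_on UNIV"
  shows "(deriv ^^ n) F holomorphic_on UNIV"
    and "((deriv ^^ n) F has_field_derivative (deriv ^^ Suc n) F z) (at z)"
proof -
  show h: "(deriv ^^ n) F holomorphic_on UNIV"
    by (rule holomorphic_higher_deriv[OF assms open_UNIV])
  show "((deriv ^^ n) F has_field_derivative (deriv ^^ Suc n) F z) (at z)"
    using holomorphic_derivI[OF h open_UNIV, of z] by simp
qed

lemma tensor_has_vector_derivative:
  fixes H :: "'d::finite \<Rightarrow> complex \<Rightarrow> complex"
  assumes "(H j has_field_derivative D) (at (of_real (t $ j)))"
  shows "((\<lambda>s. \<Prod>i\<in>UNIV. H i (of_real ((t + s *\<^sub>R axis j 1) $ i))) has_vector_derivative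
           (\<Prod>i\<in>UNIV. if i = j then D else H i (of_real (t $ i)))) (at 0)"
proof -
  define P where "P = (\<Prod>i\<in>UNIV - {j}. H i (of_real (t $ i)))"
  have "(\<Prod>i\<in>UNIV. H i (of_real ((t + s *\<^sub>R axis j 1) $ i))) = H j (of_real (t $ j + s)) * P" for s
  proof -
    have "(\<Prod>i\<in>UNIV - {j}. H i (of_real ((t + s *\<^sub>R axis j 1) $ i))) = P"
      unfolding P_def by (intro prod.cong) (auto simp: axis_def)
    then show ?thesis
      by (subst prod.remove[of _ j]) (auto simp: axis_def)
  qed
  moreover have "(\<Prod>i\<in>UNIV. if i = j then D else H i (of_real (t $ i))) = D * P"
    unfolding P_def by (subst prod.remove[of _ j]) (auto intro!: prod.cong)
  moreover have "((\<lambda>s. H j (of_real (t $ j + s))) has_vector_derivative D) (at 0)"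
  proof -
    have "((\<lambda>s. complex_of_real (t $ j + s)) has_vector_derivative 1) (at 0)"
      by (rule has_vector_derivative_eq_rhs)
        (auto intro!: derivative_eq_intros has_vector_derivative_real_field simp: has_vector_derivative_def
          bounded_linear_of_real scaleR_conv_of_real)
    from field_vector_diff_chain_at[OF this, of "H j" D] assms show ?thesis by (simp add: o_def)
  qed
  ultimately show ?thesis by (auto intro: has_vector_derivative_mult_left)
qed

text \<open>Partial derivatives of a tensor product become complex derivatives of its entire
  factors, which opens the way to Cauchy estimates. The result depends on the list only through its
  counts, so the choice made in \<open>multi_deriv\<close> is harmless.\<close>

lemma iter_partial_tensor:
  fixes F :: "'d::finite \<Rightarrow> complex \<Rightarrow> complex"
  assumes F: "\<And>i. F i holomorphic_on UNIV"
  shows "iter_partial is (\<lambda>t. \<Prod>i\<in>UNIV. F i (of_real (t $ i))) =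
    (\<lambda>t. \<Prod>i\<in>UNIV. (deriv ^^ count_list is i) (F i) (of_real (t $ i)))"
proof (induction "is")
  case (Cons j js)
  let ?H = "\<lambda>i. (deriv ^^ count_list js i) (F i)"
  show ?case
  proof
    fix t :: "real^'d"
    have "((\<lambda>s. \<Prod>i\<in>UNIV. ?H i (of_real ((t + s *\<^sub>R axis j 1) $ i))) has_vector_derivative
        (\<Prod>i\<in>UNIV. if i = j then (deriv ^^ Suc (count_list js j)) (F j) (of_real (t $ j)) else ?H i (of_real (t $ i)))) (at 0)"
      by (rule tensor_has_vector_derivative[OF holomorphic_higher_deriv_UNIV(2)[OF F]])
    then have "iter_partial (j # js) (\<lambda>t. \<Prod>i\<in>UNIV. F i (of_real (t $ i))) t =
        (\<Prod>i\<in>UNIV. if i = j then (deriv ^^ Suc (count_list js j)) (F j) (of_real (t $ j)) else ?H i (of_real (t $ i)))"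
      unfolding iter_partial.simps Cons.IH partial_deriv_def by (rule vector_derivative_at)
    also have "\<dots> = (\<Prod>i\<in>UNIV. (deriv ^^ count_list (j # js) i) (F i) (of_real (t $ i)))"
      by (intro prod.cong) auto
    finally show "iter_partial (j # js) (\<lambda>t. \<Prod>i\<in>UNIV. F i (of_real (t $ i))) t =
        (\<Prod>i\<in>UNIV. (deriv ^^ count_list (j # js) i) (F i) (of_real (t $ i)))" .
  qed
qed simp

lemma smooth_tensor:
  fixes F :: "'d::finite \<Rightarrow> complex \<Rightarrow> complex"
  assumes F: "\<And>i. F i holomorphic_on UNIV"
  shows "smooth (\<lambda>t. \<Prod>i\<in>UNIV. F i (of_real (t $ i)))"
  unfolding smooth_def iter_partial_tensor[OF F]
proof (intro allI conjI)
  fix js :: "'d list" and j t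
  have "continuous_on UNIV (\<lambda>t::real^'d. (deriv ^^ count_list js i) (F i) (of_real (t $ i)))" for i
    by (rule continuous_on_compose2[OF holomorphic_on_imp_continuous_on[OF holomorphic_higher_deriv_UNIV(1)[OF F]]])
      (auto intro!: continuous_intros)
  then show "continuous_on UNIV (\<lambda>t::real^'d. \<Prod>i\<in>UNIV. (deriv ^^ count_list js i) (F i) (of_real (t $ i)))"
    by (intro continuous_on_prod)
  show "(\<lambda>s::real. \<Prod>i\<in>UNIV. (deriv ^^ count_list js i) (F i) (of_real ((t + s *\<^sub>R axis j 1) $ i))) differentiable at 0"
    using tensor_has_vector_derivative[OF holomorphic_higher_deriv_UNIV(2)[OF F]]
    by (rule differentiableI_vector)
qed

text \<open>The shape of the bound is dictated by its use: \<open>exp (- x^2 / 2)\<close> is what is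
  needed to absorb monomials, and \<open>exp (2 * pi * r^2)\<close> becomes geometric in
  \<open>n\<close> when \<open>r = sqrt n\<close>.\<close>

lemma cmod_exp_quadratic_le:
  assumes b: "cmod b \<le> B" and z: "cmod (z - of_real x) \<le> r"
  shows "cmod (exp (- of_real pi * z\<^sup>2 + 2 * of_real pi * b * z)) \<le>
    exp (8 * pi * B\<^sup>2) * exp (- (x\<^sup>2 / 2)) * exp (2 * pi * r\<^sup>2)"
proof -
  define u v where "u = Re z - x" and "v = Im z"
  have uv: "u\<^sup>2 + v\<^sup>2 \<le> r\<^sup>2"
  proof -
    have "(cmod (z - of_real x))\<^sup>2 = u\<^sup>2 + v\<^sup>2" unfolding cmod_power2 u_def v_def by simp
    then show ?thesis using power_mono[OF z, of 2] by simp
  qed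
  have z2: "(cmod z)\<^sup>2 = (x + u)\<^sup>2 + v\<^sup>2" unfolding cmod_power2 u_def v_def by simp
  have Re2: "Re (z\<^sup>2) = (x + u)\<^sup>2 - v\<^sup>2" unfolding u_def v_def by (simp add: power2_eq_square)
  \<comment> \<open>Young's inequality with a small weight on \<open>z\<close>, so that most of the
    negative term \<open>- (x + u)^2\<close> survives.\<close>
  have "2 * (cmod b * cmod z) \<le> 8 * B\<^sup>2 + (cmod z)\<^sup>2 / 8"
  proof -
    have "cmod b * cmod z \<le> B * cmod z" using b by (intro mult_right_mono) auto
    moreover have "0 \<le> (4 * B - cmod z / 2)\<^sup>2" by simp
    then have "4 * (B * cmod z) \<le> 16 * B\<^sup>2 + (cmod z)\<^sup>2 / 4" by (simp add: power2_eq_square algebra_simps)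
    ultimately show ?thesis by linarith
  qed
  moreover have "Re (b * z) \<le> cmod b * cmod z" using complex_Re_le_cmod[of "b * z"] by (simp add: norm_mult)
  ultimately have "- Re (z\<^sup>2) + 2 * Re (b * z) \<le> - (x + u)\<^sup>2 + v\<^sup>2 + 8 * B\<^sup>2 + ((x + u)\<^sup>2 + v\<^sup>2) / 8"
    unfolding Re2 z2 by linarith
  also have "\<dots> \<le> 8 * B\<^sup>2 - x\<^sup>2 / 4 + 2 * r\<^sup>2"
  proof -
    have "0 \<le> (x + 2 * u)\<^sup>2" by simp
    then have "x\<^sup>2 / 2 - u\<^sup>2 \<le> (x + u)\<^sup>2" by (simp add: power2_sum power2_eq_square algebra_simps)
    then show ?thesis using uv zero_le_power2[of v] zero_le_power2[of u] zero_le_power2[of x]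
      unfolding add_divide_distrib by linarith
  qed
  finally have "pi * (- Re (z\<^sup>2) + 2 * Re (b * z)) \<le> pi * (8 * B\<^sup>2 - x\<^sup>2 / 4 + 2 * r\<^sup>2)"
    by (intro mult_left_mono) auto
  \<comment> \<open>Uses \<open>2 \<le> pi\<close>, which turns the surviving
    \<open>- pi * x^2 / 4\<close> into \<open>- x^2 / 2\<close>.\<close>
  also have "\<dots> \<le> 8 * pi * B\<^sup>2 + (- (x\<^sup>2 / 2)) + 2 * pi * r\<^sup>2"
    using mult_right_mono[of 2 pi "x\<^sup>2 / 4"] pi_ge_two by (simp add: algebra_simps)
  finally have "Re (- of_real pi * z\<^sup>2 + 2 * of_real pi * b * z) \<le> 8 * pi * B\<^sup>2 + (- (x\<^sup>2 / 2)) + 2 * pi * r\<^sup>2"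
    by (simp add: algebra_simps)
  then show ?thesis unfolding norm_exp_eq_Re exp_add[symmetric] by simp
qed

text \<open>Cauchy's estimate on the circle of radius \<open>sqrt n\<close> gives the growth \<open>sqrt (fact n)\<close>.\<close>

lemma higher_deriv_exp_quadratic_le:
  assumes b: "cmod b \<le> B"
  shows "cmod ((deriv ^^ n) (\<lambda>z. exp (- of_real pi * z\<^sup>2 + 2 * of_real pi * b * z)) (of_real x)) \<le>
    exp (8 * pi * B\<^sup>2) * exp (- (x\<^sup>2 / 2)) * exp (2 * pi) ^ n * sqrt (fact n)"
proof (cases "n = 0")
  \<comment> \<open>The circle of radius \<open>sqrt n\<close> degenerates here, and the pointwise
    bound with radius 0 takes its place.\<close>
  case True
  then show ?thesis using cmod_exp_quadratic_le[OF b, of "of_real x" x 0] by simp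
next
  case False
  let ?F = "\<lambda>z. exp (- of_real pi * z\<^sup>2 + 2 * of_real pi * b * z) :: complex"
  define M where "M = exp (8 * pi * B\<^sup>2) * exp (- (x\<^sup>2 / 2)) * exp (2 * pi * (sqrt n)\<^sup>2)"
  have "cmod ((deriv ^^ n) ?F (of_real x)) \<le> fact n * M / sqrt n ^ n"
  proof (rule Cauchy_inequality)
    show "?F holomorphic_on ball (of_real x) (sqrt n)" by (intro holomorphic_intros)
    show "continuous_on (cball (of_real x) (sqrt n)) ?F" by (intro continuous_intros)
    show "0 < sqrt n" using False by simp
    show "cmod (?F z) \<le> M" if "cmod (of_real x - z) = sqrt n" for z
      unfolding M_def by (rule cmod_exp_quadratic_le[OF b]) (use that in \<open>simp add: norm_minus_commute\<close>)
  qed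
  also have "\<dots> = M * (fact n / sqrt n ^ n)" by simp
  also have "\<dots> \<le> M * sqrt (fact n)"
  proof (rule mult_left_mono)
    \<comment> \<open>From \<open>fact n \<le> n ^ n\<close>: dividing by \<open>sqrt n ^ n\<close>
      takes off at least a factor \<open>sqrt (fact n)\<close>, leaving the growth allowed by the
      Gelfand-Shilov norm.\<close>
    have "fact n * fact n \<le> fact n * real n ^ n"
      using fact_le_power by (intro mult_left_mono) auto
    then have "(fact n :: real) \<le> sqrt (fact n * real n ^ n)"
      by (intro real_le_rsqrt) (simp add: power2_eq_square)
    then have "(fact n :: real) \<le> sqrt (fact n) * sqrt n ^ n"
      by (simp add: real_sqrt_mult real_sqrt_power)
    then show "fact n / sqrt n ^ n \<le> sqrt (fact n)" using False by (simp add: divide_le_eq)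
  qed (simp add: M_def)
  also have "M = exp (8 * pi * B\<^sup>2) * exp (- (x\<^sup>2 / 2)) * exp (2 * pi) ^ n"
    unfolding M_def by (simp add: exp_of_nat_mult[symmetric] mult.commute)
  finally show ?thesis .
qed

lemma sqrt_prod: "sqrt (\<Prod>i\<in>I. f i) = (\<Prod>i\<in>I. sqrt (f i))"
  by (induction I rule: infinite_finite_induct) (simp_all add: real_sqrt_mult)

text \<open>After squaring, this is the comparison of one term of the exponential series at
  \<open>x^2\<close> with its sum.\<close>

lemma power_times_exp_le: "\<bar>x\<bar> ^ m * exp (- (x\<^sup>2 / 2)) \<le> sqrt (fact m)" for x :: real
proof -
  have "(x\<^sup>2) ^ m / fact m \<le> exp (x\<^sup>2)"
  proof -
    have s: "(\<lambda>k. (x\<^sup>2) ^ k / fact k) sums exp (x\<^sup>2)"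
      using exp_converges[of "x\<^sup>2"] by (simp add: field_simps)
    have "sum (\<lambda>k. (x\<^sup>2) ^ k / fact k) {m} \<le> suminf (\<lambda>k. (x\<^sup>2) ^ k / fact k)"
      by (rule sum_le_suminf[OF sums_summable[OF s]]) auto
    then show ?thesis using sums_unique[OF s] by simp
  qed
  then have "(x\<^sup>2) ^ m * exp (- (x\<^sup>2)) \<le> fact m"
    by (simp add: exp_minus field_simps)
  then have "(\<bar>x\<bar> ^ m * exp (- (x\<^sup>2 / 2)))\<^sup>2 \<le> fact m"
    by (simp add: power_mult_distrib power_mult[symmetric] mult.commute exp_of_nat_mult[symmetric] power_even_abs)
  then show ?thesis by (rule real_le_rsqrt)
qed

lemma gauss_test_tensor:
  "gauss_test b = (\<lambda>t. \<Prod>i\<in>UNIV. exp (- of_real pi * (of_real (t $ i))\<^sup>2 + 2 * of_real pi * (b $ i) * of_real (t $ i)))"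
  unfolding gauss_test_def[abs_def] cdot_def complex_vec_def inner_vec_def
  by (rule ext) (simp add: exp_sum[symmetric] sum.distrib sum_subtractf sum_negf sum_distrib_left power2_eq_square mult_ac)

text \<open>The function and the weights both factor over the coordinates. In each coordinate the
  Cauchy estimate accounts for \<open>sqrt (fact (\<gamma> i))\<close>, and the Gaussian factor it
  retains absorbs the monomial at the cost of \<open>sqrt (fact (\<beta> i))\<close>.\<close>

lemma gauss_test_in_GS: "gauss_test (b :: complex^'d::finite) \<in> GS"
proof -
  define F :: "'d \<Rightarrow> complex \<Rightarrow> complex"
    where "F i z = exp (- of_real pi * z\<^sup>2 + 2 * of_real pi * (b $ i) * z)" for i z
  have F: "F i holomorphic_on UNIV" for i unfolding F_def[abs_def] by (intro holomorphic_intros)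
  have gt: "gauss_test b = (\<lambda>t. \<Prod>i\<in>UNIV. F i (of_real (t $ i)))"
    unfolding gauss_test_tensor F_def ..
  \<comment> \<open>The geometric rate in the bound on the derivatives.\<close>
  define h where "h = exp (2 * pi)"
  define K where "K = exp (8 * pi * (norm b)\<^sup>2)"
  have h: "h \<ge> 1" unfolding h_def by simp
  have "GS_quotient h (gauss_test b) p \<le> K ^ CARD('d)" for p
  proof (cases p)
    case (fields t \<beta> \<gamma>)
    define W where "W = h ^ (\<Sum>i\<in>UNIV. \<beta> i + \<gamma> i) *
      sqrt ((\<Prod>i\<in>UNIV. fact (\<beta> i)) * (\<Prod>i\<in>UNIV. fact (\<gamma> i)))"
    have W: "W = (\<Prod>i\<in>UNIV. h ^ (\<beta> i + \<gamma> i) * (sqrt (fact (\<beta> i)) * sqrt (fact (\<gamma> i))))"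
      unfolding W_def prod.distrib power_sum real_sqrt_mult
      by (simp add: sqrt_prod prod.distrib)
    have Wpos: "W > 0" unfolding W using h by (intro prod_pos) auto
    obtain js where js: "(SOME js. \<forall>i. count_list js i = \<gamma> i) = js" "\<forall>i. count_list js i = \<gamma> i"
      using someI_ex[OF ex_count_list[of \<gamma>]] by blast
    have "multi_deriv \<gamma> (gauss_test b) t = (\<Prod>i\<in>UNIV. (deriv ^^ \<gamma> i) (F i) (of_real (t $ i)))"
      unfolding multi_deriv_def js(1) gt iter_partial_tensor[OF F] by (simp add: js(2))
    then have "cmod (of_real (\<Prod>i\<in>UNIV. (t $ i) ^ \<beta> i) * multi_deriv \<gamma> (gauss_test b) t) =
        (\<Prod>i\<in>UNIV. \<bar>t $ i\<bar> ^ \<beta> i * cmod ((deriv ^^ \<gamma> i) (F i) (of_real (t $ i))))"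
      by (simp add: norm_mult prod_norm[symmetric] norm_power prod.distrib abs_prod power_abs)
    also have "\<dots> \<le> (\<Prod>i\<in>UNIV. K * (h ^ (\<beta> i + \<gamma> i) * (sqrt (fact (\<beta> i)) * sqrt (fact (\<gamma> i)))))"
    proof (rule prod_mono, intro conjI)
      fix i
      define x where "x = t $ i"
      have "cmod (b $ i) \<le> norm b" by (rule Finite_Cartesian_Product.norm_nth_le)
      then have "cmod ((deriv ^^ \<gamma> i) (F i) (of_real x)) \<le>
          K * exp (- (x\<^sup>2 / 2)) * h ^ \<gamma> i * sqrt (fact (\<gamma> i))"
        unfolding F_def[abs_def] K_def h_def by (rule higher_deriv_exp_quadratic_le)
      then have "\<bar>x\<bar> ^ \<beta> i * cmod ((deriv ^^ \<gamma> i) (F i) (of_real x)) \<le>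
          \<bar>x\<bar> ^ \<beta> i * (K * exp (- (x\<^sup>2 / 2)) * h ^ \<gamma> i * sqrt (fact (\<gamma> i)))"
        by (intro mult_left_mono) auto
      also have "\<dots> = (\<bar>x\<bar> ^ \<beta> i * exp (- (x\<^sup>2 / 2))) * (K * h ^ \<gamma> i * sqrt (fact (\<gamma> i)))" by simp
      also have "\<dots> \<le> sqrt (fact (\<beta> i)) * (K * h ^ \<gamma> i * sqrt (fact (\<gamma> i)))"
        using h by (intro mult_right_mono power_times_exp_le) (auto simp: K_def)
      \<comment> \<open>The monomial costs no power of \<open>h\<close>; since
        \<open>1 \<le> h\<close>, the exponent may be raised to the one in the norm.\<close>
      also have "\<dots> \<le> sqrt (fact (\<beta> i)) * (K * h ^ (\<beta> i + \<gamma> i) * sqrt (fact (\<gamma> i)))"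
        using h by (intro mult_left_mono mult_right_mono power_increasing) (auto simp: K_def)
      finally show "\<bar>t $ i\<bar> ^ \<beta> i * cmod ((deriv ^^ \<gamma> i) (F i) (of_real (t $ i))) \<le>
          K * (h ^ (\<beta> i + \<gamma> i) * (sqrt (fact (\<beta> i)) * sqrt (fact (\<gamma> i))))"
        unfolding x_def by (simp add: mult_ac)
    qed auto
    also have "\<dots> = K ^ CARD('d) * W" unfolding W prod.distrib by simp
    finally show ?thesis using Wpos unfolding fields GS_quotient_def prod.case W_def[symmetric]
      by (simp add: divide_le_eq)
  qed
  then have "gauss_test b \<in> GS_step h"
    unfolding GS_step_def bdd_above_def using smooth_tensor[OF F] gt by auto
  then show ?thesis using h unfolding GS_def by force
qed

section \<open>Symplectic block matrices\<close>

lemma sum_UNIV_Plus: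
  "(\<Sum>k\<in>(UNIV :: ('a::finite + 'b::finite) set). f k) = (\<Sum>k\<in>UNIV. f (Inl k)) + (\<Sum>k\<in>UNIV. f (Inr k))"
  by (simp add: UNIV_Plus_UNIV[symmetric] sum.Plus del: UNIV_Plus_UNIV)

lemma matrix_mult_minus:
  fixes X :: "'a::ring_1^'n::finite^'m" and Y :: "'a^'p^'n"
  shows "(- X) ** Y = - (X ** Y)" "X ** (- Y) = - (X ** Y)"
  by (simp_all add: matrix_matrix_mult_def vec_eq_iff sum_negf)

lemma matrix_add_rdistrib: "(X + Y) ** W = X ** W + Y ** W"
  by (simp add: matrix_matrix_mult_def vec_eq_iff sum.distrib distrib_right)

lemma matrix_inv_right: "invertible X \<Longrightarrow> X ** matrix_inv X = mat 1"
  unfolding invertible_def matrix_inv_def by (rule someI2_ex) auto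

lemma transpose_add: "transpose (X + Y) = transpose X + transpose Y"
  by (simp add: transpose_def vec_eq_iff)

lemma transpose_block_matrix:
  "transpose (block_matrix A B C D) = block_matrix (transpose A) (transpose C) (transpose B) (transpose D)"
  by (simp add: transpose_def block_matrix_def vec_eq_iff split: sum.split)

lemma block_matrix_mult:
  fixes A :: "'a::semiring_1^'d::finite^'d"
  shows "block_matrix A B C D ** block_matrix A' B' C' D' =
    block_matrix (A ** A' + B ** C') (A ** B' + B ** D') (C ** A' + D ** C') (C ** B' + D ** D')"
  by (simp add: matrix_matrix_mult_def block_matrix_def vec_eq_iff sum_UNIV_Plus split: sum.split)

lemma block_matrix_eq_iff:
  "block_matrix A B C D = block_matrix A' B' C' D' \<longleftrightarrow> A = A' \<and> B = B' \<and> C = C' \<and> D = D'"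
proof
  assume e: "block_matrix A B C D = block_matrix A' B' C' D'"
  have "block_matrix A B C D $ i $ j = block_matrix A' B' C' D' $ i $ j" for i j using e by simp
  from this[of "Inl _" "Inl _"] this[of "Inl _" "Inr _"] this[of "Inr _" "Inl _"] this[of "Inr _" "Inr _"]
  show "A = A' \<and> B = B' \<and> C = C' \<and> D = D'"
    unfolding block_matrix_def vec_eq_iff by simp
qed simp

lemma block_matrix_mult_vec:
  fixes A :: "'a::semiring_1^'d::finite^'d"
  shows "position (block_matrix A B C D *v z) = A *v position z + B *v momentum z"
    and "momentum (block_matrix A B C D *v z) = C *v position z + D *v momentum z"
  by (simp_all add: matrix_vector_mult_def block_matrix_def position_def momentum_def vec_eq_iff sum_UNIV_Plus)

lemma Sp_block_matrixD:
  assumes "block_matrix A B C D \<in> Sp"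
  shows "transpose A ** C = transpose C ** A" "transpose B ** D = transpose D ** B"
    and "transpose A ** D = mat 1 + transpose C ** B" "transpose D ** A = mat 1 + transpose B ** C"
  using assms unfolding Sp_def symplectic_J_def mem_Collect_eq transpose_block_matrix block_matrix_mult
    block_matrix_eq_iff matrix_mult_minus matrix_mul_rid
  by (auto simp: algebra_simps matrix_mult_minus)

text \<open>The columns of \<open>L\<close> over \<open>N\<close> span the image under
  \<open>S\<close> of the graph of the symmetric matrix \<open>Z\<close>, a Lagrangian subspace;
  this is the first identity. The second is the upper block of \<open>S^-1\<close> applied to that
  frame, with \<open>(D^T, - B^T)\<close> the upper block row of \<open>S^-1\<close>; it makes the
  frame injective.\<close>

lemma Lagrangian_frame:
  assumes S: "block_matrix A B C D \<in> Sp" and Z: "transpose Z = Z"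
  defines "L \<equiv> A + B ** Z" and "N \<equiv> C + D ** Z"
  shows "transpose L ** N = transpose N ** L"
    and "transpose D ** L = mat 1 + transpose B ** N"
proof -
  note r = Sp_block_matrixD[OF S]
  have r': "transpose A ** (D ** Z) = Z + transpose C ** (B ** Z)"
    "Z ** (transpose D ** A) = Z + Z ** (transpose B ** C)"
    using arg_cong[OF r(3), of "\<lambda>X. X ** Z"] arg_cong[OF r(4), of "\<lambda>X. Z ** X"]
    by (simp_all add: matrix_add_ldistrib matrix_add_rdistrib matrix_mul_assoc)
  have r'': "transpose B ** (D ** Z) = transpose D ** (B ** Z)"
    using arg_cong[OF r(2), of "\<lambda>X. X ** Z"] by (simp add: matrix_mul_assoc)
  show "transpose L ** N = transpose N ** L"
    unfolding L_def N_def transpose_add matrix_transpose_mul Z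
    by (simp add: matrix_add_ldistrib matrix_add_rdistrib matrix_mul_assoc[symmetric] r(1) r' r'')
  show "transpose D ** L = mat 1 + transpose B ** N"
    unfolding L_def N_def
    by (simp add: matrix_add_ldistrib matrix_mul_assoc[symmetric] r(4) r'')
qed

text \<open>Conjugation by the inverse of \<open>L\<close> turns the Lagrangian identity into
  symmetry.\<close>

lemma symmetric_quotient:
  fixes L N :: "complex^'d::finite^'d"
  assumes L: "invertible L" and LN: "transpose L ** N = transpose N ** L"
  shows "transpose (N ** matrix_inv L) = N ** matrix_inv L"
proof -
  have i: "L ** matrix_inv L = mat 1" using L by (rule matrix_inv_right)
  have i': "transpose (matrix_inv L) ** transpose L = mat 1"
    using arg_cong[OF i, of transpose] by (simp add: matrix_transpose_mul transpose_mat)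
  have "N ** matrix_inv L = (transpose (matrix_inv L) ** transpose L) ** N ** matrix_inv L"
    unfolding i' by simp
  also have "\<dots> = transpose (matrix_inv L) ** (transpose L ** N) ** matrix_inv L"
    by (simp add: matrix_mul_assoc)
  also have "\<dots> = transpose (matrix_inv L) ** transpose N ** (L ** matrix_inv L)"
    unfolding LN by (simp add: matrix_mul_assoc)
  also have "\<dots> = transpose (N ** matrix_inv L)"
    unfolding i by (simp add: matrix_transpose_mul)
  finally show ?thesis ..
qed

section \<open>Functions determined by their pairings with Gaussian test functions\<close>

lemma gauss_test_nonzero: "gauss_test b t \<noteq> 0"
  unfolding gauss_test_def by simp

text \<open>With imaginary parameter the pairing is a Fourier integral of \<open>u\<close> times the
  standard Gaussian. Integrability is asked of this product alone, so \<open>u\<close> may be a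
  square-integrable function multiplied by a linear form or an exponential.\<close>

lemma AE_zero_of_gauss_test:
  fixes u :: "real^'d::finite \<Rightarrow> complex"
  assumes int: "integrable lborel (\<lambda>t. u t * gauss_test 0 t)"
    and zero: "\<And>\<xi>. (\<integral>t. u t * gauss_test (\<i> *s complex_vec \<xi>) t \<partial>lborel) = 0"
  shows "AE t in lborel. u t = 0"
proof -
  have "AE t in lborel. u t * gauss_test 0 t = 0"
  proof (rule fourier_injective_L1[OF int])
    fix \<xi> :: "real^'d"
    have e: "exp (2 * of_real pi * \<i> * of_real (\<xi> \<bullet> t)) * (u t * gauss_test 0 t) =
        u t * gauss_test (\<i> *s complex_vec \<xi>) t" for t
      using gauss_test_mult_exp[of "\<i> *s complex_vec \<xi>" t 0]
      by (simp add: cdot_scale_left cdot_complex_vec mult.assoc mult.left_commute[of _ "u t"])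
    show "(\<integral>t. exp (2 * of_real pi * \<i> * of_real (\<xi> \<bullet> t)) * (u t * gauss_test 0 t) \<partial>lborel) = 0"
      unfolding e by (rule zero)
  qed
  then show ?thesis by eventually_elim (simp add: gauss_test_nonzero)
qed

lemma AE_lborel_shift:
  fixes c :: "'a::euclidean_space"
  assumes "AE t in lborel. P t" "Measurable.pred borel P"
  shows "AE t in lborel. P (c + t)"
proof -
  have "AE t in distr lborel borel ((+) c). P t" using assms(1) by (simp only: lborel_distr_plus)
  then show ?thesis using assms(2) by (subst (asm) AE_distr_iff) auto
qed

text \<open>The exceptional null set depends on \<open>x\<close>. Exchanging the two
  almost-everywhere quantifiers yields a single base point \<open>t0\<close> that works for almost
  every \<open>x\<close>, and translating by \<open>- t0\<close> finishes the argument.\<close>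

lemma translation_invariant_AE_const:
  fixes k :: "'a::euclidean_space \<Rightarrow> complex"
  assumes k: "k \<in> borel_measurable borel" and inv: "\<And>x. AE t in lborel. k (t + x) = k t"
  shows "\<exists>c. AE t in lborel. k t = c"
proof -
  have "{z \<in> space (lborel \<Otimes>\<^sub>M lborel). k (fst z + snd z) = k (fst z)} \<in> sets (lborel \<Otimes>\<^sub>M lborel)"
    using k by measurable
  then have "AE t in lborel. AE x in lborel. k (t + x) = k t"
    using inv by (subst lborel_pair.AE_commute) (auto simp: split_beta)
  then obtain t0 where t0: "AE x in lborel. k (t0 + x) = k t0"
    using eventually_happens'[of "ae_filter (lborel :: 'a measure)"] by (auto simp: ae_filter_eq_bot_iff)
  have "AE x in lborel. k (t0 + (- t0 + x)) = k t0"
    by (rule AE_lborel_shift[OF t0]) (use k in measurable)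
  then show ?thesis by auto
qed

section \<open>The complexified intertwining relation on Gaussian test functions\<close>

text \<open>The whole complex action falls on the test function as an exponential multiplier, so the
  functional remains an integral against \<open>g\<close>. In \<open>z\<close>, \<alpha> is
  homogeneous of degree one and \<beta> of degree two, as the difference quotients require.\<close>

lemma rho_dual_gauss_test:
  fixes g :: "real^'d::finite \<Rightarrow> complex" and b :: "complex^'d"
  defines "\<beta> z \<equiv> \<i> * of_real pi * cdot (position z) (momentum z) - of_real pi * cdot (position z) (position z)"
  defines "\<alpha> z t \<equiv> 2 * of_real pi * cdot b (position z) +
      2 * of_real pi * cdot (\<i> *s momentum z - position z) (complex_vec t)"
  shows "rho_dual z 0 (L2_functional g) (gauss_test b) = (\<integral>t. g t * (exp (\<alpha> z t + \<beta> z) * gauss_test b t) \<partial>lborel)"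
proof -
  define p q where "p = position z" and "q = momentum z"
  have "rho_dual z 0 (L2_functional g) (gauss_test b) =
      (\<integral>t. exp (- \<i> * of_real pi * cdot p q) * (g t * (exp (- of_real pi * cdot (- p) (- p) - 2 * of_real pi * cdot (b + \<i> *s q) (- p)) *
        gauss_test ((b + \<i> *s q) + - p) t)) \<partial>lborel)"
    unfolding rho_dual_def modulation_dual_def translation_dual_def modulation_gauss_test translation_gauss_test
      L2_functional_def p_def[symmetric] q_def[symmetric] by simp
  also have "\<dots> = (\<integral>t. g t * (exp (\<alpha> z t + \<beta> z) * gauss_test b t) \<partial>lborel)"
  proof (rule Bochner_Integration.integral_cong[OF refl])
    fix t
    have e1: "gauss_test ((b + \<i> *s q) + - p) t = exp (2 * of_real pi * cdot (\<i> *s q - p) (complex_vec t)) * gauss_test b t"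
      unfolding gauss_test_mult_exp by (simp add: algebra_simps)
    have e2: "exp (- \<i> * of_real pi * cdot p q) * (exp (- of_real pi * cdot (- p) (- p) - 2 * of_real pi * cdot (b + \<i> *s q) (- p)) *
        exp (2 * of_real pi * cdot (\<i> *s q - p) (complex_vec t))) = exp (\<alpha> z t + \<beta> z)"
      unfolding \<alpha>_def \<beta>_def p_def[symmetric] q_def[symmetric] exp_add[symmetric]
      by (rule arg_cong[of _ _ exp]) (simp add: cdot_linear cdot_commute[of q p] algebra_simps)
    show "exp (- \<i> * of_real pi * cdot p q) * (g t * (exp (- of_real pi * cdot (- p) (- p) - 2 * of_real pi * cdot (b + \<i> *s q) (- p)) *
        gauss_test ((b + \<i> *s q) + - p) t)) = g t * (exp (\<alpha> z t + \<beta> z) * gauss_test b t)"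
      unfolding e1 e2[symmetric] by (simp only: mult_ac)
  qed
  finally show ?thesis .
qed

text \<open>Symmetry of \<open>Z\<close> lets the translation of the Gaussian be absorbed into a
  multiplier, whose exponent again has a part linear and a part quadratic in \<open>z\<close>. The
  linear part vanishes formally when the momentum is \<open>Z\<close> times the position.\<close>

lemma rho_L2_gaussian:
  fixes z :: "real^('d::finite + 'd)" and Z :: "complex^'d^'d"
  assumes Z: "transpose Z = Z"
  defines "x \<equiv> complex_vec (position z)" and "\<xi> \<equiv> complex_vec (momentum z)"
  shows "rho_L2 z 0 (gaussian Z) t =
    exp (2 * of_real pi * \<i> * cdot (\<xi> - Z *v x) (complex_vec t) +
      (- \<i> * of_real pi * cdot x \<xi> + \<i> * of_real pi * cdot (Z *v x) x)) * gaussian Z t"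
  unfolding rho_L2_def gaussian_def x_def \<xi>_def complex_vec_diff matrix_vector_mult_diff_distrib cdot_linear
    cdot_complex_vec cdot_symmetric_matrix[OF Z, of "complex_vec t" "complex_vec (position z)"] exp_add[symmetric]
    mult_exp_exp
  by (rule arg_cong[of _ _ exp]) (simp add: algebra_simps)

lemma position_complex_vec: "position (complex_vec z) = complex_vec (position z)"
  and momentum_complex_vec: "momentum (complex_vec z) = complex_vec (momentum z)"
  by (simp_all add: position_def momentum_def complex_vec_def vec_eq_iff)

lemma position_scale: "position (c *s z) = c *s position z"
  and momentum_scale: "momentum (c *s z) = c *s momentum z"
  by (simp_all add: position_def momentum_def vec_eq_iff)

lemma position_scaleR: "position (c *\<^sub>R z) = c *\<^sub>R position z"
  and momentum_scaleR: "momentum (c *\<^sub>R z) = c *\<^sub>R momentum z"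
  by (simp_all add: position_def momentum_def vec_eq_iff)

lemma intertwiner_gauss_test:
  assumes "intertwiner S T" "f \<in> L2"
  shows "(\<integral>t. T (rho_L2 z \<tau> f) t * gauss_test b t \<partial>lborel) =
    rho_dual (S *v complex_vec z) \<tau> (L2_functional (T f)) (gauss_test b)"
  using assms gauss_test_in_GS[of b] unfolding intertwiner_def GS_dual_eq_def L2_functional_def by blast

text \<open>The relation is differentiated at \<open>s = 0\<close> along \<open>s z\<close>. On the
  left the derivative is taken inside \<open>T\<close>, which is continuous in norm; on the right it
  falls on the test function.\<close>

lemma infinitesimal_intertwining:
  fixes z :: "real^('d::finite + 'd)" and Z :: "complex^'d^'d"
  assumes T: "bounded_L2_operator T" and ST: "intertwiner S T" and Z: "Z \<in> siegel_upper_half_space"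
  defines "p \<equiv> position (S *v complex_vec z)" and "q \<equiv> momentum (S *v complex_vec z)"
    and "a \<equiv> complex_vec (momentum z) - Z *v complex_vec (position z)"
  shows "(\<integral>t. T (\<lambda>t. (0 + 2 * of_real pi * \<i> * cdot a (complex_vec t)) * gaussian Z t) t * gauss_test b t \<partial>lborel) =
    (\<integral>t. T (gaussian Z) t * ((2 * of_real pi * cdot b p + 2 * of_real pi * cdot (\<i> *s q - p) (complex_vec t)) * gauss_test b t) \<partial>lborel)"
proof -
  define g where "g = T (gaussian Z)"
  define s where "s n = 1 / real (Suc n)" for n
  have s: "s n \<noteq> 0" for n unfolding s_def by simp
  have s0: "s \<longlonglongrightarrow> 0" unfolding s_def by (rule LIMSEQ_Suc[OF lim_1_over_n])
  have \<Phi>: "gaussian_decay (gaussian Z)" by (rule gaussian_decay_gaussian[OF Z])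
  have \<Phi>L2: "gaussian Z \<in> L2" by (rule gaussian_decay_L2[OF \<Phi>])
  have gL2: "g \<in> L2" unfolding g_def by (rule bounded_L2_operatorD(1)[OF T \<Phi>L2])
  have \<phi>L2: "gauss_test b \<in> L2" by (rule gaussian_decay_L2[OF gaussian_decay_gauss_test])
  define \<beta> where "\<beta> = - \<i> * of_real pi * cdot (complex_vec (position z)) (complex_vec (momentum z)) +
    \<i> * of_real pi * cdot (Z *v complex_vec (position z)) (complex_vec (position z))"
  \<comment> \<open>The summand 0 keeps the shape \<open>c + k * cdot a _\<close> of the general
    difference quotient, so that its instances fold to \<alpha>.\<close>
  define \<alpha> where "\<alpha> t = 0 + 2 * of_real pi * \<i> * cdot a (complex_vec t)" for t
  define \<beta>' where "\<beta>' = \<i> * of_real pi * cdot p q - of_real pi * cdot p p"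
  define \<alpha>' where "\<alpha>' t = 2 * of_real pi * cdot b p + 2 * of_real pi * cdot (\<i> *s q - p) (complex_vec t)" for t
  define e where "e n t = exp (of_real (s n) * \<alpha> t + (of_real (s n))\<^sup>2 * \<beta>)" for n t
  define e' where "e' n t = exp (of_real (s n) * \<alpha>' t + (of_real (s n))\<^sup>2 * \<beta>')" for n t
  note D1 = L2_difference_quotient(1)[OF s s0 \<Phi>, where c=0 and k="2 * of_real pi * \<i>" and a=a and \<beta>=\<beta>,
      folded \<alpha>_def, folded e_def]
  note D2 = L2_difference_quotient(2)[OF s s0 \<Phi>, where c=0 and k="2 * of_real pi * \<i>" and a=a, folded \<alpha>_def]
  note D3 = L2_difference_quotient(3)[OF s s0 \<Phi>, where c=0 and k="2 * of_real pi * \<i>" and a=a and \<beta>=\<beta>,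
      folded \<alpha>_def, folded e_def]
  note D1' = L2_difference_quotient(1)[OF s s0 gaussian_decay_gauss_test[of b], where c="2 * of_real pi * cdot b p"
      and k="2 * of_real pi" and a="\<i> *s q - p" and \<beta>=\<beta>', folded \<alpha>'_def, folded e'_def]
  note D2' = L2_difference_quotient(2)[OF s s0 gaussian_decay_gauss_test[of b], where c="2 * of_real pi * cdot b p"
      and k="2 * of_real pi" and a="\<i> *s q - p", folded \<alpha>'_def]
  note D3' = L2_difference_quotient(3)[OF s s0 gaussian_decay_gauss_test[of b], where c="2 * of_real pi * cdot b p"
      and k="2 * of_real pi" and a="\<i> *s q - p" and \<beta>=\<beta>', folded \<alpha>'_def, folded e'_def]
  have eL2: "(\<lambda>t. e n t * gaussian Z t) \<in> L2" for n
  proof -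
    have "(\<lambda>t. of_real (s n) * ((e n t - 1) / of_real (s n) * gaussian Z t) + 1 * gaussian Z t) \<in> L2"
      by (intro L2_lincomb gaussian_decay_L2 D1 \<Phi>)
    then show ?thesis using s[of n] by (simp add: left_diff_distrib)
  qed
  have rho: "rho_L2 (s n *\<^sub>R z) 0 (gaussian Z) = (\<lambda>t. e n t * gaussian Z t)" for n
  proof
    fix t
    have Z': "transpose Z = Z" using Z unfolding siegel_upper_half_space_def by blast
    show "rho_L2 (s n *\<^sub>R z) 0 (gaussian Z) t = e n t * gaussian Z t"
      unfolding rho_L2_gaussian[OF Z'] e_def \<alpha>_def \<beta>_def a_def position_scaleR momentum_scaleR complex_vec_scaleR
        vector_scalar_commute cdot_linear
      by (simp add: algebra_simps power2_eq_square)
  qed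
  have pq: "position (S *v complex_vec (s n *\<^sub>R z)) = of_real (s n) *s p"
    "momentum (S *v complex_vec (s n *\<^sub>R z)) = of_real (s n) *s q" for n
    unfolding p_def q_def complex_vec_scaleR vector_scalar_commute position_scale momentum_scale by simp_all
  have eq: "(\<integral>t. T (\<lambda>t. e n t * gaussian Z t) t * gauss_test b t \<partial>lborel) =
      (\<integral>t. g t * (e' n t * gauss_test b t) \<partial>lborel)" for n
  proof -
    have "2 * of_real pi * cdot b (of_real (s n) *s p) +
        2 * of_real pi * cdot (\<i> *s (of_real (s n) *s q) - of_real (s n) *s p) (complex_vec t) +
        (\<i> * of_real pi * cdot (of_real (s n) *s p) (of_real (s n) *s q) -
         of_real pi * cdot (of_real (s n) *s p) (of_real (s n) *s p)) =
        of_real (s n) * \<alpha>' t + (of_real (s n))\<^sup>2 * \<beta>'" for t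
      unfolding \<alpha>'_def \<beta>'_def cdot_linear by (simp add: algebra_simps power2_eq_square)
    then show ?thesis
      using intertwiner_gauss_test[OF ST \<Phi>L2, of "s n *\<^sub>R z" 0 b] rho_dual_gauss_test[of "S *v complex_vec (s n *\<^sub>R z)" g b]
      unfolding rho pq e'_def g_def[symmetric] by simp
  qed
  have lhs: "(\<lambda>n. \<integral>t. T (\<lambda>t. (e n t - 1) / of_real (s n) * gaussian Z t) t * gauss_test b t \<partial>lborel) \<longlonglongrightarrow>
      (\<integral>t. T (\<lambda>t. \<alpha> t * gaussian Z t) t * gauss_test b t \<partial>lborel)"
    by (intro L2_tendsto_integral bounded_L2_operator_tendsto[OF T] bounded_L2_operatorD(1)[OF T] \<phi>L2
        gaussian_decay_L2 D1 D2 D3)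
  have rhs: "(\<lambda>n. \<integral>t. ((e' n t - 1) / of_real (s n) * gauss_test b t) * g t \<partial>lborel) \<longlonglongrightarrow>
      (\<integral>t. (\<alpha>' t * gauss_test b t) * g t \<partial>lborel)"
    by (intro L2_tendsto_integral gL2 gaussian_decay_L2 D1' D2' D3')
  \<comment> \<open>For fixed \<open>n\<close> the exponential terms agree by \<open>eq\<close>, and
    both quotients subtract the same pairing of \<open>g\<close> with the test function, the
    relation at \<open>z = 0\<close>.\<close>
  have "(\<integral>t. T (\<lambda>t. (e n t - 1) / of_real (s n) * gaussian Z t) t * gauss_test b t \<partial>lborel) =
      (\<integral>t. ((e' n t - 1) / of_real (s n) * gauss_test b t) * g t \<partial>lborel)" for n
  proof -
    define k where "k = 1 / complex_of_real (s n)"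
    have TeL2: "T (\<lambda>t. e n t * gaussian Z t) \<in> L2" by (rule bounded_L2_operatorD(1)[OF T eL2])
    have int: "integrable lborel (\<lambda>t. g t * gauss_test b t)"
      "integrable lborel (\<lambda>t. T (\<lambda>t. e n t * gaussian Z t) t * gauss_test b t)"
      using L2_Cauchy_Schwarz(1) gL2 TeL2 \<phi>L2 by blast+
    have int': "integrable lborel (\<lambda>t. g t * (e' n t * gauss_test b t))"
    proof -
      have "(\<lambda>t. of_real (s n) * ((e' n t - 1) / of_real (s n) * gauss_test b t) + 1 * gauss_test b t) \<in> L2"
        by (intro L2_lincomb gaussian_decay_L2 D1' gaussian_decay_gauss_test)
      then have "(\<lambda>t. e' n t * gauss_test b t) \<in> L2" using s[of n] by (simp add: left_diff_distrib)
      then show ?thesis using L2_Cauchy_Schwarz(1) gL2 by blast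
    qed
    have "AE t in lborel. T (\<lambda>t. k * (e n t * gaussian Z t) + (- k) * gaussian Z t) t =
        k * T (\<lambda>t. e n t * gaussian Z t) t + (- k) * g t"
      unfolding g_def by (rule bounded_L2_operatorD(2)[OF T eL2 \<Phi>L2])
    moreover have "(\<lambda>t. k * (e n t * gaussian Z t) + (- k) * gaussian Z t) =
        (\<lambda>t. (e n t - 1) / of_real (s n) * gaussian Z t)"
      unfolding k_def by (simp add: diff_divide_distrib left_diff_distrib)
    ultimately have "AE t in lborel. T (\<lambda>t. (e n t - 1) / of_real (s n) * gaussian Z t) t * gauss_test b t =
        (k * T (\<lambda>t. e n t * gaussian Z t) t + (- k) * g t) * gauss_test b t" by auto
    then have "(\<integral>t. T (\<lambda>t. (e n t - 1) / of_real (s n) * gaussian Z t) t * gauss_test b t \<partial>lborel) =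
        (\<integral>t. (k * T (\<lambda>t. e n t * gaussian Z t) t + (- k) * g t) * gauss_test b t \<partial>lborel)"
      using L2_measurable[OF TeL2] L2_measurable[OF gL2] L2_measurable[OF \<phi>L2]
        L2_measurable[OF bounded_L2_operatorD(1)[OF T gaussian_decay_L2[OF D1[of n]]]]
      by (intro integral_cong_AE) auto
    also have "\<dots> = (\<integral>t. k * (T (\<lambda>t. e n t * gaussian Z t) t * gauss_test b t) - k * (g t * gauss_test b t) \<partial>lborel)"
      by (simp add: algebra_simps)
    also have "\<dots> = k * (\<integral>t. g t * (e' n t * gauss_test b t) \<partial>lborel) - k * (\<integral>t. g t * gauss_test b t \<partial>lborel)"
      using int by (simp add: eq)
    also have "\<dots> = (\<integral>t. k * (g t * (e' n t * gauss_test b t)) - k * (g t * gauss_test b t) \<partial>lborel)"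
      using int int' by simp
    also have "\<dots> = (\<integral>t. ((e' n t - 1) / of_real (s n) * gauss_test b t) * g t \<partial>lborel)"
      unfolding k_def by (intro Bochner_Integration.integral_cong refl)
        (simp add: diff_divide_distrib algebra_simps)
    finally show ?thesis .
  qed
  from LIMSEQ_unique[OF lhs[unfolded this] rhs] show ?thesis
    unfolding \<alpha>_def \<alpha>'_def g_def by (simp add: mult.commute)
qed

section \<open>The annihilation equation\<close>

text \<open>The weak form of \<open>(i N w - L w) \<cdot> \<nabla>G + 2 \<pi> (b \<cdot> L w) G = 0\<close> for the Bargmann-type transform
  \<open>G b = \<integral> g \<cdot> gauss_test b\<close>.\<close>

definition weakly_annihilated :: "(real^'d::finite \<Rightarrow> complex) \<Rightarrow> complex^'d^'d \<Rightarrow> complex^'d^'d \<Rightarrow> bool" where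
  "weakly_annihilated g L N \<longleftrightarrow> (\<forall>b w.
    (\<integral>t. g t * ((cdot b (L *v w) + cdot (\<i> *s (N *v w) - L *v w) (complex_vec t)) * gauss_test b t) \<partial>lborel) = 0)"

lemma gaussian_decay_affine_gauss_test:
  "gaussian_decay (\<lambda>t. (c + k * cdot a (complex_vec t)) * gauss_test b t)"
  by (intro gaussian_decay_mult[OF _ gaussian_decay_gauss_test] exp_growth_intros)

text \<open>The infinitesimal relation is applied to the real parts of \<open>(w, Z w)\<close> and
  to the imaginary parts, and the second copy is added with factor \<open>\<i>\<close>. On the left
  the combined linear form is \<open>Z w - Z w = 0\<close>; on the right the block products
  reassemble into \<open>L w\<close> and \<open>N w\<close>.\<close>

lemma intertwiner_weakly_annihilated:
  fixes A B C D Z :: "complex^'d::finite^'d"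
  assumes T: "bounded_L2_operator T" and ST: "intertwiner (block_matrix A B C D) T"
    and Z: "Z \<in> siegel_upper_half_space"
  shows "weakly_annihilated (T (gaussian Z)) (A + B ** Z) (C + D ** Z)"
  unfolding weakly_annihilated_def
proof (intro allI)
  fix b w :: "complex^'d"
  let ?S = "block_matrix A B C D"
  define g where "g = T (gaussian Z)"
  define re im :: "complex^'d \<Rightarrow> real^'d" where "re u = (\<chi> j. Re (u $ j))" and "im u = (\<chi> j. Im (u $ j))" for u
  have reim: "u = complex_vec (re u) + \<i> *s complex_vec (im u)" for u
    unfolding re_def im_def complex_vec_def by (simp add: vec_eq_iff complex_eq_iff)
  define u where "u = Z *v w"
  define join :: "real^'d \<Rightarrow> real^'d \<Rightarrow> real^('d + 'd)"
    where "join x y = (\<chi> i. case i of Inl k \<Rightarrow> x $ k | Inr k \<Rightarrow> y $ k)" for x y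
  have join: "position (join x y) = x" "momentum (join x y) = y" for x y
    unfolding join_def position_def momentum_def by (simp_all add: vec_eq_iff)
  have \<Phi>: "gaussian_decay (gaussian Z)" by (rule gaussian_decay_gaussian[OF Z])
  have gL2: "g \<in> L2" unfolding g_def by (rule bounded_L2_operatorD(1)[OF T gaussian_decay_L2[OF \<Phi>]])
  define p q a where "p x y = position (?S *v complex_vec (join x y))"
    and "q x y = momentum (?S *v complex_vec (join x y))" and "a x y = complex_vec y - Z *v complex_vec x" for x y
  define F where "F x y = (\<lambda>t. (0 + 2 * of_real pi * \<i> * cdot (a x y) (complex_vec t)) * gaussian Z t)" for x y
  define H where "H x y = (\<lambda>t. (2 * of_real pi * cdot b (p x y) +
      2 * of_real pi * cdot (\<i> *s q x y - p x y) (complex_vec t)) * gauss_test b t)" for x y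
  have inf: "(\<integral>t. T (F x y) t * gauss_test b t \<partial>lborel) = (\<integral>t. g t * H x y t \<partial>lborel)" for x y
    using infinitesimal_intertwining[OF T ST Z, of "join x y" b]
    unfolding p_def q_def a_def g_def join F_def H_def .
  have FL2: "F x y \<in> L2" for x y
    unfolding F_def by (intro gaussian_decay_L2 gaussian_decay_mult[OF _ \<Phi>] exp_growth_intros)
  have HL2: "gaussian_decay (H x y)" for x y
    unfolding H_def by (rule gaussian_decay_affine_gauss_test)
  have pq: "p x y = A *v complex_vec x + B *v complex_vec y" "q x y = C *v complex_vec x + D *v complex_vec y" for x y
    unfolding p_def q_def block_matrix_mult_vec position_complex_vec momentum_complex_vec join by simp_all
  let ?F1 = "F (re w) (re u)" and ?F2 = "F (im w) (im u)"
  let ?H1 = "H (re w) (re u)" and ?H2 = "H (im w) (im u)"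
  have zero: "AE t in lborel. T (\<lambda>s. 1 * ?F1 s + \<i> * ?F2 s) t = 0"
  proof -
    have "Z *v w = Z *v complex_vec (re w) + \<i> *s (Z *v complex_vec (im w))"
      by (subst reim[of w]) (simp add: matrix_vector_right_distrib vector_scalar_commute)
    then have "a (re w) (re u) + \<i> *s a (im w) (im u) = 0"
      unfolding a_def using reim[of u] unfolding u_def by (simp add: vec_eq_iff algebra_simps)
    then have "cdot (a (re w) (re u) + \<i> *s a (im w) (im u)) (complex_vec s) = 0" for s
      by (simp only: cdot_zero_left)
    then have "cdot (a (re w) (re u)) (complex_vec s) = - \<i> * cdot (a (im w) (im u)) (complex_vec s)" for s
      unfolding cdot_linear by (simp add: eq_neg_iff_add_eq_0)
    \<comment> \<open>The zero function is written as a trivial linear combination, so that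
      linearity of \<open>T\<close> gives \<open>T 0 = 0\<close> almost everywhere.\<close>
    then have "1 * ?F1 s + \<i> * ?F2 s = 0 * ?F1 s + 0 * ?F1 s" for s
      unfolding F_def by (simp add: algebra_simps)
    then have "(\<lambda>s. 1 * ?F1 s + \<i> * ?F2 s) = (\<lambda>s. 0 * ?F1 s + 0 * ?F1 s)" by blast
    then show ?thesis using bounded_L2_operatorD(2)[OF T FL2 FL2, of 0 "re w" "re u" 0 "re w" "re u"] by simp
  qed
  have "AE t in lborel. T ?F1 t * gauss_test b t + \<i> * (T ?F2 t * gauss_test b t) = 0"
    using bounded_L2_operatorD(2)[OF T FL2 FL2, of 1 "re w" "re u" \<i> "im w" "im u"] zero
    by eventually_elim (simp add: mult.assoc[symmetric] distrib_right[symmetric])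
  then have "(\<integral>t. T ?F1 t * gauss_test b t + \<i> * (T ?F2 t * gauss_test b t) \<partial>lborel) = 0"
    by (rule integral_eq_zero_AE)
  moreover have "integrable lborel (\<lambda>t. T (F x y) t * gauss_test b t)" for x y
    by (rule L2_times_gaussian_decay_integrable[OF bounded_L2_operatorD(1)[OF T FL2] gaussian_decay_gauss_test])
  ultimately have "(\<integral>t. g t * ?H1 t \<partial>lborel) + \<i> * (\<integral>t. g t * ?H2 t \<partial>lborel) = 0"
    unfolding inf[symmetric] by simp
  moreover have "integrable lborel (\<lambda>t. g t * H x y t)" for x y
    by (rule L2_times_gaussian_decay_integrable[OF gL2 HL2])
  ultimately have "(\<integral>t. g t * ?H1 t + \<i> * (g t * ?H2 t) \<partial>lborel) = 0" by simp
  moreover have "g t * ?H1 t + \<i> * (g t * ?H2 t) = 2 * of_real pi * (g t *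
      ((cdot b ((A + B ** Z) *v w) + cdot (\<i> *s ((C + D ** Z) *v w) - (A + B ** Z) *v w) (complex_vec t)) * gauss_test b t))" for t
  proof -
    have m: "(X + Y ** Z) *v w = (X *v complex_vec (re w) + Y *v complex_vec (re u)) +
        \<i> *s (X *v complex_vec (im w) + Y *v complex_vec (im u))" for X Y
    proof -
      have "(X + Y ** Z) *v w = X *v (complex_vec (re w) + \<i> *s complex_vec (im w)) +
          Y *v (complex_vec (re u) + \<i> *s complex_vec (im u))"
        unfolding reim[symmetric] u_def
        by (simp add: matrix_vector_mult_add_rdistrib matrix_vector_mul_assoc)
      then show ?thesis
        by (simp add: matrix_vector_right_distrib vector_scalar_commute vector_add_ldistrib)
    qed
    show ?thesis unfolding H_def pq m cdot_linear by (simp add: algebra_simps)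
  qed
  ultimately have "2 * of_real pi * (\<integral>t. g t *
      ((cdot b ((A + B ** Z) *v w) + cdot (\<i> *s ((C + D ** Z) *v w) - (A + B ** Z) *v w) (complex_vec t)) * gauss_test b t) \<partial>lborel) = 0"
    by (simp only: integral_mult_right_zero)
  then show "(\<integral>t. T (gaussian Z) t *
      ((cdot b ((A + B ** Z) *v w) + cdot (\<i> *s ((C + D ** Z) *v w) - (A + B ** Z) *v w) (complex_vec t)) * gauss_test b t) \<partial>lborel) = 0"
    unfolding g_def by simp
qed

text \<open>For \<open>L w = 0\<close> the annihilation operator is multiplication by the linear form \<open>N w \<cdot> t\<close>, which
  vanishes only on a null set.\<close>

lemma weakly_annihilated_kernel:
  assumes g: "g \<in> L2" and ann: "weakly_annihilated g L N" and Lw: "L *v w = 0" and Nw: "N *v w \<noteq> 0"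
  shows "AE t in lborel. g t = 0"
proof -
  define a where "a = \<i> *s (N *v w)"
  have a: "a \<noteq> 0" using Nw unfolding a_def by (simp add: vec_eq_iff)
  have "AE t in lborel. g t * (0 + 1 * cdot a (complex_vec t)) = 0"
  proof (rule AE_zero_of_gauss_test)
    show "integrable lborel (\<lambda>t. g t * (0 + 1 * cdot a (complex_vec t)) * gauss_test 0 t)"
      using L2_times_gaussian_decay_integrable[OF g gaussian_decay_affine_gauss_test[of 0 1 a 0]]
      by (simp add: mult.assoc)
    show "(\<integral>t. g t * (0 + 1 * cdot a (complex_vec t)) * gauss_test (\<i> *s complex_vec \<xi>) t \<partial>lborel) = 0" for \<xi>
      using ann[unfolded weakly_annihilated_def, rule_format, of "\<i> *s complex_vec \<xi>" w]
      unfolding Lw cdot_zero_right a_def by (simp add: mult.assoc)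
  qed
  with AE_cdot_complex_vec_nonzero[OF a] show ?thesis by eventually_elim simp
qed

section \<open>Integrating the annihilation equation along complex lines\<close>

lemma has_vector_derivative_of_quotient:
  assumes "((\<lambda>h. (f (x + h) - f x) /\<^sub>R h) \<longlongrightarrow> D) (at 0)"
  shows "(f has_vector_derivative D) (at x)"
  unfolding has_vector_derivative_def has_derivative_at
proof
  show "bounded_linear (\<lambda>h. h *\<^sub>R D)" by (rule bounded_linear_scaleR_left)
  have "((\<lambda>h. norm ((f (x + h) - f x) /\<^sub>R h - D)) \<longlongrightarrow> 0) (at 0)"
    by (rule tendsto_norm_zero[OF LIM_zero[OF assms]])
  moreover have "eventually (\<lambda>h. norm ((f (x + h) - f x) /\<^sub>R h - D) =
      norm (f (x + h) - f x - h *\<^sub>R D) / norm h) (at 0)"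
  proof -
    have "norm ((f (x + h) - f x) /\<^sub>R h - D) = norm (f (x + h) - f x - h *\<^sub>R D) / norm h" if "h \<noteq> 0" for h
    proof -
      have "(f (x + h) - f x) /\<^sub>R h - D = (f (x + h) - f x - h *\<^sub>R D) /\<^sub>R h"
        using that by (simp add: scaleR_diff_right)
      then show ?thesis by (simp add: divide_inverse mult.commute)
    qed
    then show ?thesis by (auto simp: eventually_at_filter)
  qed
  ultimately show "((\<lambda>h. norm (f (x + h) - f x - h *\<^sub>R D) / norm h) \<longlongrightarrow> 0) (at 0)"
    by (rule Lim_transform_eventually)
qed

text \<open>Along \<open>s \<mapsto> b + s v\<close> the equation is a linear ordinary differential equation for \<open>G\<close>; this is its
  solution at \<open>s = 1\<close>.\<close>

lemma weakly_annihilated_flow: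
  assumes g: "g \<in> L2" and ann: "weakly_annihilated g L N"
  defines "v \<equiv> \<lambda>w. \<i> *s (N *v w) - L *v w"
  shows "(\<integral>t. g t * gauss_test (b + v w) t \<partial>lborel) *
      exp (2 * of_real pi * cdot b (L *v w) + of_real pi * cdot (v w) (L *v w)) =
    (\<integral>t. g t * gauss_test b t \<partial>lborel)"
proof -
  define c where "c s = b + of_real s *s v w" for s :: real
  define G where "G s = (\<integral>t. gauss_test (c s) t * g t \<partial>lborel)" for s
  \<comment> \<open>The integrating factor: its logarithmic derivative is
    \<open>2 * pi * cdot (c s) (L *v w)\<close>, opposite to that of \<open>G\<close>, so
    \<open>G * E\<close> is constant.\<close>
  define E where "E s = exp (2 * of_real pi * of_real s * cdot b (L *v w) +
      of_real pi * (of_real s)\<^sup>2 * cdot (v w) (L *v w))" for s :: real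
  have G': "(G has_vector_derivative (- 2 * of_real pi * cdot (c s) (L *v w) * G s)) (at s)" for s
  proof -
    define \<alpha> where "\<alpha> t = 0 + 2 * of_real pi * cdot (v w) (complex_vec t)" for t
    have "((\<lambda>h. (G (s + h) - G s) /\<^sub>R h) \<longlongrightarrow> (\<integral>t. (\<alpha> t * gauss_test (c s) t) * g t \<partial>lborel)) (at 0)"
      unfolding tendsto_at_iff_sequentially
    proof (intro allI impI)
      \<comment> \<open>Moving \<open>s\<close> by \<open>X n\<close> multiplies the test function
        by an exponential that is exactly linear in \<open>X n\<close>; hence the sequential
        difference quotient applies with quadratic coefficient 0.\<close>
      fix X :: "nat \<Rightarrow> real"
      assume X: "\<forall>i. X i \<in> UNIV - {0}" "X \<longlonglongrightarrow> 0"
      have X': "X n \<noteq> 0" for n using X(1) by auto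
      note D1 = L2_difference_quotient(1)[OF X' X(2) gaussian_decay_gauss_test[of "c s"],
          where c=0 and k="2 * of_real pi" and a="v w" and \<beta>=0, folded \<alpha>_def]
      note D2 = L2_difference_quotient(2)[OF X' X(2) gaussian_decay_gauss_test[of "c s"],
          where c=0 and k="2 * of_real pi" and a="v w", folded \<alpha>_def]
      note D3 = L2_difference_quotient(3)[OF X' X(2) gaussian_decay_gauss_test[of "c s"],
          where c=0 and k="2 * of_real pi" and a="v w" and \<beta>=0, folded \<alpha>_def]
      have "(\<lambda>n. \<integral>t. ((exp (of_real (X n) * \<alpha> t + (of_real (X n))\<^sup>2 * 0) - 1) / of_real (X n) * gauss_test (c s) t) * g t \<partial>lborel) \<longlonglongrightarrow>
          (\<integral>t. (\<alpha> t * gauss_test (c s) t) * g t \<partial>lborel)"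
        by (intro L2_tendsto_integral g gaussian_decay_L2 D1 D2 D3)
      moreover have "(\<integral>t. ((exp (of_real (X n) * \<alpha> t + (of_real (X n))\<^sup>2 * 0) - 1) / of_real (X n) * gauss_test (c s) t) * g t \<partial>lborel) =
          (G (s + X n) - G s) /\<^sub>R X n" for n
      proof -
        have shift: "exp (of_real (X n) * \<alpha> t + (of_real (X n))\<^sup>2 * 0) * gauss_test (c s) t = gauss_test (c (s + X n)) t" for t
        proof -
          have "c (s + X n) = c s + of_real (X n) *s v w"
            unfolding c_def by (simp add: vec_eq_iff algebra_simps)
          then show ?thesis unfolding \<alpha>_def
            using gauss_test_mult_exp[of "of_real (X n) *s v w" t "c s"] by (simp add: cdot_scale_left mult.left_commute mult.assoc)
        qed
        have int: "integrable lborel (\<lambda>t. gauss_test b' t * g t)" for b'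
          using L2_times_gaussian_decay_integrable[OF g gaussian_decay_gauss_test[of b']] by (simp add: mult.commute)
        have e: "((exp (of_real (X n) * \<alpha> t + (of_real (X n))\<^sup>2 * 0) - 1) / of_real (X n) * gauss_test (c s) t) * g t =
            (1 / of_real (X n)) * (gauss_test (c (s + X n)) t * g t - gauss_test (c s) t * g t)" for t
          unfolding shift[symmetric] by (simp add: diff_divide_distrib algebra_simps)
        show ?thesis unfolding e G_def
          by (simp add: int scaleR_conv_of_real divide_inverse)
      qed
      ultimately show "((\<lambda>h. (G (s + h) - G s) /\<^sub>R h) \<circ> X) \<longlonglongrightarrow> (\<integral>t. (\<alpha> t * gauss_test (c s) t) * g t \<partial>lborel)"
        by (simp add: o_def)
    qed
    moreover have "(\<integral>t. (\<alpha> t * gauss_test (c s) t) * g t \<partial>lborel) = - 2 * of_real pi * cdot (c s) (L *v w) * G s"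
    proof -
      have i1: "integrable lborel (\<lambda>t. g t * ((0 + 1 * cdot (v w) (complex_vec t)) * gauss_test (c s) t))"
        by (rule L2_times_gaussian_decay_integrable[OF g gaussian_decay_affine_gauss_test])
      have i2: "integrable lborel (\<lambda>t. g t * gauss_test (c s) t)"
        by (rule L2_times_gaussian_decay_integrable[OF g gaussian_decay_gauss_test])
      have "0 = (\<integral>t. cdot (c s) (L *v w) * (g t * gauss_test (c s) t) +
          g t * ((0 + 1 * cdot (v w) (complex_vec t)) * gauss_test (c s) t) \<partial>lborel)"
        using ann[unfolded weakly_annihilated_def, rule_format, of "c s" w] unfolding v_def
        by (simp add: algebra_simps)
      also have "\<dots> = cdot (c s) (L *v w) * G s +
          (\<integral>t. g t * ((0 + 1 * cdot (v w) (complex_vec t)) * gauss_test (c s) t) \<partial>lborel)"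
        using i1 i2 unfolding G_def by (simp add: mult.commute)
      finally have "(\<integral>t. g t * ((0 + 1 * cdot (v w) (complex_vec t)) * gauss_test (c s) t) \<partial>lborel) = - cdot (c s) (L *v w) * G s"
        by (simp add: eq_neg_iff_add_eq_0 add.commute)
      moreover have "(\<integral>t. (\<alpha> t * gauss_test (c s) t) * g t \<partial>lborel) =
          (\<integral>t. 2 * of_real pi * (g t * ((0 + 1 * cdot (v w) (complex_vec t)) * gauss_test (c s) t)) \<partial>lborel)"
        unfolding \<alpha>_def by (simp add: mult_ac)
      ultimately show ?thesis by (simp only: integral_mult_right_zero) (simp add: mult_ac)
    qed
    ultimately show ?thesis by (metis has_vector_derivative_of_quotient)
  qed
  have E': "(E has_vector_derivative ((2 * of_real pi * cdot (c s) (L *v w)) * E s)) (at s)" for s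
  proof -
    have "((\<lambda>z. exp (2 * of_real pi * z * cdot b (L *v w) + of_real pi * z\<^sup>2 * cdot (v w) (L *v w)))
        has_field_derivative ((2 * of_real pi * cdot (c s) (L *v w)) * E s)) (at (complex_of_real s))"
      unfolding E_def c_def cdot_linear
      by (auto intro!: derivative_eq_intros simp: algebra_simps)
    from has_vector_derivative_real_field[OF this] show ?thesis
      unfolding E_def[abs_def] by (simp add: o_def)
  qed
  have "((\<lambda>s. G s * E s) has_vector_derivative 0) (at s)" for s
    using has_vector_derivative_mult[OF G'[of s] E'[of s]] by (simp add: algebra_simps)
  then obtain k where "\<And>s. G s * E s = k"
    using has_vector_derivative_zero_constant[of UNIV "\<lambda>s. G s * E s"] by auto
  then have "G 1 * E 1 = G 0 * E 0" by simp
  then show ?thesis unfolding G_def E_def c_def by (simp add: mult.commute)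
qed

section \<open>Translation covariance and identification with a Gaussian\<close>

lemma L2_shift:
  assumes "g \<in> L2"
  shows "(\<lambda>t. g (t + x)) \<in> L2"
proof -
  have m: "g \<in> borel_measurable borel" by (rule L2_measurable[OF assms])
  have "(\<lambda>t. (cmod (g t))\<^sup>2) \<in> borel_measurable borel" using m by measurable
  from lborel_integral_affine(3)[OF this, of x] have "integrable lborel (\<lambda>t. (cmod (g (t + x)))\<^sup>2)"
    using assms unfolding L2_def by simp
  moreover have "(\<lambda>t. g (t + x)) \<in> borel_measurable borel" using m by measurable
  ultimately show ?thesis unfolding L2_def by simp
qed

lemma gaussian_shift:
  assumes "transpose M = M"
  shows "gaussian M (t + x) = gaussian M t * exp (\<i> * of_real pi * cdot (M *v complex_vec x) (complex_vec x) +
      2 * of_real pi * \<i> * cdot (M *v complex_vec x) (complex_vec t))"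
  unfolding gaussian_def exp_add[symmetric] complex_vec_add matrix_vector_right_distrib cdot_linear
    cdot_symmetric_matrix[OF assms, of "complex_vec t" "complex_vec x"]
  by (rule arg_cong[of _ _ exp]) (simp add: algebra_simps)

text \<open>Here \<open>w\<close> may be complex, but \<open>L w\<close> is the real vector
  \<open>x\<close>. In the flow identity the displacement of the parameter is
  \<open>i N w - x\<close>. Matching it with the change of variable \<open>t + x\<close> identifies
  the pairings of the two sides for all imaginary parameters, up to a common weight.\<close>

lemma weakly_annihilated_translation:
  fixes x :: "real^'d::finite" and w :: "complex^'d"
  assumes g: "g \<in> L2" and ann: "weakly_annihilated g L N" and Lw: "L *v w = complex_vec x"
  shows "AE t in lborel. g (t + x) = g t *
    exp (\<i> * of_real pi * cdot (N *v w) (complex_vec x) + 2 * of_real pi * \<i> * cdot (N *v w) (complex_vec t))"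
proof -
  define y where "y = N *v w"
  define m where "m t = exp (\<i> * of_real pi * cdot y (complex_vec x) + 2 * of_real pi * \<i> * cdot y (complex_vec t))" for t
  \<comment> \<open>The weight by which a test function changes under a shift by \<open>x\<close>,
    up to the constant \<open>k\<close> below. It is common to both sides, never zero, and cancelled
    at the end.\<close>
  define n where "n t = exp (0 + (- 2 * of_real pi) * cdot (complex_vec x) (complex_vec t))" for t
  have "AE t in lborel. (g t * m t - g (t + x)) * n t = 0"
  proof (rule AE_zero_of_gauss_test)
    have gd: "gaussian_decay (\<lambda>t. m t * n t * gauss_test b t)" "gaussian_decay (\<lambda>t. n t * gauss_test b t)" for b
      unfolding m_def n_def by (intro gaussian_decay_mult gaussian_decay_gauss_test exp_growth_intros)+
    have int: "integrable lborel (\<lambda>t. g t * (m t * n t * gauss_test b t))"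
      "integrable lborel (\<lambda>t. g (t + x) * (n t * gauss_test b t))" for b
      by (intro L2_times_gaussian_decay_integrable gd L2_shift g)+
    have e: "(\<lambda>t. (g t * m t - g (t + x)) * n t * gauss_test b t) =
        (\<lambda>t. g t * (m t * n t * gauss_test b t) - g (t + x) * (n t * gauss_test b t))" for b
      by (simp add: algebra_simps)
    show "integrable lborel (\<lambda>t. (g t * m t - g (t + x)) * n t * gauss_test 0 t)"
      unfolding e using int by simp
    fix \<xi> :: "real^'d"
    define b where "b = \<i> *s complex_vec \<xi>"
    define v where "v = \<i> *s y - complex_vec x"
    define k where "k = exp (2 * of_real pi * cdot b (complex_vec x) - of_real pi * of_real (x \<bullet> x))"
    have "(\<integral>t. g t * gauss_test (b + v) t \<partial>lborel) *
        exp (2 * of_real pi * cdot b (complex_vec x) + of_real pi * cdot v (complex_vec x)) =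
        (\<integral>t. g t * gauss_test b t \<partial>lborel)"
      using weakly_annihilated_flow[OF g ann, of b w] unfolding Lw v_def y_def .
    moreover have "gauss_test (b + v) t * exp (2 * of_real pi * cdot b (complex_vec x) + of_real pi * cdot v (complex_vec x)) =
        k * (m t * n t * gauss_test b t)" for t
      unfolding k_def m_def n_def gauss_test_def v_def cdot_linear cdot_complex_vec exp_add[symmetric]
      by (rule arg_cong[of _ _ exp]) (simp add: algebra_simps)
    then have "g t * gauss_test (b + v) t * exp (2 * of_real pi * cdot b (complex_vec x) + of_real pi * cdot v (complex_vec x)) =
        k * (g t * (m t * n t * gauss_test b t))" for t
      by (metis mult.assoc mult.left_commute)
    then have "(\<integral>t. g t * gauss_test (b + v) t \<partial>lborel) *
        exp (2 * of_real pi * cdot b (complex_vec x) + of_real pi * cdot v (complex_vec x)) =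
        k * (\<integral>t. g t * (m t * n t * gauss_test b t) \<partial>lborel)"
      by (simp only: integral_mult_left_zero[symmetric] integral_mult_right_zero[symmetric])
    moreover have "(\<integral>t. g t * gauss_test b t \<partial>lborel) = (\<integral>t. g (t + x) * gauss_test b (t + x) \<partial>lborel)"
      using lborel_integral_affine(1)[of "\<lambda>t. g t * gauss_test b t" x] L2_measurable[OF g] gauss_test_measurable[of b]
      by simp
    moreover have "gauss_test b (t + x) = k * (n t * gauss_test b t)" for t
      unfolding k_def n_def gauss_test_def complex_vec_add cdot_linear cdot_complex_vec exp_add[symmetric]
      by (rule arg_cong[of _ _ exp]) (simp add: inner_add_left inner_add_right inner_commute algebra_simps)
    then have "(\<integral>t. g (t + x) * gauss_test b (t + x) \<partial>lborel) = k * (\<integral>t. g (t + x) * (n t * gauss_test b t) \<partial>lborel)"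
      by (simp add: mult.left_commute)
    ultimately have "k * (\<integral>t. g t * (m t * n t * gauss_test b t) \<partial>lborel) = k * (\<integral>t. g (t + x) * (n t * gauss_test b t) \<partial>lborel)"
      by simp
    then have "(\<integral>t. g t * (m t * n t * gauss_test b t) \<partial>lborel) = (\<integral>t. g (t + x) * (n t * gauss_test b t) \<partial>lborel)"
      unfolding k_def by simp
    then show "(\<integral>t. (g t * m t - g (t + x)) * n t * gauss_test (\<i> *s complex_vec \<xi>) t \<partial>lborel) = 0"
      unfolding e using int unfolding b_def by simp
  qed
  then show ?thesis unfolding m_def n_def y_def by eventually_elim simp
qed

text \<open>With \<open>w\<close> the inverse of \<open>L\<close> applied to \<open>x\<close>, the
  vector \<open>N w\<close> equals \<open>M x\<close>. The factor gained by \<open>g\<close> under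
  translation is then the one in \<open>gaussian_shift\<close>, so it cancels in the
  quotient.\<close>

lemma weakly_annihilated_gaussian:
  fixes g :: "real^'d::finite \<Rightarrow> complex"
  assumes g: "g \<in> L2" and ann: "weakly_annihilated g L N" and L: "invertible L"
    and sym: "transpose (N ** matrix_inv L) = N ** matrix_inv L"
  shows "\<exists>c. AE t in lborel. g t = c * gaussian (N ** matrix_inv L) t"
proof -
  let ?M = "N ** matrix_inv L"
  have nz: "gaussian ?M t \<noteq> 0" for t unfolding gaussian_def by simp
  have "\<exists>c. AE t in lborel. g t / gaussian ?M t = c"
  proof (rule translation_invariant_AE_const)
    show "(\<lambda>t. g t / gaussian ?M t) \<in> borel_measurable borel"
      using L2_measurable[OF g] gaussian_measurable[of ?M] by measurable
    fix x :: "real^'d"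
    define w where "w = matrix_inv L *v complex_vec x"
    have Lw: "L *v w = complex_vec x"
      unfolding w_def matrix_vector_mul_assoc matrix_inv_right[OF L] by simp
    have Nw: "N *v w = ?M *v complex_vec x" unfolding w_def by (simp add: matrix_vector_mul_assoc)
    show "AE t in lborel. g (t + x) / gaussian ?M (t + x) = g t / gaussian ?M t"
      using weakly_annihilated_translation[OF g ann Lw] unfolding gaussian_shift[OF sym] Nw
      by eventually_elim simp
  qed
  then obtain c where "AE t in lborel. g t / gaussian ?M t = c" by blast
  then have "AE t in lborel. g t = c * gaussian ?M t" by eventually_elim (use nz in \<open>simp add: divide_eq_eq\<close>)
  then show ?thesis ..
qed

text \<open>Along a direction \<open>x\<close> with \<open>Y x \<cdot> x \<le> 0\<close> the function \<open>exp (- 2 \<pi> Y t \<cdot> t)\<close> would keep a fixed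
  amount of mass in the translated balls \<open>ball (n x) 1\<close>.\<close>

lemma gaussian_L2_imp_siegel:
  fixes M :: "complex^'d::finite^'d"
  assumes sym: "transpose M = M" and int: "integrable lborel (\<lambda>t. (cmod (gaussian M t))\<^sup>2)"
  shows "M \<in> siegel_upper_half_space"
proof -
  define Y :: "real^'d^'d" where "Y = (\<chi> i j. Im (M $ i $ j))"
  define Q where "Q t = t \<bullet> (Y *v t)" for t
  define q where "q t = exp (- 2 * pi * Q t)" for t
  have q: "(cmod (gaussian M t))\<^sup>2 = q t" for t
    unfolding norm_gaussian q_def Q_def Y_def exp_of_nat_mult[symmetric] by simp
  have qi: "integrable lborel q" using int unfolding q .
  have qpos: "q t > 0" for t unfolding q_def by simp
  have qm: "q \<in> borel_measurable borel" using qi by auto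
  have "Q x > 0" if x: "x \<noteq> 0" for x
  proof (rule ccontr)
    assume "\<not> Q x > 0"
    then have Qx: "Q x \<le> 0" by simp
    define B where "B = ball (0 :: real^'d) 1"
    define I where "I t = indicat_real B t" for t
    have Im: "I \<in> borel_measurable borel" unfolding I_def B_def by (intro borel_measurable_indicator) simp
    have I01: "0 \<le> I t" "I t \<le> 1" for t unfolding I_def by (auto simp: indicator_def)
    have Isym: "I (- t) = I t" for t unfolding I_def B_def by (simp add: indicator_def)
    have qint: "integrable lborel (\<lambda>t. I (h t) * q t)" if "h \<in> borel_measurable borel" for h
    proof (rule Bochner_Integration.integrable_bound[OF qi])
      show "(\<lambda>t. I (h t) * q t) \<in> borel_measurable lborel"
        using that Im qm by measurable
      show "AE t in lborel. norm (I (h t) * q t) \<le> norm (q t)"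
        using I01 qpos by (intro AE_I2) (simp add: abs_mult mult_left_le_one_le less_imp_le)
    qed
    \<comment> \<open>The mass of \<open>q\<close> in the unit ball around \<open>n x\<close>; it
      tends to 0 because \<open>q\<close> is integrable and the balls leave every point.\<close>
    define H where "H n = (\<integral>t. I (t - real n *\<^sub>R x) * q t \<partial>lborel)" for n
    have "H \<longlonglongrightarrow> integral\<^sup>L lborel (\<lambda>t::real^'d. 0)"
      unfolding H_def
    proof (rule integral_dominated_convergence[OF _ _ qi])
      show "(\<lambda>t. I (t - real n *\<^sub>R x) * q t) \<in> borel_measurable lborel" for n
        using qint[of "\<lambda>t. t - real n *\<^sub>R x"] by auto
      show "AE t in lborel. norm (I (t - real n *\<^sub>R x) * q t) \<le> q t" for n
        using I01 qpos by (intro AE_I2) (simp add: abs_mult mult_left_le_one_le less_imp_le)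
      show "AE t in lborel. (\<lambda>n. I (t - real n *\<^sub>R x) * q t) \<longlonglongrightarrow> 0"
      proof (intro AE_I2 tendsto_eventually eventually_sequentiallyI)
        fix t :: "real^'d" and n assume n: "nat \<lceil>(1 + norm t) / norm x\<rceil> \<le> n"
        then have "(1 + norm t) / norm x \<le> real n" by linarith
        then have "1 + norm t \<le> real n * norm x" using x by (simp add: divide_le_eq)
        moreover have "real n * norm x - norm t \<le> norm (t - real n *\<^sub>R x)"
          using norm_triangle_ineq2[of "real n *\<^sub>R x" t] by (simp add: norm_minus_commute)
        ultimately have "\<not> norm (t - real n *\<^sub>R x) < 1" by linarith
        then show "I (t - real n *\<^sub>R x) * q t = 0" unfolding I_def B_def by (simp add: indicator_def)
      qed
    qed auto
    then have H0: "H \<longlonglongrightarrow> 0" by simp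
    define \<delta> where "\<delta> = (\<integral>t. I t * q t \<partial>lborel)"
    have "\<delta> \<le> H n" for n
    proof -
      define c where "c = real n *\<^sub>R x"
      have m: "(\<lambda>t. I (t - c) * q t) \<in> borel_measurable borel" using qint[of "\<lambda>t. t - c"] by auto
      have i: "integrable lborel (\<lambda>t. I (t - c) * q t)" by (rule qint) measurable
      have H1: "H n = (\<integral>t. I t * q (t + c) \<partial>lborel)"
        using lborel_integral_affine(1)[OF m, of c] unfolding H_def c_def[symmetric] by simp
      have H2: "H n = (\<integral>t. I t * q (c - t) \<partial>lborel)"
        using lborel_integral_affine(2)[OF m, of c] unfolding H_def c_def[symmetric] by (simp add: Isym)
      have i1: "integrable lborel (\<lambda>t. I t * q (t + c))"
        using lborel_integral_affine(3)[OF m i, of c] by simp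
      have i2: "integrable lborel (\<lambda>t. I t * q (c - t))"
      proof -
        have "integrable (distr lborel borel uminus) (\<lambda>t. I t * q (t + c))" using i1 by (simp only: lborel_distr_uminus_euclidean)
        moreover have "(\<lambda>t. I t * q (t + c)) \<in> borel_measurable borel" using i1 by auto
        ultimately have "integrable lborel (\<lambda>t. I (- t) * q (- t + c))" by (subst (asm) integrable_distr_eq) auto
        then show ?thesis by (simp add: Isym)
      qed
      \<comment> \<open>The cross term of \<open>t\<close> and \<open>c\<close> in
        \<open>Q (t + c)\<close> has no definite sign. Averaging over \<open>t\<close> and
        \<open>- t\<close>, which preserves the ball, cancels it and leaves \<open>Q t + Q c\<close>
        with \<open>Q c \<le> 0\<close>.\<close>
      have "2 * \<delta> = (\<integral>t. 2 * (I t * q t) \<partial>lborel)" unfolding \<delta>_def by simp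
      also have "\<dots> \<le> (\<integral>t. I t * q (t + c) + I t * q (c - t) \<partial>lborel)"
      proof (rule integral_mono)
        show "integrable lborel (\<lambda>t. 2 * (I t * q t))" using qint[of "\<lambda>t. t"] by simp
        show "integrable lborel (\<lambda>t. I t * q (t + c) + I t * q (c - t))" using i1 i2 by simp
        fix t
        have "Q (t + c) + Q (c - t) = 2 * Q t + 2 * (real n)\<^sup>2 * Q x"
          unfolding Q_def c_def
          by (simp add: matrix_vector_right_distrib matrix_vector_mult_diff_distrib matrix_vector_mult_scaleR
              inner_add_left inner_add_right inner_diff_left inner_diff_right power2_eq_square, simp add: algebra_simps)
        moreover have "(real n)\<^sup>2 * Q x \<le> 0" using Qx by (simp add: mult_nonneg_nonpos)
        ultimately have le: "Q (t + c) + Q (c - t) \<le> 2 * Q t" by linarith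
        \<comment> \<open>Square roots of the two shifted values of \<open>q\<close>; the inequality
          \<open>2 u v \<le> u^2 + v^2\<close> converts the bound on the exponents into one on the
          masses.\<close>
        define u v where "u = exp (- pi * Q (t + c))" and "v = exp (- pi * Q (c - t))"
        have "q t \<le> u * v"
          unfolding q_def u_def v_def exp_add[symmetric] using mult_left_mono[OF le, of pi] by (simp add: algebra_simps)
        moreover have "2 * (u * v) \<le> u\<^sup>2 + v\<^sup>2" using sum_squares_bound[of u v] by simp
        moreover have "u\<^sup>2 = q (t + c)" "v\<^sup>2 = q (c - t)"
          unfolding u_def v_def q_def exp_of_nat_mult[symmetric] by simp_all
        ultimately have "2 * q t \<le> q (t + c) + q (c - t)" by linarith
        from mult_left_mono[OF this I01(1)[of t]]
        show "2 * (I t * q t) \<le> I t * q (t + c) + I t * q (c - t)" by (simp add: algebra_simps)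
      qed
      also have "\<dots> = 2 * H n" using i1 i2 H1 H2 by simp
      finally show ?thesis by simp
    qed
    then have "\<delta> \<le> 0" using LIMSEQ_le_const[OF H0] by blast
    moreover have "0 \<le> \<delta>" unfolding \<delta>_def using I01 qpos by (intro integral_nonneg_AE AE_I2) (simp add: less_imp_le)
    ultimately have "(\<integral>t. I t * q t \<partial>lborel) = 0" unfolding \<delta>_def by simp
    then have "AE t in lborel. I t * q t = 0"
      using qint[of "\<lambda>t. t"] I01 qpos
      by (subst (asm) integral_nonneg_eq_0_iff_AE) (auto simp: less_imp_le)
    then have "AE t in lborel. t \<notin> B"
      by eventually_elim (use qpos in \<open>auto simp: I_def indicator_def less_le\<close>)
    then have "B \<in> null_sets lborel"
      by (subst AE_iff_null_sets) (auto simp: B_def)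
    then have "negligible B"
      unfolding negligible_iff_null_sets by (rule null_sets_completionI)
    then show False using open_not_negligible[of B] unfolding B_def by auto
  qed
  then show ?thesis using sym unfolding siegel_upper_half_space_def Q_def Y_def by blast
qed

text \<open>For real \<open>z = (0, xi)\<close> the left side of the relation is \<open>T\<close> of
  a modulated Gaussian. On the right the complex action rests on the test function, so the integral
  still contains the factor \<open>T (gaussian Z)\<close> and vanishes.\<close>

lemma intertwiner_gaussian_nonzero:
  assumes T: "bounded_L2_operator T" and nz: "nonzero_L2_operator T" and ST: "intertwiner S T"
    and Z: "Z \<in> siegel_upper_half_space"
  shows "\<not> (AE t in lborel. T (gaussian Z) t = 0)"
proof
  assume zero: "AE t in lborel. T (gaussian Z) t = 0"
  have \<Phi>: "gaussian_decay (gaussian Z)" by (rule gaussian_decay_gaussian[OF Z])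
  have "AE t in lborel. T (\<lambda>s. exp (2 * of_real pi * \<i> * of_real (\<xi> \<bullet> s)) * gaussian Z s) t = 0" for \<xi>
  proof -
    define z :: "real^('a + 'a)" where "z = (\<chi> i. case i of Inl k \<Rightarrow> 0 | Inr k \<Rightarrow> \<xi> $ k)"
    have z: "position z = 0" "momentum z = \<xi>"
      unfolding z_def position_def momentum_def by (simp_all add: vec_eq_iff)
    define f where "f = (\<lambda>s. exp (2 * of_real pi * \<i> * of_real (\<xi> \<bullet> s)) * gaussian Z s)"
    have rho: "rho_L2 z 0 (gaussian Z) = f"
      unfolding rho_L2_def z f_def by simp
    have fd: "gaussian_decay f"
    proof -
      have "f = (\<lambda>s. exp (0 + 2 * of_real pi * \<i> * cdot (complex_vec \<xi>) (complex_vec s)) * gaussian Z s)"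
        unfolding f_def cdot_complex_vec by simp
      then show ?thesis using gaussian_decay_mult[OF exp_growth_exp_cdot \<Phi>] by metis
    qed
    have TfL2: "T f \<in> L2" by (rule bounded_L2_operatorD(1)[OF T gaussian_decay_L2[OF fd]])
    have "(\<integral>t. T f t * gauss_test b t \<partial>lborel) = 0" for b
    proof -
      have "(\<integral>t. T (gaussian Z) t * h t \<partial>lborel) = 0" for h
        by (rule integral_eq_zero_AE) (use zero in \<open>eventually_elim, simp\<close>)
      then show ?thesis
        using intertwiner_gauss_test[OF ST gaussian_decay_L2[OF \<Phi>], of z 0 b] unfolding rho rho_dual_gauss_test by simp
    qed
    then show ?thesis unfolding f_def[symmetric]
      by (intro AE_zero_of_gauss_test L2_times_gaussian_decay_integrable[OF TfL2 gaussian_decay_gauss_test])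
  qed
  moreover have "gaussian Z t \<noteq> 0" for t unfolding gaussian_def by simp
  ultimately show False
    using bounded_L2_operator_zero[OF T \<Phi>] nz unfolding nonzero_L2_operator_def by blast
qed

theorem proposition4p3:
  fixes A B C D Z :: "complex^'d::finite^'d"
    and S :: "complex^('d + 'd)^('d + 'd)"
    and T :: "(real^'d \<Rightarrow> complex) \<Rightarrow> (real^'d \<Rightarrow> complex)"
  assumes "S = block_matrix A B C D"
    and "S \<in> Sp"
    and "bounded_L2_operator T"
    and "nonzero_L2_operator T"
    and "intertwiner S T"
    and "Z \<in> siegel_upper_half_space"
  shows "let L = A + B ** Z; N = C + D ** Z; M = N ** matrix_inv L in
           invertible L \<and>
           M \<in> siegel_upper_half_space \<and>
           (\<exists>c. c \<noteq> 0 \<and> (AE t in lborel. T (gaussian Z) t = c * gaussian M t))"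
proof -
  define L N M where "L = A + B ** Z" and "N = C + D ** Z" and "M = N ** matrix_inv L"
  define g where "g = T (gaussian Z)"
  have Zsym: "transpose Z = Z" using assms(6) unfolding siegel_upper_half_space_def by blast
  note frame = Lagrangian_frame[OF assms(2)[unfolded assms(1)] Zsym, folded L_def N_def]
  have gL2: "g \<in> L2"
    unfolding g_def by (intro bounded_L2_operatorD(1)[OF assms(3)] gaussian_decay_L2 gaussian_decay_gaussian assms(6))
  have ann: "weakly_annihilated g L N"
    unfolding g_def L_def N_def
    by (rule intertwiner_weakly_annihilated[OF assms(3) assms(5)[unfolded assms(1)] assms(6)])
  have gnz: "\<not> (AE t in lborel. g t = 0)"
    unfolding g_def by (rule intertwiner_gaussian_nonzero[OF assms(3-6)])
  have "w = 0" if Lw: "L *v w = 0" for w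
  proof -
    \<comment> \<open>Otherwise the linear form of \<open>N w\<close> would force \<open>g\<close>
      to vanish; the second frame identity applied to \<open>w\<close> then leaves
      \<open>w = 0\<close>.\<close>
    have "N *v w = 0" using weakly_annihilated_kernel[OF gL2 ann Lw] gnz by blast
    moreover have "transpose D *v (L *v w) = w + transpose B *v (N *v w)"
      using arg_cong[OF frame(2), of "\<lambda>X. X *v w"]
      by (simp add: matrix_vector_mul_assoc matrix_vector_mult_add_rdistrib)
    ultimately show "w = 0" using Lw by simp
  qed
  then have L: "invertible L"
    using matrix_left_invertible_ker[of L] invertible_left_inverse[of L] by blast
  have Msym: "transpose M = M"
    unfolding M_def by (rule symmetric_quotient[OF L frame(1)])
  obtain c where c: "AE t in lborel. g t = c * gaussian M t"
    using weakly_annihilated_gaussian[OF gL2 ann L] Msym unfolding M_def by blast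
  have c0: "c \<noteq> 0"
  proof
    assume "c = 0"
    then show False using c gnz by simp
  qed
  \<comment> \<open>Dividing by the nonzero constant \<open>c\<close> transfers square integrability
    from \<open>g\<close> to the Gaussian of \<open>M\<close>, the input for positivity of its
    imaginary part.\<close>
  have "integrable lborel (\<lambda>t. (cmod (gaussian M t))\<^sup>2)"
  proof (rule integrable_cong_AE_imp)
    show "integrable lborel (\<lambda>t. (cmod (g t))\<^sup>2 / (cmod c)\<^sup>2)" using gL2 unfolding L2_def by simp
    show "(\<lambda>t. (cmod (gaussian M t))\<^sup>2) \<in> borel_measurable lborel" using gaussian_measurable[of M] by measurable
    show "AE t in lborel. (cmod (g t))\<^sup>2 / (cmod c)\<^sup>2 = (cmod (gaussian M t))\<^sup>2"
      using c by eventually_elim (use c0 in \<open>simp add: norm_mult power_mult_distrib\<close>)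
  qed
  then have "M \<in> siegel_upper_half_space" by (rule gaussian_L2_imp_siegel[OF Msym])
  then show ?thesis using L c c0 unfolding Let_def g_def M_def L_def N_def by blast
qed

end
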